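(* Let $(M,\mathcal F)$ be a Finsler space with $M$ admitting a global coordinate system $(u^i)$ (induced coordinates $((x^i),(y^i))$ on $TM$), and let $X=X^s\,\partial/\partial u^s$ be a vector field on $M$ with (global) flow $\varphi$. Then for every geodesic $\gamma$ of $\mathcal F$ and every $s$ the curve $t\mapsto\varphi(s,\gamma(t))$ is an extremal of the length functional (i.e. the flow takes geodesics into geodesics as point sets) if and only if the component functions $X^s$ satisfy on $TM\setminus\{0\}$, for $i=1,\dots,n$, $$\Big[\frac{\partial^2\mathcal F}{\partial x^s\partial x^i}-\frac{\partial^3\mathcal F}{\partial x^s\partial x^k\partial y^i}y^k-\frac{\partial^3\mathcal F}{\partial x^s\partial y^k\partial y^i}C^k\Big](X^s)^{\mathsf v}$$ $$+\Big[\Big(\frac{\partial^2\mathcal F}{\partial y^s\partial x^i}-\frac{\partial^2\mathcal F}{\partial y^i\partial x^s}\Big)y^r-\frac{\partial^2\mathcal F}{\partial y^s\partial y^i}C^r-\Big(\frac{\partial^3\mathcal F}{\partial y^s\partial x^k\partial y^i}y^k+\frac{\partial^3\mathcal F}{\partial y^s\partial y^k\partial y^i}C^k\Big)y^r\Big]\Big(\frac{\partial X^s}{\partial u^r}\Big)^{\mathsf v}$$ $$-\Big[\frac{\partial^2\mathcal F}{\partial y^s\partial y^i}y^my^r\Big]\Big(\frac{\partial^2X^s}{\partial u^m\partial u^r}\Big)^{\mathsf v}=0,$$ where $C^1,\dots,C^n$ are functions on $TM\setminus\{0\}$ satisfying $\frac{\partial^2\mathcal F}{\partial y^k\partial y^i}C^k=\frac{\partial\mathcal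 F}{\partial x^i}-\frac{\partial^2\mathcal F}{\partial x^k\partial y^i}y^k$ for $i=1,\dots,n$.
   Context: A Finsler function on $M$ is $\mathcal F\colon TM\to\mathbb R$ smooth and positive on $TM\setminus\{0\}$, positively $1$-homogeneous on each tangent space, and strongly convex ($\partial^2\mathcal F^2/\partial y^i\partial y^j$ positive definite). Induced coordinates on $TM$: $x^i=u^i\circ\tau$, $y^i(v)=v(u^i)$, $\tau\colon TM\to M$ the projection; $h^{\mathsf v}:=h\circ\tau$ for functions $h$ on $M$. Summation over repeated indices. The length functional is $\gamma\mapsto\int\mathcal F(\dot\gamma(t))\,dt$; its $C^2$ extremals are the solutions of $\frac{\partial\mathcal F}{\partial x^i}\circ\dot\gamma-\frac{d}{dt}\big(\frac{\partial\mathcal F}{\partial y^i}\circ\dot\gamma\big)=0$; a geodesic is an extremal of positive constant speed. *)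

theory Defs
  imports "HOL-Analysis.Analysis"
begin

text \<open>Coordinates: M is identified, via the global chart (u^i), with an open set
  U of a Euclidean space 'a (dimension n = DIM('a)); TM = U x 'a with induced
  coordinates (x,y). Coordinate indices are elements of Basis; the i-th
  coordinate of v is v \<bullet> i.\<close>

definition fpd :: "'a::euclidean_space \<Rightarrow> ('a \<Rightarrow> real) \<Rightarrow> 'a \<Rightarrow> real" where
  "fpd b f p = deriv (\<lambda>t. f (p + t *\<^sub>R b)) 0"

definition C_inf_on :: "'a::euclidean_space set \<Rightarrow> ('a \<Rightarrow> real) \<Rightarrow> bool" where
  "C_inf_on S f \<longleftrightarrow>
     (\<forall>bs. set bs \<subseteq> Basis \<longrightarrow>
        continuous_on S (foldr fpd bs f) \<and>
        (\<forall>b\<in>Basis. \<forall>p\<in>S.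
           ((\<lambda>t. foldr fpd bs f (p + t *\<^sub>R b)) has_real_derivative foldr fpd (b # bs) f p) (at 0)))"

text \<open>Directions of the induced coordinates x^i and y^i on TM = 'a x 'a.\<close>
definition dx :: "'a::euclidean_space \<Rightarrow> 'a \<times> 'a" where "dx i = (i, 0)"
definition dy :: "'a::euclidean_space \<Rightarrow> 'a \<times> 'a" where "dy i = (0, i)"

definition finsler_on :: "'a::euclidean_space set \<Rightarrow> ('a \<times> 'a \<Rightarrow> real) \<Rightarrow> bool" where
  "finsler_on U F \<longleftrightarrow>
     C_inf_on (U \<times> (UNIV - {0})) F \<and>
     (\<forall>x\<in>U. \<forall>v. v \<noteq> 0 \<longrightarrow> F (x, v) > 0) \<and>
     (\<forall>x\<in>U. \<forall>v. \<forall>c>0. F (x, c *\<^sub>R v) = c * F (x, v)) \<and>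
     (\<forall>x\<in>U. \<forall>v. v \<noteq> 0 \<longrightarrow> (\<forall>w. w \<noteq> 0 \<longrightarrow>
        (\<Sum>i\<in>Basis. \<Sum>j\<in>Basis.
           fpd (dy i) (fpd (dy j) (\<lambda>p. (F p)\<^sup>2)) (x, v) * (w \<bullet> i) * (w \<bullet> j)) > 0))"

definition global_flow :: "'a::euclidean_space set \<Rightarrow> ('a \<Rightarrow> 'a) \<Rightarrow> (real \<Rightarrow> 'a \<Rightarrow> 'a) \<Rightarrow> bool" where
  "global_flow U X \<phi> \<longleftrightarrow>
     (\<forall>p\<in>U. \<phi> 0 p = p \<and>
        (\<forall>s. \<phi> s p \<in> U \<and> ((\<lambda>s. \<phi> s p) has_vector_derivative X (\<phi> s p)) (at s)))"

definition C2_curve :: "real set \<Rightarrow> (real \<Rightarrow> 'a::euclidean_space) \<Rightarrow> bool" where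
  "C2_curve I \<gamma> \<longleftrightarrow>
     (\<exists>\<gamma>' \<gamma>''. (\<forall>t\<in>I. (\<gamma> has_vector_derivative \<gamma>' t) (at t) \<and>
                       (\<gamma>' has_vector_derivative \<gamma>'' t) (at t)) \<and>
               continuous_on I \<gamma>'')"

text \<open>Extremal of the length functional on the (open) parameter interval I:
  C^2 curve in U satisfying the Euler-Lagrange equations
  d/dt (dF/dy^i o gamma') = dF/dx^i o gamma'.\<close>
definition extremal :: "'a::euclidean_space set \<Rightarrow> ('a \<times> 'a \<Rightarrow> real) \<Rightarrow> real set \<Rightarrow> (real \<Rightarrow> 'a) \<Rightarrow> bool" where
  "extremal U F I \<gamma> \<longleftrightarrow>
     C2_curve I \<gamma> \<and> (\<forall>t\<in>I. \<gamma> t \<in> U) \<and>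
     (\<forall>i\<in>Basis. \<forall>t\<in>I.
        ((\<lambda>t. fpd (dy i) F (\<gamma> t, vector_derivative \<gamma> (at t))) has_real_derivative
            fpd (dx i) F (\<gamma> t, vector_derivative \<gamma> (at t))) (at t))"

definition geodesic :: "'a::euclidean_space set \<Rightarrow> ('a \<times> 'a \<Rightarrow> real) \<Rightarrow> real set \<Rightarrow> (real \<Rightarrow> 'a) \<Rightarrow> bool" where
  "geodesic U F I \<gamma> \<longleftrightarrow>
     extremal U F I \<gamma> \<and> (\<exists>c>0. \<forall>t\<in>I. F (\<gamma> t, vector_derivative \<gamma> (at t)) = c)"

definition flow_eq_lhs ::
  "('a::euclidean_space \<times> 'a \<Rightarrow> real) \<Rightarrow> ('a \<Rightarrow> 'a) \<Rightarrow> ('a \<times> 'a \<Rightarrow> 'a) \<Rightarrow> 'a \<Rightarrow> 'a \<Rightarrow> 'a \<Rightarrow> real" where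
  "flow_eq_lhs F X C i x y =
     (\<Sum>s\<in>Basis.
        (fpd (dx s) (fpd (dx i) F) (x, y)
         - (\<Sum>k\<in>Basis. fpd (dx s) (fpd (dx k) (fpd (dy i) F)) (x, y) * (y \<bullet> k))
         - (\<Sum>k\<in>Basis. fpd (dx s) (fpd (dy k) (fpd (dy i) F)) (x, y) * (C (x, y) \<bullet> k)))
        * (X x \<bullet> s))
   + (\<Sum>s\<in>Basis. \<Sum>r\<in>Basis.
        ((fpd (dy s) (fpd (dx i) F) (x, y) - fpd (dy i) (fpd (dx s) F) (x, y)) * (y \<bullet> r)
         - fpd (dy s) (fpd (dy i) F) (x, y) * (C (x, y) \<bullet> r)
         - (\<Sum>k\<in>Basis. fpd (dy s) (fpd (dx k) (fpd (dy i) F)) (x, y) * (y \<bullet> k)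
                      + fpd (dy s) (fpd (dy k) (fpd (dy i) F)) (x, y) * (C (x, y) \<bullet> k))
           * (y \<bullet> r))
        * fpd r (\<lambda>u. X u \<bullet> s) x)
   - (\<Sum>s\<in>Basis. \<Sum>m\<in>Basis. \<Sum>r\<in>Basis.
        fpd (dy s) (fpd (dy i) F) (x, y) * (y \<bullet> m) * (y \<bullet> r)
        * fpd m (fpd r (\<lambda>u. X u \<bullet> s)) x)"

end

theory Submission
  imports Defs
begin

text \<open>
  Write the Euler-Lagrange expression as \<open>E(x, y, z) = F\<^sub>x - D(F\<^sub>y)(y, z)\<close>, so that a regular
  \<open>C\<^sup>2\<close> curve is extremal iff \<open>E(\<gamma>, \<gamma>', \<gamma>'') = 0\<close>. The flow of \<open>X\<close> acts on the 2-jet of a curve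
  through the complete lifts of \<open>X\<close>, and the left-hand side of the flow equation is the derivative
  of \<open>E\<close> along this action at \<open>z = C(x, y)\<close>. If the flow maps geodesics to extremals, differentiating
  \<open>E = 0\<close> in the flow parameter at a geodesic with arbitrary initial vector gives the equation.
  Conversely, the variation of \<open>E\<close> is affine in \<open>z\<close> and, by homogeneity, insensitive to adding
  multiples of \<open>y\<close>, while strong convexity bounds \<open>z - C(x, y)\<close> modulo \<open>y\<close> by \<open>E\<close>; so the equation
  yields \<open>|dE/ds| \<le> K |E|\<close> along the flow, and \<open>E\<close> stays zero by Gronwall's inequality.
\<close>

subsection \<open>Iterated partial derivatives\<close>

text \<open>The hypotheses give \<open>\<phi>\<close> only as a family of trajectories in
  \<open>s\<close>, whereas the curves \<open>\<lambda>t. \<phi> s (\<gamma> t)\<close> must be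
  shown to be twice differentiable in \<open>t\<close>. This regularity is recovered along curves:
  the differentiability theorem for trajectories is applied to \<open>X\<close> and then once more
  to its complete lift, which yields both \<open>t\<close>-derivatives together with the linear
  equations they satisfy in \<open>s\<close>. Smoothness itself means existence and continuity of
  iterated partial derivatives, so total differentiability and symmetry have to be derived first.
  The second obstacle is \<open>C\<close>. Since \<open>F\<close> is 1-homogeneous,
  \<open>F\<^sub>y\<^sub>y\<close> annihilates \<open>y\<close>; hence \<open>C\<close> is fixed
  only up to multiples of \<open>y\<close>, which may vary discontinuously, and it cannot serve as
  the right-hand side of a differential equation. Removing a suitable multiple of \<open>y\<close>
  leaves the one choice along which \<open>F\<close> is constant. That choice is locally Lipschitz,
  and its solutions are geodesics rather than mere extremals.\<close>

definition fd :: "('a::euclidean_space \<Rightarrow> real) \<Rightarrow> 'a \<Rightarrow> 'a \<Rightarrow> real" where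
  "fd f p v = (\<Sum>b\<in>Basis. fpd b f p * (v \<bullet> b))"

lemma C_inf_on_fpd:
  assumes "C_inf_on S f" "b \<in> Basis"
  shows "C_inf_on S (fpd b f)"
  unfolding C_inf_on_def
proof (intro allI impI)
  fix bs :: "'a list" assume "set bs \<subseteq> Basis"
  then have "set (bs @ [b]) \<subseteq> Basis" using assms(2) by auto
  from assms(1)[unfolded C_inf_on_def, rule_format, OF this]
  show "continuous_on S (foldr fpd bs (fpd b f)) \<and>
    (\<forall>c\<in>Basis. \<forall>p\<in>S. ((\<lambda>t. foldr fpd bs (fpd b f) (p + t *\<^sub>R c)) has_real_derivative
       foldr fpd (c # bs) (fpd b f) p) (at 0))"
    by simp
qed

lemma C_inf_on_continuous: "C_inf_on S f \<Longrightarrow> continuous_on S f"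
  unfolding C_inf_on_def by (metis empty_subsetI foldr_Nil id_apply list.set(1))

lemma C_inf_on_partial:
  assumes "C_inf_on S f" "b \<in> Basis" "p \<in> S"
  shows "((\<lambda>t. f (p + t *\<^sub>R b)) has_real_derivative fpd b f p) (at 0)"
proof -
  have "set [] \<subseteq> (Basis::'a set)" by simp
  from assms(1)[unfolded C_inf_on_def, rule_format, OF this]
  show ?thesis using assms(2,3) by auto
qed

lemma C_inf_on_partial_line:
  assumes "C_inf_on S f" "b \<in> Basis" "p + t *\<^sub>R b \<in> S"
  shows "((\<lambda>t. f (p + t *\<^sub>R b)) has_real_derivative fpd b f (p + t *\<^sub>R b)) (at t)"
proof -
  have "((\<lambda>u. f ((p + t *\<^sub>R b) + u *\<^sub>R b)) has_real_derivative fpd b f (p + t *\<^sub>R b)) (at 0)"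
    by (rule C_inf_on_partial[OF assms])
  then have "((\<lambda>u. f (p + (u + t) *\<^sub>R b)) has_real_derivative fpd b f (p + t *\<^sub>R b)) (at 0)"
    by (simp add: algebra_simps)
  then show ?thesis using DERIV_shift[of "\<lambda>u. f (p + u *\<^sub>R b)" _ 0 t] by simp
qed

lemma C_inf_on_line_mvt:
  fixes f :: "'a::euclidean_space \<Rightarrow> real"
  assumes f: "C_inf_on S f" and b: "b \<in> Basis" 
    and seg: "\<And>t. \<bar>t\<bar> \<le> \<bar>c\<bar> \<Longrightarrow> q + t *\<^sub>R b \<in> S"
  shows "\<exists>t. \<bar>t\<bar> \<le> \<bar>c\<bar> \<and> f (q + c *\<^sub>R b) - f q = c * fpd b f (q + t *\<^sub>R b)"
proof -
  have d: "((\<lambda>t. f (q + t *\<^sub>R b)) has_real_derivative fpd b f (q + t *\<^sub>R b)) (at t)" if "\<bar>t\<bar> \<le> \<bar>c\<bar>" for t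
    by (rule C_inf_on_partial_line[OF f b seg[OF that]])
  consider "c = 0" | "c > 0" | "c < 0" by linarith
  then show ?thesis
  proof cases
    case 1 then show ?thesis by auto
  next
    case 2
    obtain z where z: "0 < z" "z < c" 
        "f (q + c *\<^sub>R b) - f (q + 0 *\<^sub>R b) = (c - 0) * fpd b f (q + z *\<^sub>R b)"
      using MVT2[OF 2, of "\<lambda>t. f (q + t *\<^sub>R b)" "\<lambda>t. fpd b f (q + t *\<^sub>R b)"] d 2 by fastforce
    then show ?thesis by (intro exI[of _ z]) auto
  next
    case 3
    obtain z where z: "c < z" "z < 0" 
        "f (q + 0 *\<^sub>R b) - f (q + c *\<^sub>R b) = (0 - c) * fpd b f (q + z *\<^sub>R b)"
      using MVT2[OF 3, of "\<lambda>t. f (q + t *\<^sub>R b)" "\<lambda>t. fpd b f (q + t *\<^sub>R b)"] d 3 by fastforce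
    then show ?thesis by (intro exI[of _ z]) auto
  qed
qed

text \<open>Classical passage from continuous partial derivatives to total differentiability: the
  coordinates of \<open>v\<close> in \<open>B\<close> are changed one at a time (induction on
  \<open>B\<close>), the mean value theorem handles each segment, and continuity of the partial
  derivative at \<open>p\<close> replaces its intermediate value by the value at
  \<open>p\<close>.\<close>

lemma C_inf_on_strong_derivative:
  fixes f :: "'a::euclidean_space \<Rightarrow> real"
  assumes f: "C_inf_on S f" and S: "open S" and p: "p \<in> S" and e: "e > 0"
    and B: "B \<subseteq> Basis"
  shows "\<exists>d>0. \<forall>q v. dist q p < d \<longrightarrow> norm v < d \<longrightarrow> (\<forall>b\<in>Basis - B. v \<bullet> b = 0) \<longrightarrow>
     \<bar>f (q + v) - f q - (\<Sum>b\<in>B. fpd b f p * (v \<bullet> b))\<bar> \<le> e * (\<Sum>b\<in>B. \<bar>v \<bullet> b\<bar>)"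
proof -
  have "finite B" using B finite_Basis by (rule finite_subset)
  then show ?thesis using B
  proof (induction B rule: finite_induct)
    case empty
    have v: "v = 0" if "\<forall>b\<in>Basis. v \<bullet> b = 0" for v :: 'a
      by (rule euclidean_eqI) (use that in simp)
    show ?case
    proof (intro exI[of _ "1::real"] conjI allI impI)
      fix q v :: 'a assume "\<forall>b\<in>Basis - {}. v \<bullet> b = 0"
      then have "v = 0" using v by simp
      then show "\<bar>f (q + v) - f q - (\<Sum>b\<in>{}. fpd b f p * (v \<bullet> b))\<bar> \<le> e * (\<Sum>b\<in>{}. \<bar>v \<bullet> b\<bar>)" by simp
    qed simp
  next
    case (insert b B)
    then have b: "b \<in> Basis" and BB: "B \<subseteq> Basis" by auto
    from insert.IH[OF BB] obtain d where d: "d > 0" and 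
      dI': "\<forall>q v. dist q p < d \<longrightarrow> norm v < d \<longrightarrow> (\<forall>b\<in>Basis - B. v \<bullet> b = 0) \<longrightarrow>
     \<bar>f (q + v) - f q - (\<Sum>b\<in>B. fpd b f p * (v \<bullet> b))\<bar> \<le> e * (\<Sum>b\<in>B. \<bar>v \<bullet> b\<bar>)"
      by (elim exE conjE)
    note dI = dI'[rule_format]
    have "continuous_on S (fpd b f)" using C_inf_on_continuous C_inf_on_fpd f b by blast
    then have "continuous (at p) (fpd b f)" using S p continuous_on_eq_continuous_at by blast
    then obtain d1 where d1: "d1 > 0" "\<And>x. dist x p < d1 \<Longrightarrow> dist (fpd b f x) (fpd b f p) < e"
      using e unfolding continuous_at_eps_delta by meson
    obtain d2 where d2: "d2 > 0" "ball p d2 \<subseteq> S" using S p openE by blast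
    \<comment> \<open>The points met below lie within
      \<open>norm (q - p) + norm w + \<bar>c\<bar>\<close> of \<open>p\<close>, and
      \<open>norm w \<le> 2 * norm v\<close>. The total is less than \<open>r + 2 * r + r\<close>,
      whence the factor 4.\<close>
    define r where "r = min d (min d1 d2) / 4"
    have r: "r > 0" "4 * r \<le> d" "4 * r \<le> d1" "4 * r \<le> d2" using d d1 d2 by (auto simp: r_def)
    have "\<bar>f (q + v) - f q - (\<Sum>b\<in>insert b B. fpd b f p * (v \<bullet> b))\<bar> \<le> e * (\<Sum>b\<in>insert b B. \<bar>v \<bullet> b\<bar>)"
      if q: "dist q p < r" and v: "norm v < r" and v0: "\<forall>b\<in>Basis - insert b B. v \<bullet> b = 0" for q v
    proof -
      define c where "c = v \<bullet> b"
      define w where "w = v - c *\<^sub>R b"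
      have cn: "\<bar>c\<bar> \<le> norm v" unfolding c_def using Basis_le_norm[OF b] by blast
      have wn: "norm w \<le> 2 * norm v" 
        unfolding w_def using norm_triangle_ineq4[of v "c *\<^sub>R b"] cn b by simp
      have wb: "w \<bullet> j = (if j = b then 0 else v \<bullet> j)" if "j \<in> Basis" for j
        using that b by (auto simp: w_def c_def inner_diff_left inner_Basis)
      have 1: "\<bar>f (q + w) - f q - (\<Sum>b\<in>B. fpd b f p * (w \<bullet> b))\<bar> \<le> e * (\<Sum>b\<in>B. \<bar>w \<bullet> b\<bar>)"
        using q v r wn v0 wb by (intro dI) auto
      have sums: "(\<Sum>j\<in>B. fpd j f p * (w \<bullet> j)) = (\<Sum>j\<in>B. fpd j f p * (v \<bullet> j))"
        "(\<Sum>j\<in>B. \<bar>w \<bullet> j\<bar>) = (\<Sum>j\<in>B. \<bar>v \<bullet> j\<bar>)"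
        using insert.hyps BB wb by (auto intro!: sum.cong)
      have near: "dist (q + w + t *\<^sub>R b) p < 4 * r" if "\<bar>t\<bar> \<le> \<bar>c\<bar>" for t
      proof -
        have "dist (q + w + t *\<^sub>R b) p = norm ((q - p) + w + t *\<^sub>R b)" by (simp add: dist_norm algebra_simps)
        also have "\<dots> \<le> norm (q - p) + norm w + \<bar>t\<bar>" 
          using norm_triangle_ineq[of "(q - p) + w" "t *\<^sub>R b"] norm_triangle_ineq[of "q - p" w] b by simp
        also have "\<dots> < 4 * r" using q v wn cn that by (simp add: dist_norm)
        finally show ?thesis .
      qed
      have "q + w + t *\<^sub>R b \<in> S" if "\<bar>t\<bar> \<le> \<bar>c\<bar>" for t
        using near[OF that] r d2 by (auto simp: dist_commute subset_eq)
      from C_inf_on_line_mvt[OF f b this]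
      obtain t where t: "\<bar>t\<bar> \<le> \<bar>c\<bar>" "f (q + w + c *\<^sub>R b) - f (q + w) = c * fpd b f (q + w + t *\<^sub>R b)"
        by blast
      have "dist (fpd b f (q + w + t *\<^sub>R b)) (fpd b f p) < e"
        using near[OF t(1)] r by (intro d1) auto
      then have "\<bar>c * (fpd b f (q + w + t *\<^sub>R b) - fpd b f p)\<bar> \<le> \<bar>c\<bar> * e"
        by (simp add: abs_mult dist_real_def mult_left_mono)
      then have 2: "\<bar>f (q + v) - f (q + w) - fpd b f p * c\<bar> \<le> e * \<bar>c\<bar>"
        using t(2) by (simp add: w_def algebra_simps)
      have "f (q + v) - f q - (\<Sum>j\<in>insert b B. fpd j f p * (v \<bullet> j)) = 
        (f (q + v) - f (q + w) - fpd b f p * c) + (f (q + w) - f q - (\<Sum>j\<in>B. fpd j f p * (w \<bullet> j)))"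
        using insert.hyps by (simp add: sums c_def)
      also have "\<bar>\<dots>\<bar> \<le> e * \<bar>c\<bar> + e * (\<Sum>b\<in>B. \<bar>w \<bullet> b\<bar>)" using 1 2 by linarith
      also have "\<dots> = e * (\<Sum>b\<in>insert b B. \<bar>v \<bullet> b\<bar>)"
        using insert.hyps by (simp add: sums c_def algebra_simps)
      finally show ?thesis .
    qed
    then show ?case using r(1) by blast
  qed
qed

lemma linear_fd: "linear (fd f p)"
  unfolding fd_def
  by (rule linearI) (auto simp: inner_left_distrib algebra_simps sum.distrib sum_distrib_left)

lemma C_inf_on_has_derivative:
  fixes f :: "'a::euclidean_space \<Rightarrow> real"
  assumes f: "C_inf_on S f" and S: "open S" and p: "p \<in> S"
  shows "(f has_derivative fd f p) (at p)"
  unfolding has_derivative_at_alt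
proof (intro conjI allI impI)
  show "bounded_linear (fd f p)" using linear_fd by (rule linear_conv_bounded_linear[THEN iffD1])
  fix e :: real assume e: "e > 0"
  \<comment> \<open>Each of the \<open>DIM('a)\<close> coordinates of \<open>y - p\<close> is
    bounded by its norm, so the coordinate sum costs a factor \<open>DIM('a)\<close>.\<close>
  define e' where "e' = e / DIM('a)"
  have e': "e' > 0" using e by (simp add: e'_def)
  obtain d where d: "d > 0" and dI: "\<And>q v. dist q p < d \<Longrightarrow> norm v < d \<Longrightarrow> 
     \<bar>f (q + v) - f q - (\<Sum>b\<in>Basis. fpd b f p * (v \<bullet> b))\<bar> \<le> e' * (\<Sum>b\<in>Basis. \<bar>v \<bullet> b\<bar>)"
    using C_inf_on_strong_derivative[OF f S p e', of Basis] by auto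
  have "norm (f y - f p - fd f p (y - p)) \<le> e * norm (y - p)" if "norm (y - p) < d" for y
  proof -
    have "norm (f y - f p - fd f p (y - p)) \<le> e' * (\<Sum>b\<in>Basis. \<bar>(y - p) \<bullet> b\<bar>)"
      using dI[of p "y - p"] that d by (simp add: fd_def)
    also have "\<dots> \<le> e' * (\<Sum>b\<in>(Basis::'a set). norm (y - p))"
      using e' by (intro mult_left_mono sum_mono Basis_le_norm) auto
    also have "\<dots> = e * norm (y - p)" by (simp add: e'_def)
    finally show ?thesis .
  qed
  then show "\<exists>d>0. \<forall>y. norm (y - p) < d \<longrightarrow> norm (f y - f p - fd f p (y - p)) \<le> e * norm (y - p)"
    using d by blast
qed

lemma C_inf_on_chain:
  assumes "C_inf_on S f" "open S" "q s \<in> S" "(q has_vector_derivative q') (at s)"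
  shows "((\<lambda>s. f (q s)) has_real_derivative fd f (q s) q') (at s)"
  using vector_derivative_diff_chain_within[OF assms(4), of f "fd f (q s)"]
    has_derivative_at_withinI[OF C_inf_on_has_derivative[OF assms(1-3)]]
  by (simp add: has_real_derivative_iff_has_vector_derivative o_def)

lemma continuous_on_fd:
  assumes "C_inf_on S f" "continuous_on T q" "q ` T \<subseteq> S" "continuous_on T v"
  shows "continuous_on T (\<lambda>t. fd f (q t) (v t))"
  unfolding fd_def
  by (intro continuous_intros assms continuous_on_compose2[OF C_inf_on_continuous[OF C_inf_on_fpd[OF assms(1)]] assms(2)])
     (use assms in auto)

text \<open>The second difference over a square of side \<open>h\<close> is the increment of a first
  difference \<open>g\<close>. The mean value theorem is used on \<open>g\<close> in direction
  \<open>a\<close>, then on \<open>fpd a f\<close> in direction \<open>b\<close>.\<close>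

lemma mixed_difference_mvt:
  fixes f :: "'a::euclidean_space \<Rightarrow> real"
  assumes f: "C_inf_on S f" and a: "a \<in> Basis" and b: "b \<in> Basis" and h: "h > 0"
    and S: "\<And>s t. \<bar>s\<bar> \<le> h \<Longrightarrow> \<bar>t\<bar> \<le> h \<Longrightarrow> p + s *\<^sub>R a + t *\<^sub>R b \<in> S"
  shows "\<exists>s t. \<bar>s\<bar> \<le> h \<and> \<bar>t\<bar> \<le> h \<and>
     f (p + h *\<^sub>R a + h *\<^sub>R b) - f (p + h *\<^sub>R a) - f (p + h *\<^sub>R b) + f p
       = h * (h * fpd b (fpd a f) (p + s *\<^sub>R a + t *\<^sub>R b))"
proof -
  define g where "g s = f (p + h *\<^sub>R b + s *\<^sub>R a) - f (p + s *\<^sub>R a)" for s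
  have "(g has_real_derivative (fpd a f (p + h *\<^sub>R b + s *\<^sub>R a) - fpd a f (p + s *\<^sub>R a))) (at s)"
    if "0 \<le> s" "s \<le> h" for s
    unfolding g_def
    by (intro DERIV_diff C_inf_on_partial_line[OF f a])
       (use S[of s h] S[of s 0] that h in \<open>auto simp: algebra_simps\<close>)
  from MVT2[OF h this] obtain s where s: "0 < s" "s < h"
    "g h - g 0 = (h - 0) * (fpd a f (p + h *\<^sub>R b + s *\<^sub>R a) - fpd a f (p + s *\<^sub>R a))" by blast
  have "\<exists>t. \<bar>t\<bar> \<le> \<bar>h\<bar> \<and> fpd a f (p + s *\<^sub>R a + h *\<^sub>R b) - fpd a f (p + s *\<^sub>R a) 
      = h * fpd b (fpd a f) (p + s *\<^sub>R a + t *\<^sub>R b)"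
    by (rule C_inf_on_line_mvt[OF C_inf_on_fpd[OF f a] b]) (use S s h in auto)
  then obtain t where "\<bar>t\<bar> \<le> h" "fpd a f (p + s *\<^sub>R a + h *\<^sub>R b) - fpd a f (p + s *\<^sub>R a) 
      = h * fpd b (fpd a f) (p + s *\<^sub>R a + t *\<^sub>R b)" using h by auto
  then show ?thesis using s
    by (intro exI[of _ s] exI[of _ t]) (auto simp: g_def algebra_simps)
qed

text \<open>Schwarz's argument: the second difference is symmetric in \<open>a\<close> and
  \<open>b\<close>, and either order of the mean value theorem expresses it through one of the two
  mixed derivatives at a point near \<open>p\<close>. By continuity the two values at
  \<open>p\<close> cannot be \<open>2 * e\<close> apart.\<close>

lemma fpd_commute:
  fixes f :: "'a::euclidean_space \<Rightarrow> real"
  assumes f: "C_inf_on S f" and S: "open S" and p: "p \<in> S" and a: "a \<in> Basis" and b: "b \<in> Basis"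
  shows "fpd a (fpd b f) p = fpd b (fpd a f) p"
proof (rule ccontr)
  assume ne: "fpd a (fpd b f) p \<noteq> fpd b (fpd a f) p"
  define e where "e = \<bar>fpd a (fpd b f) p - fpd b (fpd a f) p\<bar> / 2"
  have e: "e > 0" using ne by (simp add: e_def)
  have cont: "continuous (at p) (fpd i (fpd j f))" if "i \<in> Basis" "j \<in> Basis" for i j
    using C_inf_on_continuous[OF C_inf_on_fpd[OF C_inf_on_fpd[OF f that(2)] that(1)]] S p
      continuous_on_eq_continuous_at by blast
  obtain d1 where d1: "d1 > 0" "\<And>x. dist x p < d1 \<Longrightarrow> dist (fpd a (fpd b f) x) (fpd a (fpd b f) p) < e"
    using cont[OF a b] e unfolding continuous_at_eps_delta by meson
  obtain d2 where d2: "d2 > 0" "\<And>x. dist x p < d2 \<Longrightarrow> dist (fpd b (fpd a f) x) (fpd b (fpd a f) p) < e"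
    using cont[OF b a] e unfolding continuous_at_eps_delta by meson
  obtain d3 where d3: "d3 > 0" "ball p d3 \<subseteq> S" using S p openE by blast
  define h where "h = min d1 (min d2 d3) / 3"
  have h: "h > 0" "2 * h < d1" "2 * h < d2" "2 * h < d3" using d1 d2 d3 by (auto simp: h_def)
  have near: "dist (p + s *\<^sub>R i + t *\<^sub>R j) p \<le> 2 * h" 
    if "\<bar>s\<bar> \<le> h" "\<bar>t\<bar> \<le> h" "i \<in> Basis" "j \<in> Basis" for s t i j
    using norm_triangle_ineq[of "s *\<^sub>R i" "t *\<^sub>R j"] that by (simp add: dist_norm)
  have inS: "p + s *\<^sub>R i + t *\<^sub>R j \<in> S" 
    if "\<bar>s\<bar> \<le> h" "\<bar>t\<bar> \<le> h" "i \<in> Basis" "j \<in> Basis" for s t i j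
    using near[OF that] h d3 by (auto simp: dist_commute subset_eq)
  obtain s t where st: "\<bar>s\<bar> \<le> h" "\<bar>t\<bar> \<le> h" 
     "f (p + h *\<^sub>R a + h *\<^sub>R b) - f (p + h *\<^sub>R a) - f (p + h *\<^sub>R b) + f p
       = h * (h * fpd b (fpd a f) (p + s *\<^sub>R a + t *\<^sub>R b))"
    using mixed_difference_mvt[OF f a b h(1) inS[OF _ _ a b]] by blast
  obtain s' t' where st': "\<bar>s'\<bar> \<le> h" "\<bar>t'\<bar> \<le> h" 
     "f (p + h *\<^sub>R b + h *\<^sub>R a) - f (p + h *\<^sub>R b) - f (p + h *\<^sub>R a) + f p
       = h * (h * fpd a (fpd b f) (p + s' *\<^sub>R b + t' *\<^sub>R a))"
    using mixed_difference_mvt[OF f b a h(1) inS[OF _ _ b a]] by blast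
  have "h * (h * fpd b (fpd a f) (p + s *\<^sub>R a + t *\<^sub>R b)) = h * (h * fpd a (fpd b f) (p + s' *\<^sub>R b + t' *\<^sub>R a))"
    unfolding st(3)[symmetric] st'(3)[symmetric] by (simp add: algebra_simps)
  then have "fpd b (fpd a f) (p + s *\<^sub>R a + t *\<^sub>R b) = fpd a (fpd b f) (p + s' *\<^sub>R b + t' *\<^sub>R a)"
    using h by simp
  moreover have "dist (fpd b (fpd a f) (p + s *\<^sub>R a + t *\<^sub>R b)) (fpd b (fpd a f) p) < e"
    using near[OF st(1,2) a b] h by (intro d2) auto
  moreover have "dist (fpd a (fpd b f) (p + s' *\<^sub>R b + t' *\<^sub>R a)) (fpd a (fpd b f) p) < e"
    using near[OF st'(1,2) b a] h by (intro d1) auto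
  ultimately show False unfolding e_def dist_real_def by (simp add: field_simps abs_if split: if_splits)
qed

subsection \<open>Dependence of trajectories on parameters\<close>

lemma has_vector_derivative_affine_arg:
  assumes "(u has_vector_derivative d) (at (c + k * s))"
  shows "((\<lambda>s. u (c + k * s)) has_vector_derivative k *\<^sub>R d) (at s)"
proof -
  have "((\<lambda>x. c + k * x) has_real_derivative k) (at s)"
    by (auto intro!: derivative_eq_intros)
  then have "((\<lambda>x. c + k * x) has_vector_derivative k) (at s)"
    by (simp only: has_real_derivative_iff_has_vector_derivative)
  from vector_diff_chain_at[OF this assms] show ?thesis by (simp only: o_def)
qed

text \<open>Squares avoid the failure of differentiability of the norm at 0. Since
  \<open>2 * norm (u s) * r\<close> is at most \<open>(norm (u s))\<^sup>2 + r\<^sup>2\<close>, the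
  quantity \<open>(norm (u s))\<^sup>2 + r\<^sup>2\<close> grows at rate at most
  \<open>2 * K + 1\<close>, which the exponential weight in \<open>w\<close> compensates.\<close>

lemma gronwall_nonneg:
  fixes u :: "real \<Rightarrow> 'a::real_inner"
  assumes s0: "0 \<le> s0"
    and u: "\<And>s. 0 \<le> s \<Longrightarrow> s \<le> s0 \<Longrightarrow> (u has_vector_derivative u' s) (at s)"
    and K: "K \<ge> 0"
    and le: "\<And>s. 0 \<le> s \<Longrightarrow> s \<le> s0 \<Longrightarrow> norm (u' s) \<le> K * norm (u s) + r"
  shows "(norm (u s0))\<^sup>2 \<le> ((norm (u 0))\<^sup>2 + r\<^sup>2) * exp ((2 * K + 1) * s0)"
proof -
  define w where "w s = ((norm (u s))\<^sup>2 + r\<^sup>2) * exp (- (2 * K + 1) * s)" for s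
  have w': "\<exists>y. (w has_real_derivative y) (at s) \<and> y \<le> 0" if s: "0 \<le> s" "s \<le> s0" for s
  proof -
    have n: "(\<lambda>s. (norm (u s))\<^sup>2) = (\<lambda>s. u s \<bullet> u s)" by (simp add: power2_norm_eq_inner)
    have "((\<lambda>s. u s \<bullet> u s) has_derivative (\<lambda>h. u s \<bullet> (h *\<^sub>R u' s) + (h *\<^sub>R u' s) \<bullet> u s)) (at s)"
      using u[OF s] unfolding has_vector_derivative_def by (rule has_derivative_inner[rotated]) (use u[OF s] in \<open>simp add: has_vector_derivative_def\<close>)
    then have d: "((\<lambda>s. (norm (u s))\<^sup>2) has_real_derivative 2 * (u s \<bullet> u' s)) (at s)"
      unfolding n has_field_derivative_def by (rule has_derivative_eq_rhs) (auto simp: inner_commute algebra_simps)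
    have dw: "(w has_real_derivative (2 * (u s \<bullet> u' s) - (2 * K + 1) * ((norm (u s))\<^sup>2 + r\<^sup>2)) * exp (- (2 * K + 1) * s)) (at s)"
      unfolding w_def by (rule derivative_eq_intros d refl)+ (simp add: algebra_simps)
    have "u s \<bullet> u' s \<le> norm (u s) * norm (u' s)" by (rule norm_cauchy_schwarz)
    also have "\<dots> \<le> norm (u s) * (K * norm (u s) + r)" by (rule mult_left_mono[OF le[OF s]]) simp
    finally have 1: "2 * (u s \<bullet> u' s) \<le> 2 * K * (norm (u s))\<^sup>2 + 2 * norm (u s) * r" 
      by (simp add: power2_eq_square algebra_simps)
    have "0 \<le> (norm (u s) - r)\<^sup>2" by simp
    then have 2: "2 * norm (u s) * r \<le> (norm (u s))\<^sup>2 + r\<^sup>2" by (simp add: power2_diff)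
    have 3: "2 * (u s \<bullet> u' s) \<le> (2 * K + 1) * (norm (u s))\<^sup>2 + r\<^sup>2"
      using 1 2 by (simp add: algebra_simps)
    have "(2 * K + 1) * (norm (u s))\<^sup>2 + 1 * r\<^sup>2 \<le> (2 * K + 1) * ((norm (u s))\<^sup>2 + r\<^sup>2)"
      unfolding distrib_left using K by (intro add_left_mono mult_right_mono) auto
    then have "2 * (u s \<bullet> u' s) - (2 * K + 1) * ((norm (u s))\<^sup>2 + r\<^sup>2) \<le> 0"
      using 3 by simp
    then show ?thesis using dw by (meson exp_ge_zero mult_nonpos_nonneg)
  qed
  have "w s0 \<le> w 0"
    by (rule DERIV_nonpos_imp_nonincreasing[OF s0]) (use w' in auto)
  then have "((norm (u s0))\<^sup>2 + r\<^sup>2) * exp (- (2 * K + 1) * s0) * exp ((2 * K + 1) * s0) \<le> ((norm (u 0))\<^sup>2 + r\<^sup>2) * exp ((2 * K + 1) * s0)"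
    unfolding w_def by (intro mult_right_mono) auto
  then have "(norm (u s0))\<^sup>2 + r\<^sup>2 \<le> ((norm (u 0))\<^sup>2 + r\<^sup>2) * exp ((2 * K + 1) * s0)"
    unfolding mult.assoc exp_add[symmetric] by (simp add: algebra_simps)
  then show ?thesis by (smt (verit) zero_le_power2)
qed
text \<open>The two conditions on \<open>s\<close> place it on the segment from 0 to
  \<open>s0\<close> for either sign of \<open>s0\<close>; a negative \<open>s0\<close> is treated by
  reversing time. Restricting the hypotheses to this segment is what makes the later first-exit
  argument possible.\<close>

lemma gronwall:
  fixes u :: "real \<Rightarrow> 'a::real_inner"
  assumes u: "\<And>s. \<bar>s\<bar> \<le> \<bar>s0\<bar> \<Longrightarrow> s * s0 \<ge> 0 \<Longrightarrow> (u has_vector_derivative u' s) (at s)"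
    and K: "K \<ge> 0"
    and le: "\<And>s. \<bar>s\<bar> \<le> \<bar>s0\<bar> \<Longrightarrow> s * s0 \<ge> 0 \<Longrightarrow> norm (u' s) \<le> K * norm (u s) + r"
  shows "(norm (u s0))\<^sup>2 \<le> ((norm (u 0))\<^sup>2 + r\<^sup>2) * exp ((2 * K + 1) * \<bar>s0\<bar>)"
proof (cases "s0 \<ge> 0")
  case True
  then show ?thesis using gronwall_nonneg[of s0 u u' K r] u K le by auto
next
  case False
  have "(norm (u (- (- s0))))\<^sup>2 \<le> ((norm (u (- 0)))\<^sup>2 + r\<^sup>2) * exp ((2 * K + 1) * (- s0))"
  proof (rule gronwall_nonneg[of "- s0" "\<lambda>s. u (- s)" "\<lambda>s. - u' (- s)"])
    fix s assume s: "0 \<le> s" "s \<le> - s0"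
    then have s': "\<bar>- s\<bar> \<le> \<bar>s0\<bar>" "(- s) * s0 \<ge> 0" by (auto simp: mult_le_0_iff)
    show "((\<lambda>s. u (- s)) has_vector_derivative - u' (- s)) (at s)"
      using has_vector_derivative_affine_arg[of u "u' (- s)" 0 "-1" s] u[OF s'] by simp
    show "norm (- u' (- s)) \<le> K * norm (u (- s)) + r" using le[OF s'] by simp
  qed (use False K in auto)
  then show ?thesis using False by simp
qed

text \<open>A zero at any time spreads in both directions. This serves to keep the Euler-Lagrange
  expression zero along the flow and, contrapositively, to keep a nonzero velocity nonzero.\<close>

lemma gronwall_zero:
  fixes u :: "real \<Rightarrow> 'a::real_inner"
  assumes u: "\<And>s. \<bar>s\<bar> \<le> T \<Longrightarrow> (u has_vector_derivative u' s) (at s)"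
    and le: "\<And>s. \<bar>s\<bar> \<le> T \<Longrightarrow> norm (u' s) \<le> K * norm (u s)"
    and s1: "\<bar>s1\<bar> \<le> T" and z: "u s1 = 0" and s2: "\<bar>s2\<bar> \<le> T"
  shows "u s2 = 0"
proof -
  have "(norm (u (s1 + (s2 - s1))))\<^sup>2 \<le> ((norm (u (s1 + 0)))\<^sup>2 + 0\<^sup>2) * exp ((2 * \<bar>K\<bar> + 1) * \<bar>s2 - s1\<bar>)"
  proof (rule gronwall[where u' = "\<lambda>s. u' (s1 + s)"])
    fix s assume s: "\<bar>s\<bar> \<le> \<bar>s2 - s1\<bar>" "0 \<le> s * (s2 - s1)"
    then have T: "\<bar>s1 + s\<bar> \<le> T" using s1 s2
      by (auto simp: zero_le_mult_iff abs_if split: if_splits)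
    show "((\<lambda>s. u (s1 + s)) has_vector_derivative u' (s1 + s)) (at s)"
      using has_vector_derivative_affine_arg[of u "u' (s1 + s)" s1 1 s] u[OF T] by simp
    have "K * norm (u (s1 + s)) \<le> \<bar>K\<bar> * norm (u (s1 + s))" by (rule mult_right_mono) auto
    then show "norm (u' (s1 + s)) \<le> \<bar>K\<bar> * norm (u (s1 + s)) + 0" using le[OF T] by simp
  qed simp
  then show ?thesis using z by simp
qed

text \<open>Here \<open>x\<close> ranges over \<open>K\<close>, but \<open>y\<close> is any point
  near \<open>x\<close>. Uniform continuity of \<open>V'\<close> is therefore taken on
  \<open>N\<close>, a compact neighbourhood of \<open>K\<close> inside \<open>W\<close>; the
  linearization error then follows from the mean value inequality on a ball.\<close>

lemma uniform_linearization:
  fixes V :: "'a::euclidean_space \<Rightarrow> 'b::euclidean_space" and V' :: "'a \<Rightarrow> 'a \<Rightarrow>\<^sub>L 'b"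
  assumes W: "open W" and V: "\<And>x. x \<in> W \<Longrightarrow> (V has_derivative V' x) (at x)"
    and V': "continuous_on W V'" and K: "compact K" "K \<subseteq> W" and e: "e > 0"
  obtains d where "d > 0" 
    "\<And>x y. x \<in> K \<Longrightarrow> dist x y < d \<Longrightarrow> norm (V' y - V' x) \<le> e"
    "\<And>x y. x \<in> K \<Longrightarrow> dist x y < d \<Longrightarrow> norm (V y - V x - V' x (y - x)) \<le> e * norm (y - x)"
proof -
  obtain d0 where d0: "d0 > 0" "(\<Union>x\<in>K. cball x d0) \<subseteq> W"
    using compact_subset_open_imp_cball_epsilon_subset[OF K(1) W K(2)] by auto
  define N where "N = (\<Union>x\<in>K. cball x d0)"
  have "N = {x + y |x y. x \<in> K \<and> y \<in> cball 0 d0}"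
    unfolding N_def by (auto simp: dist_norm) (metis add_diff_cancel_left' diff_add_cancel norm_minus_commute add.commute)
  then have "compact N" using compact_sums[OF K(1) compact_cball[of 0 d0]] by simp
  then have "uniformly_continuous_on N V'"
    using compact_uniformly_continuous V' d0 continuous_on_subset N_def by metis
  then obtain d1 where d1: "d1 > 0" "\<And>x y. x \<in> N \<Longrightarrow> y \<in> N \<Longrightarrow> dist y x < d1 \<Longrightarrow> dist (V' y) (V' x) < e"
    unfolding uniformly_continuous_on_def using e by metis
  define d where "d = min d0 d1"
  have "norm (V' y - V' x) \<le> e \<and> norm (V y - V x - V' x (y - x)) \<le> e * norm (y - x)"
    if x: "x \<in> K" and y: "dist x y < d" for x y
  proof -
    have B: "z \<in> N" "z \<in> W" "norm (V' z - V' x) \<le> e" if "z \<in> ball x d" for z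
    proof -
      show z: "z \<in> N" using that x by (auto simp: N_def d_def intro!: bexI[of _ x])
      then show "z \<in> W" using d0(2) unfolding N_def by blast
      have "x \<in> N" using x d0(1) unfolding N_def by (auto intro!: bexI[of _ x])
      then show "norm (V' z - V' x) \<le> e"
        using d1(2)[of x z] z that by (simp add: dist_norm d_def norm_minus_commute less_imp_le)
    qed
    have "norm (V y - V x - V' x (y - x)) \<le> norm (y - x) * e"
    proof (rule differentiable_bound_linearization[where S="ball x d" and f'="\<lambda>z. blinfun_apply (V' z)"])
      show "x + t *\<^sub>R (y - x) \<in> ball x d" if "t \<in> {0..1}" for t
      proof -
        have "norm (t *\<^sub>R (y - x)) \<le> norm (y - x)" using that by (simp add: mult_left_le_one_le)
        then show ?thesis using y by (simp add: dist_norm norm_minus_commute)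
      qed
      show "(V has_derivative V' z) (at z within ball x d)" if "z \<in> ball x d" for z
        using V[OF B(2)[OF that]] has_derivative_at_withinI by blast
      show "onorm (blinfun_apply (V' z) - blinfun_apply (V' x)) \<le> e" if "z \<in> ball x d" for z
        using B(3)[OF that] by (simp add: norm_blinfun.rep_eq minus_blinfun.rep_eq fun_diff_def)
      show "x \<in> ball x d" using d0 d1 by (simp add: d_def)
    qed
    then show ?thesis using B[of y] y by (simp add: mult.commute)
  qed
  moreover have "d > 0" using d0 d1 by (simp add: d_def)
  ultimately show thesis using that by simp
qed

text \<open>A Lipschitz constant of \<open>V\<close> is available only near the compact orbit
  \<open>K\<close>, so Gronwall applies only while the other trajectory stays in a tube around it
  (claim \<open>G\<close>). A first-exit argument removes this condition when the initial distance
  is small.\<close>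

lemma trajectory_dependence:
  fixes V :: "'a::euclidean_space \<Rightarrow> 'a" and V' :: "'a \<Rightarrow> 'a \<Rightarrow>\<^sub>L 'a"
  assumes W: "open W" and V: "\<And>x. x \<in> W \<Longrightarrow> (V has_derivative V' x) (at x)"
    and V': "continuous_on W V'" 
    and a0: "\<And>s. \<bar>s\<bar> \<le> T \<Longrightarrow> a0 s \<in> W" 
            "\<And>s. \<bar>s\<bar> \<le> T \<Longrightarrow> (a0 has_vector_derivative V (a0 s)) (at s)"
  obtains L \<delta> where "L \<ge> 0" "\<delta> > 0" 
    "\<And>a s. (\<And>s. \<bar>s\<bar> \<le> T \<Longrightarrow> a s \<in> W) \<Longrightarrow> (\<And>s. \<bar>s\<bar> \<le> T \<Longrightarrow> (a has_vector_derivative V (a s)) (at s)) \<Longrightarrow>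
       dist (a0 0) (a 0) < \<delta> \<Longrightarrow> \<bar>s\<bar> \<le> T \<Longrightarrow> dist (a0 s) (a s) \<le> L * dist (a0 0) (a 0)"
proof -
  define K where "K = a0 ` {-T..T}"
  have "continuous_on {-T..T} a0"
    by (intro continuous_at_imp_continuous_on ballI has_vector_derivative_continuous[OF a0(2)]) auto
  then have K: "compact K" "K \<subseteq> W" unfolding K_def using a0(1) by (auto intro!: compact_continuous_image)
  obtain d where d: "d > 0" and lin: "\<And>x y. x \<in> K \<Longrightarrow> dist x y < d \<Longrightarrow> norm (V y - V x - V' x (y - x)) \<le> 1 * norm (y - x)"
    by (rule uniform_linearization[OF W V V' K zero_less_one]) (assumption | rule that)+
  have "bounded (V' ` K)" using K V' continuous_on_subset compact_continuous_image compact_imp_bounded by metis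
  then obtain M where M: "M > 0" "\<And>x. x \<in> K \<Longrightarrow> norm (V' x) \<le> M" unfolding bounded_pos by auto
  have lip: "norm (V y - V x) \<le> (M + 1) * norm (y - x)" if "x \<in> K" "dist x y < d" for x y
  proof -
    have "norm (V y - V x) \<le> norm (V y - V x - V' x (y - x)) + norm (V' x (y - x))"
      using norm_triangle_ineq[of "V y - V x - V' x (y - x)" "V' x (y - x)"] by simp
    also have "norm (V' x (y - x)) \<le> M * norm (y - x)"
      using norm_blinfun[of "V' x" "y - x"] mult_right_mono[OF M(2)[OF that(1)], of "norm (y - x)"] by simp
    finally show ?thesis using lin[OF that] by (simp add: algebra_simps)
  qed
  \<comment> \<open>\<open>M + 1\<close> is the Lipschitz constant in the tube. Gronwall bounds the
    squared distance by \<open>c\<close> times its initial value, and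
    \<open>c \<le> c\<^sup>2\<close> permits taking roots. With
    \<open>\<delta> = \<epsilon> / c\<close> the bound stays strictly below the tube radius
    \<open>\<epsilon>\<close>.\<close>
  define c where "c = exp ((2 * (M + 1) + 1) * \<bar>T\<bar>)"
  have c1: "1 \<le> c" using M by (simp add: c_def)
  define \<epsilon> where "\<epsilon> = d / 2"
  define \<delta> where "\<delta> = \<epsilon> / c"
  have \<delta>: "\<delta> > 0" "\<delta> \<le> \<epsilon>" "\<epsilon> > 0" "\<epsilon> < d" using c1 d by (auto simp: \<delta>_def \<epsilon>_def field_simps)
  have main: "dist (a0 s) (a s) \<le> c * dist (a0 0) (a 0)"
    if a: "\<And>s. \<bar>s\<bar> \<le> T \<Longrightarrow> a s \<in> W" "\<And>s. \<bar>s\<bar> \<le> T \<Longrightarrow> (a has_vector_derivative V (a s)) (at s)" 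
      and ini: "dist (a0 0) (a 0) < \<delta>" and s: "\<bar>s\<bar> \<le> T" for a s
  proof -
    have G: "dist (a0 s1) (a s1) \<le> c * dist (a0 0) (a 0)" 
      if s1: "\<bar>s1\<bar> \<le> T" and tube: "\<And>s. \<bar>s\<bar> \<le> \<bar>s1\<bar> \<Longrightarrow> s * s1 \<ge> 0 \<Longrightarrow> dist (a0 s) (a s) \<le> \<epsilon>" for s1
    proof -
      have "(norm (a s1 - a0 s1))\<^sup>2 \<le> ((norm (a 0 - a0 0))\<^sup>2 + 0\<^sup>2) * exp ((2 * (M + 1) + 1) * \<bar>s1\<bar>)"
      proof (rule gronwall[where u' = "\<lambda>s. V (a s) - V (a0 s)"])
        fix s assume s: "\<bar>s\<bar> \<le> \<bar>s1\<bar>" "0 \<le> s * s1"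
        then have sT: "\<bar>s\<bar> \<le> T" using s1 by simp
        show "((\<lambda>s. a s - a0 s) has_vector_derivative V (a s) - V (a0 s)) (at s)"
          by (intro has_vector_derivative_diff a a0 sT)
        have "a0 s \<in> K" using sT unfolding K_def by (intro imageI) auto
        then show "norm (V (a s) - V (a0 s)) \<le> (M + 1) * norm (a s - a0 s) + 0"
          using lip[of "a0 s" "a s"] tube[OF s] \<delta> by simp
      qed (use M in auto)
      also have "\<dots> \<le> (norm (a 0 - a0 0))\<^sup>2 * c"
        unfolding c_def using M s1 by (intro mult_mono) (auto intro!: mult_left_mono)
      also have "\<dots> \<le> (norm (a 0 - a0 0))\<^sup>2 * c\<^sup>2"
        using c1 by (intro mult_left_mono) (auto simp: power2_eq_square)
      finally have "(norm (a s1 - a0 s1))\<^sup>2 \<le> (c * norm (a 0 - a0 0))\<^sup>2" by (simp add: power_mult_distrib mult.commute)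
      then have "norm (a s1 - a0 s1) \<le> c * norm (a 0 - a0 0)" by (rule power2_le_imp_le) (use c1 in auto)
      then show ?thesis by (simp add: dist_norm norm_minus_commute)
    qed
    \<comment> \<open>Rescaling the segment from 0 to \<open>s\<close> to the unit interval treats
      both signs of \<open>s\<close> at once.\<close>
    define g where "g \<sigma> = dist (a0 (\<sigma> * s)) (a (\<sigma> * s))" for \<sigma>
    have sc: "\<bar>\<sigma> * s\<bar> \<le> T" if "\<sigma> \<in> {0..1}" for \<sigma>
    proof -
      have "\<bar>\<sigma> * s\<bar> \<le> \<bar>s\<bar>" using that by (simp add: abs_mult mult_left_le_one_le)
      then show ?thesis using s by simp
    qed
    have gc: "continuous_on {0..1} g"
    proof -
      have "continuous_on {-T..T} a0" "continuous_on {-T..T} a"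
        by (auto intro!: continuous_at_imp_continuous_on has_vector_derivative_continuous[OF a0(2)]
              has_vector_derivative_continuous[OF a(2)])
      moreover have "(\<lambda>\<sigma>. \<sigma> * s) ` {0..1} \<subseteq> {-T..T}" using sc by (force simp: abs_le_iff)
      ultimately show ?thesis unfolding g_def
        by (intro continuous_on_dist) (auto intro!: continuous_on_compose2[of "{-T..T}" _ "{0..1}" "\<lambda>\<sigma>. \<sigma> * s"] continuous_intros)
    qed
    have cd: "c * dist (a0 0) (a 0) < \<epsilon>" using ini c1 by (simp add: \<delta>_def field_simps)
    have tube: "g \<sigma> < \<epsilon>" if \<sigma>: "\<sigma> \<in> {0..1}" for \<sigma>
    proof (rule ccontr)
      assume "\<not> g \<sigma> < \<epsilon>"
      define H where "H = {x \<in> {0..1}. g x = \<epsilon>}"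
      have hit: "\<exists>y\<in>{0..x}. g y = \<epsilon>" if "x \<in> {0..1}" "\<epsilon> \<le> g x" for x
      proof -
        have "g 0 \<le> \<epsilon>" using ini \<delta> by (simp add: g_def)
        then show ?thesis using IVT'[of g 0 \<epsilon> x] that continuous_on_subset[OF gc, of "{0..x}"] by auto
      qed
      obtain y0 where "y0 \<in> {0..\<sigma>}" "g y0 = \<epsilon>" using hit[of \<sigma>] \<sigma> \<open>\<not> g \<sigma> < \<epsilon>\<close> by auto
      then have "y0 \<in> H" using \<sigma> unfolding H_def by simp
      then have "H \<noteq> {}" by blast
      moreover have "compact H"
      proof -
        have "H = {0..1} \<inter> g -` {\<epsilon>}" by (auto simp: H_def)
        then have "closed H" using continuous_closed_preimage[OF gc] by simp
        then show ?thesis by (auto simp: compact_eq_bounded_closed H_def intro: bounded_subset[of "{0..1}"])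
      qed
      ultimately obtain m where m: "m \<in> H" "\<And>x. x \<in> H \<Longrightarrow> m \<le> x" using compact_attains_inf by metis
      have below: "g x \<le> \<epsilon>" if x: "0 \<le> x" "x \<le> m" for x
      proof (rule ccontr)
        assume n: "\<not> g x \<le> \<epsilon>"
        have x01: "x \<in> {0..1}" using x m(1) by (auto simp: H_def)
        obtain y where y: "y \<in> {0..x}" "g y = \<epsilon>" using hit[OF x01] n by auto
        then have "y \<in> H" using x01 by (auto simp: H_def)
        then have "y = x" using m(2) y x by force
        then show False using y n by simp
      qed
      have "dist (a0 (m * s)) (a (m * s)) \<le> c * dist (a0 0) (a 0)"
      proof (rule G)
        show "\<bar>m * s\<bar> \<le> T" using sc m(1) by (auto simp: H_def)
        fix r assume r: "\<bar>r\<bar> \<le> \<bar>m * s\<bar>" "0 \<le> r * (m * s)"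
        have m0: "m \<ge> 0" using m(1) by (auto simp: H_def)
        show "dist (a0 r) (a r) \<le> \<epsilon>"
        proof (cases "m * s = 0")
          case True
          then have "r = 0" using r(1) by (simp only: abs_zero abs_le_zero_iff)
          then show ?thesis using ini \<delta> by simp
        next
          case False
          define x where "x = r / s"
          have rx: "r = x * s" using False by (simp add: x_def)
          have "m > 0" "s \<noteq> 0" using False m0 by auto
          have "0 \<le> (x * m) * (s * s)" using r(2) unfolding rx by (simp add: algebra_simps)
          moreover have "s * s > 0" using \<open>s \<noteq> 0\<close> by (metis not_real_square_gt_zero)
          ultimately have "0 \<le> x * m" by (simp add: zero_le_mult_iff)
          then have "0 \<le> x" using \<open>m > 0\<close> by (simp add: zero_le_mult_iff)
          moreover have "x \<le> m" using r(1) \<open>s \<noteq> 0\<close> \<open>0 \<le> x\<close> m0 unfolding rx by (simp add: abs_mult)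
          ultimately show ?thesis using below[of x] unfolding g_def rx by simp
        qed
      qed
      moreover have "dist (a0 (m * s)) (a (m * s)) = \<epsilon>" using m(1) by (auto simp: H_def g_def)
      ultimately show False using cd by simp
    qed
    show ?thesis
    proof (rule G[OF s])
      fix r assume r: "\<bar>r\<bar> \<le> \<bar>s\<bar>" "0 \<le> r * s"
      show "dist (a0 r) (a r) \<le> \<epsilon>"
      proof (cases "s = 0")
        case True then show ?thesis using r ini \<delta> by simp
      next
        case False
        then have "r / s \<in> {0..1}" using r by (auto simp: divide_simps abs_if mult_le_0_iff zero_le_mult_iff split: if_splits)
        then show ?thesis using tube[of "r / s"] False by (simp add: g_def)
      qed
    qed
  qed
  show thesis by (rule that[of c \<delta>]) (use c1 \<delta>(1) main in auto)
qed

lemma gronwall_uniform: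
  fixes u :: "real \<Rightarrow> 'a::real_inner"
  assumes u: "\<And>s. \<bar>s\<bar> \<le> T \<Longrightarrow> (u has_vector_derivative u' s) (at s)"
    and K: "K \<ge> 0" and r: "r \<ge> 0"
    and le: "\<And>s. \<bar>s\<bar> \<le> T \<Longrightarrow> norm (u' s) \<le> K * norm (u s) + r"
    and s: "\<bar>s\<bar> \<le> T"
  shows "norm (u s) \<le> (norm (u 0) + r) * exp ((2 * K + 1) * T)"
proof -
  have "(norm (u s))\<^sup>2 \<le> ((norm (u 0))\<^sup>2 + r\<^sup>2) * exp ((2 * K + 1) * \<bar>s\<bar>)"
    by (rule gronwall[where u' = u']) (use u K le s in auto)
  also have "\<dots> \<le> (norm (u 0) + r)\<^sup>2 * (exp ((2 * K + 1) * T))\<^sup>2"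
  proof (rule mult_mono)
    show "(norm (u 0))\<^sup>2 + r\<^sup>2 \<le> (norm (u 0) + r)\<^sup>2" using r by (simp add: power2_sum)
    have T: "0 \<le> T" using s by simp
    have "exp ((2 * K + 1) * \<bar>s\<bar>) \<le> exp ((2 * K + 1) * T)" using s K by (simp add: mult_left_mono)
    also have "\<dots> \<le> (exp ((2 * K + 1) * T))\<^sup>2" 
      using T K by (intro self_le_power) auto
    finally show "exp ((2 * K + 1) * \<bar>s\<bar>) \<le> (exp ((2 * K + 1) * T))\<^sup>2" .
  qed auto
  finally have "(norm (u s))\<^sup>2 \<le> ((norm (u 0) + r) * exp ((2 * K + 1) * T))\<^sup>2"
    by (simp add: power_mult_distrib)
  then show ?thesis by (rule power2_le_imp_le) (use r in auto)
qed

text \<open>Existence for a linear equation out of approximate solutions: two of them differ by a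
  function solving the equation up to \<open>2 * \<eta>\<close>, so Gronwall makes the sequence
  uniformly Cauchy. As \<open>A\<close> is bounded, the derivatives converge uniformly as well, and
  the limit is a solution.\<close>

lemma linear_ode_limit:
  fixes A :: "real \<Rightarrow> 'a::euclidean_space \<Rightarrow>\<^sub>L 'a" and d :: "nat \<Rightarrow> real \<Rightarrow> 'a"
  assumes A: "\<And>s. \<bar>s\<bar> \<le> T \<Longrightarrow> norm (A s) \<le> K" and T: "T > 0"
    and d: "\<And>n s. \<bar>s\<bar> \<le> T \<Longrightarrow> (d n has_vector_derivative D n s) (at s)"
    and approx: "\<And>\<eta>. \<eta> > 0 \<Longrightarrow> \<forall>\<^sub>F n in sequentially. \<forall>s. \<bar>s\<bar> \<le> T \<longrightarrow> norm (D n s - A s (d n s)) \<le> \<eta>"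
    and lim: "(\<lambda>n. d n 0) \<longlonglongrightarrow> c"
  shows "\<exists>b. b 0 = c \<and> (\<forall>s. \<bar>s\<bar> < T \<longrightarrow> (b has_vector_derivative A s (b s)) (at s))"
proof -
  have K: "K \<ge> 0" using A[of 0] T norm_ge_zero[of "A 0"] by linarith
  define E where "E = exp ((2 * K + 1) * T)"
  have E: "E \<ge> 1" using K T by (simp add: E_def)
  have Ab: "norm (A s v) \<le> K * norm v" if "\<bar>s\<bar> \<le> T" for s v
    using norm_blinfun[of "A s" v] mult_right_mono[OF A[OF that], of "norm v"] by simp
  have close: "norm (d m s - d n s) \<le> (norm (d m 0 - d n 0) + 2 * \<eta>) * E"
    if "\<eta> > 0" and "\<And>s. \<bar>s\<bar> \<le> T \<Longrightarrow> norm (D n s - A s (d n s)) \<le> \<eta>" 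
      and "\<And>s. \<bar>s\<bar> \<le> T \<Longrightarrow> norm (D m s - A s (d m s)) \<le> \<eta>" and "\<bar>s\<bar> \<le> T" for m n s \<eta>
    unfolding E_def
  proof (rule gronwall_uniform[where u = "\<lambda>s. d m s - d n s" and u' = "\<lambda>s. D m s - D n s" and s = s])
    fix s assume s: "\<bar>s\<bar> \<le> T"
    show "((\<lambda>s. d m s - d n s) has_vector_derivative D m s - D n s) (at s)"
      by (intro has_vector_derivative_diff d s)
    have "D m s - D n s = A s (d m s - d n s) + (D m s - A s (d m s)) - (D n s - A s (d n s))"
      by (simp add: blinfun.diff_right)
    also have "norm \<dots> \<le> norm (A s (d m s - d n s)) + norm (D m s - A s (d m s)) + norm (D n s - A s (d n s))"
      by (rule order_trans[OF norm_triangle_ineq4 add_right_mono[OF norm_triangle_ineq]])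
    finally show "norm (D m s - D n s) \<le> K * norm (d m s - d n s) + 2 * \<eta>"
      using Ab[OF s, of "d m s - d n s"] that(2,3)[OF s] by linarith
  qed (use that K in auto)
  have "uniformly_Cauchy_on {-T..T} d"
    unfolding uniformly_Cauchy_on_def
  proof (intro allI impI)
    fix e :: real assume e: "e > 0"
    \<comment> \<open>Two approximate solutions differ by at most
      \<open>(\<eta> + 2 * \<eta>) * E\<close>, which is 3/4 of \<open>e\<close>.\<close>
    define \<eta> where "\<eta> = e / (4 * E)"
    have \<eta>: "\<eta> > 0" using e E by (simp add: \<eta>_def)
    obtain N1 where N1: "\<And>n s. n \<ge> N1 \<Longrightarrow> \<bar>s\<bar> \<le> T \<Longrightarrow> norm (D n s - A s (d n s)) \<le> \<eta>"
      using approx[OF \<eta>] unfolding eventually_sequentially by auto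
    have "Cauchy (\<lambda>n. d n 0)" using lim LIMSEQ_imp_Cauchy by blast
    then obtain N2 where N2: "\<And>m n. m \<ge> N2 \<Longrightarrow> n \<ge> N2 \<Longrightarrow> dist (d m 0) (d n 0) < \<eta>"
      using \<eta> unfolding Cauchy_def by meson
    have "dist (d m x) (d n x) < e" if "x \<in> {-T..T}" "m \<ge> max N1 N2" "n \<ge> max N1 N2" for x m n
    proof -
      have "norm (d m x - d n x) \<le> (norm (d m 0 - d n 0) + 2 * \<eta>) * E"
        by (rule close[OF \<eta> N1 N1]) (use that in \<open>auto simp: abs_le_iff\<close>)
      also have "\<dots> \<le> (3 * \<eta>) * E" using N2[of m n] that E by (intro mult_right_mono) (auto simp: dist_norm)
      also have "\<dots> < e" using e E by (simp add: \<eta>_def)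
      finally show ?thesis by (simp add: dist_norm)
    qed
    then show "\<exists>M. \<forall>x\<in>{-T..T}. \<forall>m\<ge>M. \<forall>n\<ge>M. dist (d m x) (d n x) < e" by blast
  qed
  then obtain b where b: "uniform_limit {-T..T} d b sequentially"
    using Cauchy_uniformly_convergent unfolding uniformly_convergent_on_def by blast
  have blim: "(\<lambda>n. d n s) \<longlonglongrightarrow> b s" if "s \<in> {-T..T}" for s
    using tendsto_uniform_limitI[OF b that] .
  have "\<exists>g. \<forall>x\<in>{-T<..<T}. (\<lambda>n. d n x) \<longlonglongrightarrow> g x \<and> (g has_derivative (\<lambda>h. h *\<^sub>R A x (b x))) (at x within {-T<..<T})"
  proof (rule has_derivative_sequence[where f' = "\<lambda>n x h. h *\<^sub>R D n x" and ?x0.0 = 0])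
    show "(d n has_derivative (\<lambda>h. h *\<^sub>R D n x)) (at x within {-T<..<T})" if "x \<in> {-T<..<T}" for n x
      using d[of x n] that has_derivative_at_withinI unfolding has_vector_derivative_def by fastforce
    fix e :: real assume e: "e > 0"
    \<comment> \<open>One half of \<open>e\<close> pays for replacing \<open>D n x\<close> by
      \<open>A x (d n x)\<close>, the other for replacing \<open>d n x\<close> by
      \<open>b x\<close>. The divisor \<open>K + 1\<close> also covers \<open>K = 0\<close>.\<close>
    have e2: "e / 2 > 0" "e / (2 * (K + 1)) > 0" using e K by auto
    show "\<forall>\<^sub>F n in sequentially. \<forall>x\<in>{-T<..<T}. \<forall>h. norm (h *\<^sub>R D n x - h *\<^sub>R A x (b x)) \<le> e * norm h"
      using approx[OF e2(1)] uniform_limitD[OF b e2(2)]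
    proof eventually_elim
      case (elim n)
      show ?case
      proof (intro ballI allI)
        fix x h :: real assume x: "x \<in> {-T<..<T}"
        then have xT: "\<bar>x\<bar> \<le> T" "x \<in> {-T..T}" by auto
        have "norm (D n x - A x (b x)) \<le> norm (D n x - A x (d n x)) + norm (A x (d n x - b x))"
          using norm_triangle_ineq[of "D n x - A x (d n x)" "A x (d n x - b x)"] by (simp add: blinfun.diff_right)
        also have "norm (D n x - A x (d n x)) \<le> e / 2" using elim xT by blast
        also have "norm (A x (d n x - b x)) \<le> (K + 1) * norm (d n x - b x)"
          by (rule order_trans[OF Ab[OF xT(1)] mult_right_mono]) auto
        also have "(K + 1) * norm (d n x - b x) \<le> (K + 1) * (e / (2 * (K + 1)))"
          using elim(2) xT K by (intro mult_left_mono) (auto simp: dist_norm less_imp_le)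
        also have "(K + 1) * (e / (2 * (K + 1))) = e / 2" using K by (simp add: field_simps)
        finally have "norm (D n x - A x (b x)) \<le> e" by simp
        then show "norm (h *\<^sub>R D n x - h *\<^sub>R A x (b x)) \<le> e * norm h"
          by (simp flip: scaleR_diff_right add: mult.commute[of e] mult_left_mono)
      qed
    qed
  qed (use T lim in auto)
  then obtain g where g: "\<And>x. x \<in> {-T<..<T} \<Longrightarrow> (\<lambda>n. d n x) \<longlonglongrightarrow> g x"
    "\<And>x. x \<in> {-T<..<T} \<Longrightarrow> (g has_derivative (\<lambda>h. h *\<^sub>R A x (b x))) (at x within {-T<..<T})" by blast
  have gb: "g x = b x" if "x \<in> {-T<..<T}" for x
    using LIMSEQ_unique[OF g(1)[OF that] blim] that by auto
  have "(g has_vector_derivative A s (g s)) (at s)" if "\<bar>s\<bar> < T" for s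
  proof -
    have s: "s \<in> {-T<..<T}" using that by auto
    then show ?thesis using g(2)[OF s] gb[OF s] at_within_open[OF s] 
      by (simp add: has_vector_derivative_def)
  qed
  moreover have "g 0 = c" using LIMSEQ_unique[OF g(1) lim] T by auto
  ultimately show ?thesis by blast
qed

lemma has_vector_derivative_iff_quotient:
  "(f has_vector_derivative c) (at t0) \<longleftrightarrow> ((\<lambda>t. (f t - f t0) /\<^sub>R (t - t0)) \<longlongrightarrow> c) (at t0)"
proof -
  have "norm (f t - f t0 - (t - t0) *\<^sub>R c) / norm (t - t0) = norm ((f t - f t0) /\<^sub>R (t - t0) - c)"
    if "t \<noteq> t0" for t
  proof -
    have "(f t - f t0) /\<^sub>R (t - t0) - c = (f t - f t0 - (t - t0) *\<^sub>R c) /\<^sub>R (t - t0)"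
      using that by (simp add: scaleR_diff_right)
    then show ?thesis by (simp add: divide_inverse mult.commute)
  qed
  then have "((\<lambda>t. norm (f t - f t0 - (t - t0) *\<^sub>R c) / norm (t - t0)) \<longlongrightarrow> 0) (at t0) \<longleftrightarrow>
     ((\<lambda>t. norm ((f t - f t0) /\<^sub>R (t - t0) - c)) \<longlongrightarrow> 0) (at t0)"
    by (intro LIM_cong) auto
  then show ?thesis
    unfolding has_vector_derivative_def has_derivative_iff_norm
    by (simp add: tendsto_norm_zero_iff LIM_zero_iff bounded_linear_scaleR_left)
qed

text \<open>The difference quotients of a family of trajectories in the parameter are approximate
  solutions of the variational equation, which also yields the existence of its exact solution.\<close>

lemma trajectory_differentiable_local:
  fixes V :: "'a::euclidean_space \<Rightarrow> 'a" and V' :: "'a \<Rightarrow> 'a \<Rightarrow>\<^sub>L 'a"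
  assumes W: "open W" and V: "\<And>x. x \<in> W \<Longrightarrow> (V has_derivative V' x) (at x)"
    and V': "continuous_on W V'" 
    and a: "\<And>t s. t \<in> I \<Longrightarrow> a t s \<in> W" 
            "\<And>t s. t \<in> I \<Longrightarrow> (a t has_vector_derivative V (a t s)) (at s)"
    and I: "open I" "t0 \<in> I"
    and c: "((\<lambda>t. a t 0) has_vector_derivative c) (at t0)"
    and T: "T > 0"
  shows "\<exists>b. b 0 = c \<and> (\<forall>s. \<bar>s\<bar> < T \<longrightarrow> (b has_vector_derivative V' (a t0 s) (b s)) (at s) \<and>
            ((\<lambda>t. a t s) has_vector_derivative b s) (at t0))"
proof -
  define K where "K = a t0 ` {-T..T}"
  have "continuous_on {-T..T} (a t0)"
    by (intro continuous_at_imp_continuous_on ballI has_vector_derivative_continuous[OF a(2)[OF I(2)]])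
  then have K: "compact K" "K \<subseteq> W" unfolding K_def using a(1) I by (auto intro!: compact_continuous_image)
  have sK: "a t0 s \<in> K" if "\<bar>s\<bar> \<le> T" for s using that unfolding K_def by (intro imageI) auto
  have "bounded (V' ` K)" using K V' continuous_on_subset compact_continuous_image compact_imp_bounded by metis
  then obtain M where M: "M > 0" "\<And>x. x \<in> K \<Longrightarrow> norm (V' x) \<le> M" unfolding bounded_pos by auto
  obtain L \<delta> where L: "L \<ge> 0" "\<delta> > 0" and dep: "\<And>a' s. (\<And>s. \<bar>s\<bar> \<le> T \<Longrightarrow> a' s \<in> W) \<Longrightarrow> (\<And>s. \<bar>s\<bar> \<le> T \<Longrightarrow> (a' has_vector_derivative V (a' s)) (at s)) \<Longrightarrow>
     dist (a t0 0) (a' 0) < \<delta> \<Longrightarrow> \<bar>s\<bar> \<le> T \<Longrightarrow> dist (a t0 s) (a' s) \<le> L * dist (a t0 0) (a' 0)"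
    by (rule trajectory_dependence[OF W V V' a(1)[OF I(2)] a(2)[OF I(2)], of T]; blast intro: that)
  define d where "d t s = (a t s - a t0 s) /\<^sub>R (t - t0)" for t s
  define D where "D t s = (V (a t s) - V (a t0 s)) /\<^sub>R (t - t0)" for t s
  \<comment> \<open>Eventual bound for all difference quotients: by Lipschitz dependence the norm of
    \<open>d t s\<close> is at most \<open>L\<close> times that of \<open>d t 0\<close>, which is
    eventually below \<open>norm c + 1\<close>.\<close>
  define B where "B = L * (norm c + 1)"
  have B: "B \<ge> 0" using L by (simp add: B_def)
  have lim0: "((\<lambda>t. d t 0) \<longlongrightarrow> c) (at t0)"
    using c unfolding has_vector_derivative_iff_quotient d_def .
  have I_ev: "\<forall>\<^sub>F t in at t0. t \<in> I" using I eventually_at_topological by blast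
  have near0: "\<forall>\<^sub>F t in at t0. dist (a t0 0) (a t 0) < r" if "r > 0" for r
  proof -
    have "((\<lambda>t. a t 0) \<longlongrightarrow> a t0 0) (at t0)"
      using has_vector_derivative_continuous[OF c] unfolding continuous_at .
    from tendstoD[OF this that] show ?thesis by (simp add: dist_commute)
  qed
  have dD: "(d t has_vector_derivative D t s) (at s)" if "t \<in> I" for t s
    unfolding d_def D_def
    by (rule bounded_linear.has_vector_derivative[OF bounded_linear_scaleR_right])
       (intro has_vector_derivative_diff a that I)
  have dB: "\<forall>\<^sub>F t in at t0. \<forall>s. \<bar>s\<bar> \<le> T \<longrightarrow> norm (d t s) \<le> B"
  proof -
    have "\<forall>\<^sub>F t in at t0. dist (d t 0) c < 1" using lim0 by (rule tendstoD) simp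
    then show ?thesis using I_ev near0[OF L(2)]
    proof eventually_elim
      case (elim t)
      have "norm (d t 0) \<le> norm c + 1" using elim(1) norm_triangle_sub[of "d t 0" c] by (simp add: dist_norm)
      moreover have "norm (d t s) \<le> L * norm (d t 0)" if "\<bar>s\<bar> \<le> T" for s
      proof -
        have n: "norm (d t \<sigma>) = inverse \<bar>t - t0\<bar> * dist (a t0 \<sigma>) (a t \<sigma>)" for \<sigma>
          by (simp add: d_def dist_norm norm_minus_commute)
        have "dist (a t0 s) (a t s) \<le> L * dist (a t0 0) (a t 0)"
          using dep[of "a t" s] a elim that by simp
        then have "inverse \<bar>t - t0\<bar> * dist (a t0 s) (a t s) \<le> inverse \<bar>t - t0\<bar> * (L * dist (a t0 0) (a t 0))"
          by (rule mult_left_mono) simp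
        then show ?thesis unfolding n by (simp only: mult.left_commute)
      qed
      ultimately show ?case unfolding B_def using L(1) by (meson mult_left_mono order_trans)
    qed
  qed
  have approx: "\<forall>\<^sub>F t in at t0. \<forall>s. \<bar>s\<bar> \<le> T \<longrightarrow> norm (D t s - V' (a t0 s) (d t s)) \<le> \<eta>" if \<eta>: "\<eta> > 0" for \<eta>
  proof -
    \<comment> \<open>The linearization error is relative to the size of \<open>d t s\<close>, which
      is at most \<open>B\<close>, so this scaling brings it down to \<open>\<eta>\<close>.\<close>
    define \<eta>' where "\<eta>' = \<eta> / (B + 1)"
    have \<eta>': "\<eta>' > 0" using \<eta> B by (simp add: \<eta>'_def)
    obtain \<theta> where \<theta>: "\<theta> > 0" and lin: "\<And>x y. x \<in> K \<Longrightarrow> dist x y < \<theta> \<Longrightarrow> norm (V y - V x - V' x (y - x)) \<le> \<eta>' * norm (y - x)"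
      by (rule uniform_linearization[OF W V V' K \<eta>']) (assumption | rule that)+
    have "\<theta> / (L + 1) > 0" using \<theta> L by simp
    from near0[OF this] I_ev near0[OF L(2)] dB show ?thesis
    proof eventually_elim
      case (elim t)
      show ?case
      proof (intro allI impI)
        fix s assume s: "\<bar>s\<bar> \<le> T"
        have "dist (a t0 s) (a t s) \<le> L * dist (a t0 0) (a t 0)"
          using dep[of "a t" s] a elim s by simp
        also have "\<dots> \<le> (L + 1) * dist (a t0 0) (a t 0)" by (simp add: mult_right_mono)
        also have "\<dots> < \<theta>" using elim(1) L by (simp add: field_simps)
        finally have "norm (V (a t s) - V (a t0 s) - V' (a t0 s) (a t s - a t0 s)) \<le> \<eta>' * norm (a t s - a t0 s)"
          by (rule lin[OF sK[OF s]])
        from mult_left_mono[OF this, of "\<bar>inverse (t - t0)\<bar>"]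
        have "norm (D t s - V' (a t0 s) (d t s)) \<le> \<eta>' * norm (d t s)"
          unfolding D_def d_def blinfun.scaleR_right scaleR_diff_right[symmetric] norm_scaleR
          by (simp add: mult.left_commute)
        also have "\<dots> \<le> \<eta>' * (B + 1)" using elim(4) s \<eta>' by (intro mult_left_mono) fastforce+
        also have "\<dots> = \<eta>" using B by (simp add: \<eta>'_def)
        finally show "norm (D t s - V' (a t0 s) (d t s)) \<le> \<eta>" .
      qed
    qed
  qed
  obtain \<rho> where \<rho>: "\<rho> > 0" "ball t0 \<rho> \<subseteq> I" using I openE by blast
  \<comment> \<open>The limit lemma needs a sequence, so \<open>b\<close> is produced along one
    sequence of parameters tending to \<open>t0\<close>. The offset 2 keeps already
    \<open>\<tau> 0\<close> strictly inside the ball.\<close>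
  define \<tau> where "\<tau> n = t0 + \<rho> / real (n + 2)" for n :: nat
  have \<tau>I: "\<tau> n \<in> I" for n
  proof -
    have "\<rho> / real (n + 2) < \<rho> / 1" using \<rho> by (intro divide_strict_left_mono) auto
    then have "\<tau> n \<in> ball t0 \<rho>" using \<rho> by (simp add: \<tau>_def dist_real_def)
    then show ?thesis using \<rho> by blast
  qed
  have \<tau>: "filterlim \<tau> (at t0) sequentially"
    unfolding filterlim_at
  proof
    show "\<forall>\<^sub>F n in sequentially. \<tau> n \<in> UNIV \<and> \<tau> n \<noteq> t0" using \<rho> by (simp add: \<tau>_def)
    have "(\<lambda>n. \<rho> / real (n + 2)) \<longlonglongrightarrow> 0"
      by (rule LIMSEQ_ignore_initial_segment[OF lim_const_over_n])
    from tendsto_add[OF tendsto_const[of t0] this] show "\<tau> \<longlonglongrightarrow> t0" by (simp add: \<tau>_def[abs_def])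
  qed
  have "\<exists>b. b 0 = c \<and> (\<forall>s. \<bar>s\<bar> < T \<longrightarrow> (b has_vector_derivative V' (a t0 s) (b s)) (at s))"
  proof (rule linear_ode_limit[where d = "\<lambda>n. d (\<tau> n)" and D = "\<lambda>n. D (\<tau> n)" and K = M])
    show "norm (V' (a t0 s)) \<le> M" if "\<bar>s\<bar> \<le> T" for s using M sK that by blast
    show "\<forall>\<^sub>F n in sequentially. \<forall>s. \<bar>s\<bar> \<le> T \<longrightarrow> norm (D (\<tau> n) s - V' (a t0 s) (d (\<tau> n) s)) \<le> \<eta>" if "\<eta> > 0" for \<eta>
      using eventually_compose_filterlim[OF approx[OF that] \<tau>] .
    show "(\<lambda>n. d (\<tau> n) 0) \<longlonglongrightarrow> c" using filterlim_compose[OF lim0 \<tau>] .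
  qed (use dD \<tau>I T in auto)
  then obtain b where b: "b 0 = c" "\<And>s. \<bar>s\<bar> < T \<Longrightarrow> (b has_vector_derivative V' (a t0 s) (b s)) (at s)" by blast
  define E where "E = exp ((2 * M + 1) * T)"
  have E: "E \<ge> 1" using M T by (simp add: E_def)
  \<comment> \<open>The sequence only served to produce \<open>b\<close>. For the full limit,
    \<open>d t\<close> is compared with this exact solution by Gronwall: both solve the same linear
    equation up to \<open>\<eta>\<close>, and their initial values differ by less than
    \<open>\<eta>\<close>.\<close>
  have "((\<lambda>t. a t s) has_vector_derivative b s) (at t0)" if s: "\<bar>s\<bar> < T" for s
    unfolding has_vector_derivative_iff_quotient d_def[symmetric]
  proof (rule tendstoI)
    fix e :: real assume e: "e > 0"
    define \<eta> where "\<eta> = e / (3 * E)"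
    have \<eta>: "\<eta> > 0" using e E by (simp add: \<eta>_def)
    from approx[OF \<eta>] I_ev tendstoD[OF lim0 \<eta>]
    show "\<forall>\<^sub>F t in at t0. dist (d t s) (b s) < e"
    proof eventually_elim
      case (elim t)
      have "norm (d t s - b s) \<le> (norm (d t 0 - b 0) + \<eta>) * exp ((2 * M + 1) * \<bar>s\<bar>)"
      proof (rule gronwall_uniform[where u = "\<lambda>s. d t s - b s" and u' = "\<lambda>\<sigma>. D t \<sigma> - V' (a t0 \<sigma>) (b \<sigma>)" and s = s])
        fix \<sigma> assume "\<bar>\<sigma>\<bar> \<le> \<bar>s\<bar>"
        then have \<sigma>: "\<bar>\<sigma>\<bar> < T" "\<bar>\<sigma>\<bar> \<le> T" using s by auto
        show "((\<lambda>s. d t s - b s) has_vector_derivative D t \<sigma> - V' (a t0 \<sigma>) (b \<sigma>)) (at \<sigma>)"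
          using elim by (intro has_vector_derivative_diff dD b \<sigma>)
        have "D t \<sigma> - V' (a t0 \<sigma>) (b \<sigma>) = V' (a t0 \<sigma>) (d t \<sigma> - b \<sigma>) + (D t \<sigma> - V' (a t0 \<sigma>) (d t \<sigma>))"
          by (simp add: blinfun.diff_right)
        also have "norm \<dots> \<le> norm (V' (a t0 \<sigma>) (d t \<sigma> - b \<sigma>)) + norm (D t \<sigma> - V' (a t0 \<sigma>) (d t \<sigma>))"
          by (rule norm_triangle_ineq)
        also have "norm (V' (a t0 \<sigma>) (d t \<sigma> - b \<sigma>)) \<le> M * norm (d t \<sigma> - b \<sigma>)"
          using norm_blinfun[of "V' (a t0 \<sigma>)" "d t \<sigma> - b \<sigma>"]
            mult_right_mono[OF M(2)[OF sK[OF \<sigma>(2)]], of "norm (d t \<sigma> - b \<sigma>)"] by simp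
        finally show "norm (D t \<sigma> - V' (a t0 \<sigma>) (b \<sigma>)) \<le> M * norm (d t \<sigma> - b \<sigma>) + \<eta>"
          using elim(1) \<sigma>(2) by force
      qed (use M \<eta> in auto)
      also have "\<dots> \<le> (2 * \<eta>) * E"
        unfolding E_def using s M elim(3) \<eta> b(1) by (intro mult_mono) (auto simp: dist_norm)
      also have "\<dots> < e" using e E by (simp add: \<eta>_def field_simps)
      finally show ?case by (simp add: dist_norm)
    qed
  qed
  then show ?thesis using b by blast
qed

text \<open>Needed for transported curves to be of class \<open>C\<^sup>2\<close>. The coefficients
  \<open>V' (a t s)\<close> of the linear equation are uniformly close to \<open>V' (a t0 s)\<close>
  on bounded time intervals, by Lipschitz dependence of \<open>a\<close> and uniform continuity of
  \<open>V'\<close> near the orbit; Gronwall transfers this to the solutions.\<close>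

lemma variation_continuous:
  fixes V :: "'a::euclidean_space \<Rightarrow> 'a" and V' :: "'a \<Rightarrow> 'a \<Rightarrow>\<^sub>L 'a"
  assumes W: "open W" and V: "\<And>x. x \<in> W \<Longrightarrow> (V has_derivative V' x) (at x)"
    and V': "continuous_on W V'" 
    and a: "\<And>t s. t \<in> I \<Longrightarrow> a t s \<in> W" 
            "\<And>t s. t \<in> I \<Longrightarrow> (a t has_vector_derivative V (a t s)) (at s)"
    and I: "open I" "t0 \<in> I"
    and a0: "isCont (\<lambda>t. a t 0) t0" and b0: "isCont (\<lambda>t. b t 0) t0"
    and b: "\<And>t s. t \<in> I \<Longrightarrow> (b t has_vector_derivative V' (a t s) (b t s)) (at s)"
  shows "isCont (\<lambda>t. b t s) t0"
proof -
  define T where "T = \<bar>s\<bar> + 1"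
  have sT: "\<bar>s\<bar> \<le> T" and T: "T > 0" by (auto simp: T_def)
  define K where "K = a t0 ` {-T..T}"
  have "continuous_on {-T..T} (a t0)"
    by (intro continuous_at_imp_continuous_on ballI has_vector_derivative_continuous[OF a(2)[OF I(2)]])
  then have K: "compact K" "K \<subseteq> W" unfolding K_def using a(1) I by (auto intro!: compact_continuous_image)
  have sK: "a t0 s \<in> K" if "\<bar>s\<bar> \<le> T" for s using that unfolding K_def by (intro imageI) auto
  have "bounded (V' ` K)" using K V' continuous_on_subset compact_continuous_image compact_imp_bounded by metis
  then obtain M where M: "M > 0" "\<And>x. x \<in> K \<Longrightarrow> norm (V' x) \<le> M" unfolding bounded_pos by auto
  have "continuous_on {-T..T} (b t0)"
    by (intro continuous_at_imp_continuous_on ballI has_vector_derivative_continuous[OF b[OF I(2)]])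
  then have "bounded (b t0 ` {-T..T})" by (intro compact_imp_bounded compact_continuous_image) auto
  then obtain B where B: "B > 0" and B': "\<And>x. x \<in> {-T..T} \<Longrightarrow> norm (b t0 x) \<le> B" unfolding bounded_pos by auto
  obtain L \<delta> where L: "L \<ge> 0" "\<delta> > 0" and dep: "\<And>a' s. (\<And>s. \<bar>s\<bar> \<le> T \<Longrightarrow> a' s \<in> W) \<Longrightarrow> (\<And>s. \<bar>s\<bar> \<le> T \<Longrightarrow> (a' has_vector_derivative V (a' s)) (at s)) \<Longrightarrow>
     dist (a t0 0) (a' 0) < \<delta> \<Longrightarrow> \<bar>s\<bar> \<le> T \<Longrightarrow> dist (a t0 s) (a' s) \<le> L * dist (a t0 0) (a' 0)"
    by (rule trajectory_dependence[OF W V V' a(1)[OF I(2)] a(2)[OF I(2)], of T]; blast intro: that)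
  have I_ev: "\<forall>\<^sub>F t in at t0. t \<in> I" using I eventually_at_topological by blast
  have near0: "\<forall>\<^sub>F t in at t0. dist (a t0 0) (a t 0) < r" if "r > 0" for r
    using tendstoD[OF a0[unfolded isCont_def] that] by (simp add: dist_commute)
  define E where "E = exp ((2 * (M + 1) + 1) * T)"
  have E: "E \<ge> 1" using M T by (simp add: E_def)
  show ?thesis unfolding isCont_def
  proof (rule tendstoI)
    fix e :: real assume e: "e > 0"
    \<comment> \<open>\<open>\<eta> \<le> 1\<close> bounds the perturbed coefficients by
      \<open>M + 1\<close>. The other bound keeps the perturbation \<open>\<eta> * B\<close> within
      \<open>e / (3 * E)\<close>, the same as the initial difference, for a total of 2/3 of
      \<open>e\<close> after multiplication by \<open>E\<close>.\<close>
    define \<eta> where "\<eta> = min 1 (e / (3 * E * B))"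
    have \<eta>: "\<eta> > 0" using e E B by (simp add: \<eta>_def)
    have \<eta>1: "\<eta> \<le> 1" "\<eta> * B \<le> e / (3 * E)" using e E B by (auto simp: \<eta>_def field_simps min_def)
    obtain \<theta> where \<theta>: "\<theta> > 0" and lin: "\<And>x y. x \<in> K \<Longrightarrow> dist x y < \<theta> \<Longrightarrow> norm (V' y - V' x) \<le> \<eta>"
      by (rule uniform_linearization[OF W V V' K \<eta>]) (assumption | rule that)+
    have p: "\<theta> / (L + 1) > 0" "e / (3 * E) > 0" using \<theta> L e E by auto
    from near0[OF p(1)] near0[OF L(2)] I_ev tendstoD[OF b0[unfolded isCont_def] p(2)]
    show "\<forall>\<^sub>F t in at t0. dist (b t s) (b t0 s) < e"
    proof eventually_elim
      case (elim t)
      have near: "norm (V' (a t s) - V' (a t0 s)) \<le> \<eta>" if s: "\<bar>s\<bar> \<le> T" for s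
      proof -
        have "dist (a t0 s) (a t s) \<le> L * dist (a t0 0) (a t 0)"
          using dep[of "a t" s] a elim s by simp
        also have "\<dots> \<le> (L + 1) * dist (a t0 0) (a t 0)" by (simp add: mult_right_mono)
        also have "\<dots> < \<theta>" using elim(1) L by (simp add: field_simps)
        finally show ?thesis by (rule lin[OF sK[OF s]])
      qed
      have "norm (b t s - b t0 s) \<le> (norm (b t 0 - b t0 0) + \<eta> * B) * E"
        unfolding E_def
      proof (rule gronwall_uniform[where u = "\<lambda>s. b t s - b t0 s" and u' = "\<lambda>\<sigma>. V' (a t \<sigma>) (b t \<sigma>) - V' (a t0 \<sigma>) (b t0 \<sigma>)" and s = s])
        fix \<sigma> assume \<sigma>: "\<bar>\<sigma>\<bar> \<le> T"
        show "((\<lambda>s. b t s - b t0 s) has_vector_derivative V' (a t \<sigma>) (b t \<sigma>) - V' (a t0 \<sigma>) (b t0 \<sigma>)) (at \<sigma>)"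
          using elim by (intro has_vector_derivative_diff b I)
        have Vb: "norm (V' (a t \<sigma>)) \<le> M + 1"
          using norm_triangle_sub[of "V' (a t \<sigma>)" "V' (a t0 \<sigma>)"] near[OF \<sigma>] M(2)[OF sK[OF \<sigma>]] \<eta>1 by linarith
        have "V' (a t \<sigma>) (b t \<sigma>) - V' (a t0 \<sigma>) (b t0 \<sigma>) = V' (a t \<sigma>) (b t \<sigma> - b t0 \<sigma>) + (V' (a t \<sigma>) - V' (a t0 \<sigma>)) (b t0 \<sigma>)"
          by (simp add: blinfun.diff_right blinfun.diff_left)
        also have "norm \<dots> \<le> norm (V' (a t \<sigma>) (b t \<sigma> - b t0 \<sigma>)) + norm ((V' (a t \<sigma>) - V' (a t0 \<sigma>)) (b t0 \<sigma>))"
          by (rule norm_triangle_ineq)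
        also have "norm (V' (a t \<sigma>) (b t \<sigma> - b t0 \<sigma>)) \<le> (M + 1) * norm (b t \<sigma> - b t0 \<sigma>)"
          using order_trans[OF norm_blinfun mult_right_mono[OF Vb norm_ge_zero]] .
        also have "norm ((V' (a t \<sigma>) - V' (a t0 \<sigma>)) (b t0 \<sigma>)) \<le> \<eta> * B"
          by (rule order_trans[OF norm_blinfun mult_mono]) (use near[OF \<sigma>] B'[of \<sigma>] \<sigma> \<eta> in \<open>auto simp: abs_le_iff\<close>)
        finally show "norm (V' (a t \<sigma>) (b t \<sigma>) - V' (a t0 \<sigma>) (b t0 \<sigma>)) \<le> (M + 1) * norm (b t \<sigma> - b t0 \<sigma>) + \<eta> * B" by simp
      qed (use M \<eta> B sT in auto)
      also have "\<dots> \<le> (2 * (e / (3 * E))) * E"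
        using elim(4) \<eta>1 E by (intro mult_right_mono) (auto simp: dist_norm)
      also have "\<dots> < e" using e E by (simp add: field_simps)
      finally show ?case by (simp add: dist_norm)
    qed
  qed
qed

theorem trajectory_differentiable:
  fixes V :: "'a::euclidean_space \<Rightarrow> 'a" and V' :: "'a \<Rightarrow> 'a \<Rightarrow>\<^sub>L 'a"
  assumes W: "open W" and V: "\<And>x. x \<in> W \<Longrightarrow> (V has_derivative V' x) (at x)"
    and V': "continuous_on W V'" 
    and a: "\<And>t s. t \<in> I \<Longrightarrow> a t s \<in> W" 
            "\<And>t s. t \<in> I \<Longrightarrow> (a t has_vector_derivative V (a t s)) (at s)"
    and I: "open I" 
    and c: "\<And>t. t \<in> I \<Longrightarrow> ((\<lambda>t. a t 0) has_vector_derivative c t) (at t)"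
  obtains b where "\<And>t. t \<in> I \<Longrightarrow> b t 0 = c t"
    "\<And>t s. t \<in> I \<Longrightarrow> (b t has_vector_derivative V' (a t s) (b t s)) (at s)"
    "\<And>t s. t \<in> I \<Longrightarrow> ((\<lambda>t. a t s) has_vector_derivative b t s) (at t)"
    "continuous_on I c \<Longrightarrow> (\<And>s. continuous_on I (\<lambda>t. b t s))"
proof -
  \<comment> \<open>The local lemma yields a function that depends on the time bound
    \<open>T\<close>; describing it as a \<open>t\<close>-derivative makes the pieces agree, so that
    one \<open>b\<close> serves for all \<open>s\<close>.\<close>
  define b where "b t s = vector_derivative (\<lambda>t. a t s) (at t)" for t s
  have loc: "b t 0 = c t \<and> (b t has_vector_derivative V' (a t s) (b t s)) (at s) \<and>
        ((\<lambda>t. a t s) has_vector_derivative b t s) (at t)" if t: "t \<in> I" for t s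
  proof -
    have T: "\<bar>s\<bar> + 1 > 0" by simp
    obtain \<beta> where \<beta>: "\<beta> 0 = c t" "\<And>\<sigma>. \<bar>\<sigma>\<bar> < \<bar>s\<bar> + 1 \<Longrightarrow> (\<beta> has_vector_derivative V' (a t \<sigma>) (\<beta> \<sigma>)) (at \<sigma>)"
            "\<And>\<sigma>. \<bar>\<sigma>\<bar> < \<bar>s\<bar> + 1 \<Longrightarrow> ((\<lambda>t. a t \<sigma>) has_vector_derivative \<beta> \<sigma>) (at t)"
      using trajectory_differentiable_local[OF W V V' a I t c[OF t] T] by blast
    have eq: "b t \<sigma> = \<beta> \<sigma>" if "\<bar>\<sigma>\<bar> < \<bar>s\<bar> + 1" for \<sigma>
      unfolding b_def using \<beta>(3)[OF that] by (rule vector_derivative_at)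
    have "(b t has_vector_derivative V' (a t s) (\<beta> s)) (at s)"
    proof (rule has_vector_derivative_transform_within_open[OF \<beta>(2)])
      show "open {- (\<bar>s\<bar> + 1)<..<\<bar>s\<bar> + 1}" "s \<in> {- (\<bar>s\<bar> + 1)<..<\<bar>s\<bar> + 1}" by auto
      show "\<beta> x = b t x" if "x \<in> {- (\<bar>s\<bar> + 1)<..<\<bar>s\<bar> + 1}" for x
        using eq[of x] that by (simp add: abs_less_iff)
    qed simp
    then show ?thesis using \<beta>(1) \<beta>(3)[of s] eq[of 0] eq[of s] by simp
  qed
  have "continuous_on I (\<lambda>t. b t s)" if cc: "continuous_on I c" for s
  proof (intro continuous_at_imp_continuous_on ballI)
    fix t assume t: "t \<in> I"
    have "isCont c t" using cc I t continuous_on_eq_continuous_at by blast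
    moreover have "\<forall>\<^sub>F x in nhds t. b x 0 = c x"
      unfolding eventually_nhds using loc I t by (intro exI[of _ I]) simp
    ultimately have b0: "isCont (\<lambda>t. b t 0) t" by (simp add: isCont_cong)
    show "isCont (\<lambda>t. b t s) t"
      by (rule variation_continuous[where b = b, OF W V V' a I t has_vector_derivative_continuous[OF c[OF t]] b0])
         (use loc in blast)+
  qed
  then show thesis by (intro that[of b]) (use loc in blast)+
qed

subsection \<open>Local existence for autonomous equations\<close>

text \<open>Picard's theorem through the contraction principle on bounded continuous functions on
  the whole line; \<open>bnd\<close> keeps the iterates bounded.\<close>

lemma autonomous_ode_lipschitz:
  fixes f :: "'a::euclidean_space \<Rightarrow> 'a"
  assumes lip: "L-lipschitz_on UNIV f" and bnd: "\<And>x. norm (f x) \<le> B"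
  obtains \<delta> u where "\<delta> > 0" "u 0 = p" "\<And>t. \<bar>t\<bar> < \<delta> \<Longrightarrow> (u has_vector_derivative f (u t)) (at t)"
proof -
  have L: "L \<ge> 0" using lip by (rule lipschitz_on_nonneg)
  have B: "B \<ge> 0" using bnd norm_ge_zero order_trans by blast
  \<comment> \<open>Two Picard iterates differ by integrals over lengths at most
    \<open>2 * \<delta>\<close> and \<open>\<delta>\<close>, so the contraction factor is
    \<open>3 * \<delta> * L\<close>, kept at or below 3/4.\<close>
  define \<delta> where "\<delta> = 1 / (4 * (L + 1))"
  have \<delta>: "\<delta> > 0" "3 * \<delta> * L \<le> 3/4" using L by (auto simp: \<delta>_def field_simps)
  \<comment> \<open>Subtracting the integral up to 0 produces the oriented integral from 0 to
    \<open>t\<close> for either sign of \<open>t\<close>.\<close>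
  define J where "J g t = p + integral {-\<delta>..t} g - integral {-\<delta>..0} g" for g :: "real \<Rightarrow> 'a" and t
  \<comment> \<open>Freezing the time outside the interval turns a Picard iterate into a bounded
    continuous function on all of the line; inside the interval \<open>cl\<close> is the
    identity.\<close>
  define cl where "cl t = max (-\<delta>) (min \<delta> t)" for t
  have cl: "cl t \<in> {-\<delta>..\<delta>}" for t using \<delta> by (auto simp: cl_def)
  define \<Phi> where "\<Phi> u = Bcontfun (\<lambda>t. J (\<lambda>t. f (apply_bcontfun u t)) (cl t))" for u :: "real \<Rightarrow>\<^sub>C 'a"
  have fu: "continuous_on S (\<lambda>t. f (apply_bcontfun u t))" for u :: "real \<Rightarrow>\<^sub>C 'a" and S
    using continuous_on_compose2[OF lipschitz_on_continuous_on[OF lip]] by (metis continuous_on_apply_bcontfun subset_UNIV)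
  have int: "norm (integral {-\<delta>..t} g) \<le> b * (2 * \<delta>)"
    if "t \<in> {-\<delta>..\<delta>}" "continuous_on {-\<delta>..t} g" "\<And>t. norm (g t) \<le> b" "b \<ge> 0" for t b and g :: "real \<Rightarrow> 'a"
  proof -
    have "norm (integral {-\<delta>..t} g) \<le> b * (t - - \<delta>)"
      by (rule integral_bound) (use that in auto)
    also have "\<dots> \<le> b * (2 * \<delta>)" using that by (intro mult_left_mono) auto
    finally show ?thesis .
  qed
  have int0: "norm (integral {-\<delta>..0} g) \<le> b * \<delta>"
    if "continuous_on {-\<delta>..0} g" "\<And>t. norm (g t) \<le> b" for b and g :: "real \<Rightarrow> 'a"
    using integral_bound[of "-\<delta>" 0 g b] that \<delta> by auto
  have \<Phi>: "apply_bcontfun (\<Phi> u) t = J (\<lambda>t. f (apply_bcontfun u t)) (cl t)" for u t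
  proof -
    have "(\<lambda>t. J (\<lambda>t. f (apply_bcontfun u t)) (cl t)) \<in> bcontfun"
    proof (rule bcontfun_normI)
      have "continuous_on {-\<delta>..\<delta>} (\<lambda>t. J (\<lambda>t. f (apply_bcontfun u t)) t)"
        unfolding J_def
        by (intro continuous_intros indefinite_integral_continuous_1 integrable_continuous_interval fu)
      moreover have "continuous_on UNIV cl" unfolding cl_def by (intro continuous_intros)
      ultimately show "continuous_on UNIV (\<lambda>t. J (\<lambda>t. f (apply_bcontfun u t)) (cl t))"
        by (rule continuous_on_compose2) (use cl in auto)
      show "norm (J (\<lambda>t. f (apply_bcontfun u t)) (cl t)) \<le> norm p + B * (2 * \<delta>) + B * \<delta>" for t
      proof -
        have "norm (J (\<lambda>t. f (apply_bcontfun u t)) (cl t)) \<le> norm p + norm (integral {-\<delta>..cl t} (\<lambda>t. f (apply_bcontfun u t)))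
            + norm (integral {-\<delta>..0} (\<lambda>t. f (apply_bcontfun u t)))"
          unfolding J_def by (rule order_trans[OF norm_triangle_ineq4 add_right_mono[OF norm_triangle_ineq]])
        then show ?thesis 
          using int[OF cl fu bnd B, of t u] int0[OF fu bnd, of u] by linarith
      qed
    qed
    then show ?thesis by (simp add: \<Phi>_def Bcontfun_inverse)
  qed
  have contr: "dist (\<Phi> u) (\<Phi> v) \<le> 3/4 * dist u v" for u v
  proof (rule dist_bound)
    fix t
    define g where "g t = f (apply_bcontfun u t) - f (apply_bcontfun v t)" for t
    have gc: "continuous_on S g" for S unfolding g_def by (intro continuous_intros fu)
    have gb: "norm (g t) \<le> L * dist u v" for t
      using lipschitz_onD[OF lip UNIV_I UNIV_I, of "apply_bcontfun u t" "apply_bcontfun v t"]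
        mult_left_mono[OF dist_bounded[of u t v] L]
      by (simp add: g_def dist_norm)
    have "J (\<lambda>t. f (apply_bcontfun u t)) (cl t) - J (\<lambda>t. f (apply_bcontfun v t)) (cl t)
       = integral {-\<delta>..cl t} g - integral {-\<delta>..0} g"
      unfolding J_def g_def
      by (simp add: Henstock_Kurzweil_Integration.integral_diff[OF integrable_continuous_interval[OF fu] integrable_continuous_interval[OF fu]])
    then have "dist (apply_bcontfun (\<Phi> u) t) (apply_bcontfun (\<Phi> v) t) \<le> norm (integral {-\<delta>..cl t} g) + norm (integral {-\<delta>..0} g)"
      unfolding \<Phi> dist_norm by (simp add: norm_triangle_ineq4)
    also have "\<dots> \<le> L * dist u v * (2 * \<delta>) + L * dist u v * \<delta>"
      by (intro add_mono int int0 cl gc gb) (use L in auto)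
    also have "\<dots> = (3 * \<delta> * L) * dist u v" by (simp add: algebra_simps)
    also have "\<dots> \<le> 3/4 * dist u v" using \<delta> by (intro mult_right_mono) auto
    finally show "dist (apply_bcontfun (\<Phi> u) t) (apply_bcontfun (\<Phi> v) t) \<le> 3/4 * dist u v" .
  qed
  have "\<exists>!u. \<Phi> u = u"
    by (rule banach_fix_type[of "3/4"]) (use contr in auto)
  then obtain u where u: "\<Phi> u = u" by blast
  define g where "g t = f (apply_bcontfun u t)" for t
  have ueq: "apply_bcontfun u t = J g t" if "\<bar>t\<bar> < \<delta>" for t
    using \<Phi>[of u t] that unfolding u g_def by (simp add: cl_def)
  have "(apply_bcontfun u has_vector_derivative f (apply_bcontfun u t)) (at t)" if t: "\<bar>t\<bar> < \<delta>" for t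
  proof -
    have t': "t \<in> {-\<delta><..<\<delta>}" "t \<in> {-\<delta>..\<delta>}" using t by auto
    have "((\<lambda>x. integral {-\<delta>..x} g) has_vector_derivative g t) (at t within {-\<delta>..\<delta>})"
      by (rule integral_has_vector_derivative) (use fu t' in \<open>auto simp: g_def\<close>)
    then have "((\<lambda>x. integral {-\<delta>..x} g) has_vector_derivative g t) (at t within {-\<delta><..<\<delta>})"
      by (rule has_vector_derivative_within_subset) auto
    then have "((\<lambda>x. integral {-\<delta>..x} g) has_vector_derivative g t) (at t)"
      using at_within_open[OF t'(1)] by simp
    then have "((\<lambda>x. p + integral {-\<delta>..x} g - integral {-\<delta>..0} g) has_vector_derivative g t) (at t)"
      by (auto intro!: derivative_eq_intros)
    then have "((\<lambda>x. J g x) has_vector_derivative g t) (at t)" unfolding J_def .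
    then have "(apply_bcontfun u has_vector_derivative g t) (at t)"
      by (rule has_vector_derivative_transform_within_open[where S = "{-\<delta><..<\<delta>}"]) (use t' ueq in auto)
    then show ?thesis by (simp add: g_def)
  qed
  moreover have "apply_bcontfun u 0 = p" using ueq[of 0] \<delta> by (simp add: J_def)
  ultimately show thesis using that \<delta>(1) by blast
qed

text \<open>Composing with the closest-point retraction onto the ball, which is 1-Lipschitz, makes
  the field globally Lipschitz and bounded. By continuity the solution stays in the ball for a short
  time, and there the retraction is the identity.\<close>

lemma autonomous_ode_exists:
  fixes f :: "'a::euclidean_space \<Rightarrow> 'a"
  assumes lip: "L-lipschitz_on (cball p r) f" and r: "r > 0"
  obtains \<delta> u where "\<delta> > 0" "u 0 = p" "\<And>t. \<bar>t\<bar> < \<delta> \<Longrightarrow> u t \<in> cball p r"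
    "\<And>t. \<bar>t\<bar> < \<delta> \<Longrightarrow> (u has_vector_derivative f (u t)) (at t)"
proof -
  define P where "P = closest_point (cball p r)"
  have P: "P x \<in> cball p r" for x unfolding P_def using r by (intro closest_point_in_set) auto
  have Pid: "P x = x" if "x \<in> cball p r" for x unfolding P_def using that by (rule closest_point_self)
  have "1-lipschitz_on UNIV P"
    using r unfolding P_def by (intro lipschitz_onI) (auto intro!: closest_point_lipschitz)
  moreover have "L-lipschitz_on (P ` UNIV) f" using lip by (rule lipschitz_on_subset) (use P in auto)
  ultimately have 1: "(L * 1)-lipschitz_on UNIV (f \<circ> P)" by (rule lipschitz_on_compose)
  have "bounded (f ` cball p r)"
    using compact_continuous_image[OF lipschitz_on_continuous_on[OF lip] compact_cball] by (rule compact_imp_bounded)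
  then obtain B where "\<And>x. x \<in> cball p r \<Longrightarrow> norm (f x) \<le> B" unfolding bounded_iff by (metis imageI)
  then have 2: "norm ((f \<circ> P) x) \<le> B" for x using P by simp
  obtain \<delta> u where u: "\<delta> > 0" "u 0 = p" "\<And>t. \<bar>t\<bar> < \<delta> \<Longrightarrow> (u has_vector_derivative (f \<circ> P) (u t)) (at t)"
    by (rule autonomous_ode_lipschitz[OF 1 2]) (rule that)
  have "isCont u 0" using has_vector_derivative_continuous[OF u(3)[of 0]] u(1) by simp
  then obtain e where e: "e > 0" "\<And>t. dist t 0 < e \<Longrightarrow> dist (u t) (u 0) < r"
    unfolding continuous_at_eps_delta using r by meson
  have in_ball: "u t \<in> cball p r" if "\<bar>t\<bar> < min \<delta> e" for t
    using e(2)[of t] that u(2) by (simp add: dist_commute)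
  show thesis
  proof (rule that[of "min \<delta> e" u])
    show "(u has_vector_derivative f (u t)) (at t)" if "\<bar>t\<bar> < min \<delta> e" for t
      using u(3)[of t] that Pid[OF in_ball[OF that]] by simp
  qed (use u e in_ball in auto)
qed

subsection \<open>Complete lift of a vector field\<close>

text \<open>Version with the derivative as a plain function, whose continuity is tested on basis
  vectors, which suffices in finite dimension. The last conclusion is new: a solution of a linear
  equation that vanishes once vanishes always, so regular curves are transported to regular
  curves.\<close>

lemma trajectory_differentiable_frechet:
  fixes V :: "'a::euclidean_space \<Rightarrow> 'a" and V' :: "'a \<Rightarrow> 'a \<Rightarrow> 'a"
  assumes W: "open W" and V: "\<And>x. x \<in> W \<Longrightarrow> (V has_derivative V' x) (at x)"
    and V': "\<And>i. i \<in> Basis \<Longrightarrow> continuous_on W (\<lambda>x. V' x i)" 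
    and a: "\<And>t s. t \<in> I \<Longrightarrow> a t s \<in> W" 
            "\<And>t s. t \<in> I \<Longrightarrow> (a t has_vector_derivative V (a t s)) (at s)"
    and I: "open I" 
    and c: "\<And>t. t \<in> I \<Longrightarrow> ((\<lambda>t. a t 0) has_vector_derivative c t) (at t)"
  obtains b where "\<And>t. t \<in> I \<Longrightarrow> b t 0 = c t"
    "\<And>t s. t \<in> I \<Longrightarrow> (b t has_vector_derivative V' (a t s) (b t s)) (at s)"
    "\<And>t s. t \<in> I \<Longrightarrow> ((\<lambda>t. a t s) has_vector_derivative b t s) (at t)"
    "\<And>s. continuous_on I c \<Longrightarrow> continuous_on I (\<lambda>t. b t s)"
    "\<And>t s. t \<in> I \<Longrightarrow> b t s = 0 \<Longrightarrow> c t = 0"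
proof -
  define VB where "VB x = Blinfun (V' x)" for x
  have VB: "blinfun_apply (VB x) = V' x" if "x \<in> W" for x
    unfolding VB_def using has_derivative_bounded_linear[OF V[OF that]] by (rule bounded_linear_Blinfun_apply)
  have d: "(V has_derivative VB x) (at x)" if "x \<in> W" for x using V[OF that] VB[OF that] by simp
  have cont: "continuous_on W VB"
  proof (rule continuous_on_blinfun_componentwise)
    fix i :: 'a assume "i \<in> Basis"
    from V'[OF this] show "continuous_on W (\<lambda>x. VB x i)"
      by (rule continuous_on_cong[THEN iffD1, rotated 2]) (simp_all add: VB)
  qed
  obtain b where b: "\<And>t. t \<in> I \<Longrightarrow> b t 0 = c t"
    "\<And>t s. t \<in> I \<Longrightarrow> (b t has_vector_derivative VB (a t s) (b t s)) (at s)"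
    "\<And>t s. t \<in> I \<Longrightarrow> ((\<lambda>t. a t s) has_vector_derivative b t s) (at t)"
    "\<And>s. continuous_on I c \<Longrightarrow> continuous_on I (\<lambda>t. b t s)"
    by (rule trajectory_differentiable[OF W d cont a I c]) (assumption | rule that; assumption)+
  have "c t = 0" if t: "t \<in> I" and z: "b t s = 0" for t s
  proof -
    define T where "T = \<bar>s\<bar>"
    have "continuous_on {-T..T} (\<lambda>\<sigma>. VB (a t \<sigma>))"
      by (rule continuous_on_compose2[OF cont])
         (use a(1)[OF t] in \<open>auto intro!: continuous_at_imp_continuous_on has_vector_derivative_continuous[OF a(2)[OF t]]\<close>)
    then have "bounded ((\<lambda>\<sigma>. VB (a t \<sigma>)) ` {-T..T})" by (intro compact_imp_bounded compact_continuous_image) auto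
    then obtain M where M: "\<And>\<sigma>. \<sigma> \<in> {-T..T} \<Longrightarrow> norm (VB (a t \<sigma>)) \<le> M" unfolding bounded_iff by (metis imageI)
    have "b t 0 = 0"
    proof (rule gronwall_zero[where K = M and T = T, OF b(2)[OF t]])
      fix \<sigma> assume "\<bar>\<sigma>\<bar> \<le> T"
      then have "\<sigma> \<in> {-T..T}" by (auto simp: abs_le_iff)
      then show "norm (VB (a t \<sigma>) (b t \<sigma>)) \<le> M * norm (b t \<sigma>)"
        using order_trans[OF norm_blinfun mult_right_mono[OF M norm_ge_zero]] by blast
    qed (use z in \<open>auto simp: T_def\<close>)
    then show ?thesis using b(1)[OF t] by simp
  qed
  then show thesis by (intro that[of b]) (use b VB a in auto)
qed

locale smooth_vector_field =
  fixes U :: "'a::euclidean_space set" and X :: "'a \<Rightarrow> 'a"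
  assumes open_U: "open U" and smooth_X: "s \<in> Basis \<Longrightarrow> C_inf_on U (\<lambda>u. X u \<bullet> s)"
begin

definition DX :: "'a \<Rightarrow> 'a \<Rightarrow> 'a" where
  "DX x v = (\<Sum>s\<in>Basis. fd (\<lambda>u. X u \<bullet> s) x v *\<^sub>R s)"

text \<open>The derivative in direction \<open>v\<close> of \<open>DX x w\<close> as a function of
  \<open>x\<close>, with \<open>w\<close> held fixed.\<close>

definition D2X :: "'a \<Rightarrow> 'a \<Rightarrow> 'a \<Rightarrow> 'a" where
  "D2X x v w = (\<Sum>s\<in>Basis. (\<Sum>r\<in>Basis. fd (fpd r (\<lambda>u. X u \<bullet> s)) x v * (w \<bullet> r)) *\<^sub>R s)"

text \<open>\<open>X1\<close> is the complete lift of \<open>X\<close>; its flow is the differential of the flow of \<open>X\<close>.\<close>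

definition X1 :: "'a \<times> 'a \<Rightarrow> 'a \<times> 'a" where
  "X1 p = (X (fst p), DX (fst p) (snd p))"

definition DX1 :: "'a \<times> 'a \<Rightarrow> 'a \<times> 'a \<Rightarrow> 'a \<times> 'a" where
  "DX1 p v = (DX (fst p) (fst v), D2X (fst p) (fst v) (snd p) + DX (fst p) (snd v))"

lemma linear_DX: "linear (DX x)"
  unfolding DX_def
  by (rule linearI) (auto simp: linear_add[OF linear_fd] linear_scale[OF linear_fd] algebra_simps sum.distrib scaleR_sum_right)

lemma X_has_derivative: "x \<in> U \<Longrightarrow> (X has_derivative DX x) (at x)"
proof -
  assume x: "x \<in> U"
  have "((\<lambda>u. \<Sum>s\<in>Basis. (X u \<bullet> s) *\<^sub>R s) has_derivative DX x) (at x)"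
    unfolding DX_def
    by (intro has_derivative_sum has_derivative_scaleR_left C_inf_on_has_derivative[OF smooth_X open_U x])
  then show ?thesis by (simp add: euclidean_representation)
qed

lemma continuous_on_DX: "continuous_on S f \<Longrightarrow> f ` S \<subseteq> U \<Longrightarrow> continuous_on S v \<Longrightarrow> continuous_on S (\<lambda>z. DX (f z) (v z))"
  unfolding DX_def by (intro continuous_intros continuous_on_fd[OF smooth_X])

lemma X1_has_derivative:
  assumes p: "p \<in> U \<times> UNIV"
  shows "(X1 has_derivative DX1 p) (at p)"
proof -
  have x: "fst p \<in> U" using p by auto
  have DX_alt: "DX x v = (\<Sum>s\<in>Basis. (\<Sum>r\<in>Basis. fpd r (\<lambda>u. X u \<bullet> s) x * (v \<bullet> r)) *\<^sub>R s)" for x v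
    by (simp add: DX_def fd_def)
  have comp: "((\<lambda>p. f (fst p)) has_derivative (\<lambda>v. fd f (fst p) (fst v))) (at p)" if "C_inf_on U f" for f
    by (rule has_derivative_compose[OF has_derivative_fst[OF has_derivative_ident] C_inf_on_has_derivative[OF that open_U x]])
  have snd: "((\<lambda>p. snd p \<bullet> r) has_derivative (\<lambda>v. snd v \<bullet> r)) (at p)" for r :: 'a
    by (intro has_derivative_inner_left has_derivative_snd has_derivative_ident)
  have "((\<lambda>p. DX (fst p) (snd p)) has_derivative (\<lambda>v. \<Sum>s\<in>Basis. (\<Sum>r\<in>Basis. 
       fpd r (\<lambda>u. X u \<bullet> s) (fst p) * (snd v \<bullet> r) + fd (fpd r (\<lambda>u. X u \<bullet> s)) (fst p) (fst v) * (snd p \<bullet> r)) *\<^sub>R s)) (at p)"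
    unfolding DX_alt
    by (intro has_derivative_sum has_derivative_scaleR_left has_derivative_mult comp snd C_inf_on_fpd smooth_X)
  moreover have "((\<lambda>p. X (fst p)) has_derivative (\<lambda>v. DX (fst p) (fst v))) (at p)"
    by (rule has_derivative_compose[OF has_derivative_fst[OF has_derivative_ident] X_has_derivative[OF x]])
  ultimately have "(X1 has_derivative (\<lambda>v. (DX (fst p) (fst v), \<Sum>s\<in>Basis. (\<Sum>r\<in>Basis. 
       fpd r (\<lambda>u. X u \<bullet> s) (fst p) * (snd v \<bullet> r) + fd (fpd r (\<lambda>u. X u \<bullet> s)) (fst p) (fst v) * (snd p \<bullet> r)) *\<^sub>R s))) (at p)"
    unfolding X1_def[abs_def] by (intro has_derivative_Pair)
  moreover have "(\<Sum>s\<in>Basis. (\<Sum>r\<in>Basis. 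
       fpd r (\<lambda>u. X u \<bullet> s) (fst p) * (snd v \<bullet> r) + fd (fpd r (\<lambda>u. X u \<bullet> s)) (fst p) (fst v) * (snd p \<bullet> r)) *\<^sub>R s)
     = D2X (fst p) (fst v) (snd p) + DX (fst p) (snd v)" for v
    by (simp add: DX_alt D2X_def sum.distrib scaleR_add_left)
  ultimately show ?thesis by (simp add: DX1_def[abs_def])
qed

lemma continuous_on_DX1: "continuous_on (U \<times> UNIV) (\<lambda>p. DX1 p v)"
  unfolding DX1_def D2X_def
  by (intro continuous_intros continuous_on_DX continuous_on_fd[OF C_inf_on_fpd[OF smooth_X]]) auto

text \<open>Two applications of the differentiability theorem: the trajectories
  \<open>\<phi> s (\<gamma> t)\<close> of \<open>X\<close> give the velocities \<open>b\<close>, and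
  the pairs of point and velocity are in turn trajectories of \<open>X1\<close>, whose
  \<open>t\<close>-derivative contains the accelerations \<open>c\<close>.\<close>

lemma flow_prolongation:
  assumes flow: "global_flow U X \<phi>" and I: "open I" and U: "\<And>t. t \<in> I \<Longrightarrow> \<gamma> t \<in> U"
    and g: "\<And>t. t \<in> I \<Longrightarrow> (\<gamma> has_vector_derivative \<gamma>' t) (at t)"
           "\<And>t. t \<in> I \<Longrightarrow> (\<gamma>' has_vector_derivative \<gamma>'' t) (at t)" "continuous_on I \<gamma>''"
  obtains b c where
    "\<And>t. t \<in> I \<Longrightarrow> b t 0 = \<gamma>' t" "\<And>t. t \<in> I \<Longrightarrow> c t 0 = \<gamma>'' t"
    "\<And>t s. t \<in> I \<Longrightarrow> ((\<lambda>t. \<phi> s (\<gamma> t)) has_vector_derivative b t s) (at t)"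
    "\<And>t s. t \<in> I \<Longrightarrow> ((\<lambda>t. b t s) has_vector_derivative c t s) (at t)"
    "\<And>s. continuous_on I (\<lambda>t. c t s)"
    "\<And>t s. t \<in> I \<Longrightarrow> ((\<lambda>s. (\<phi> s (\<gamma> t), b t s)) has_vector_derivative X1 (\<phi> s (\<gamma> t), b t s)) (at s)"
    "\<And>t s. t \<in> I \<Longrightarrow> ((\<lambda>s. (b t s, c t s)) has_vector_derivative DX1 (\<phi> s (\<gamma> t), b t s) (b t s, c t s)) (at s)"
    "\<And>t s. t \<in> I \<Longrightarrow> b t s = 0 \<Longrightarrow> \<gamma>' t = 0"
proof -
  define a where "a t s = \<phi> s (\<gamma> t)" for t s
  have fl: "\<phi> 0 p = p" "\<phi> s p \<in> U" "((\<lambda>s. \<phi> s p) has_vector_derivative X (\<phi> s p)) (at s)" if "p \<in> U" for p s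
    using flow that unfolding global_flow_def by auto
  have a: "a t s \<in> U" "(a t has_vector_derivative X (a t s)) (at s)" if "t \<in> I" for t s
    using fl[OF U[OF that]] by (auto simp: a_def[abs_def])
  have init: "((\<lambda>t. a t 0) has_vector_derivative \<gamma>' t) (at t)" if t: "t \<in> I" for t
    by (rule has_vector_derivative_transform_within_open[OF g(1)[OF t] I t]) (use fl U in \<open>auto simp: a_def\<close>)
  have contX: "continuous_on U (\<lambda>x. DX x i)" for i by (rule continuous_on_DX) (auto intro: continuous_intros)
  obtain b where b: "\<And>t. t \<in> I \<Longrightarrow> b t 0 = \<gamma>' t"
    "\<And>t s. t \<in> I \<Longrightarrow> (b t has_vector_derivative DX (a t s) (b t s)) (at s)"
    "\<And>t s. t \<in> I \<Longrightarrow> ((\<lambda>t. a t s) has_vector_derivative b t s) (at t)"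
    "\<And>t s. t \<in> I \<Longrightarrow> b t s = 0 \<Longrightarrow> \<gamma>' t = 0"
    by (rule trajectory_differentiable_frechet[OF open_U X_has_derivative contX a I init]) (assumption | rule that; assumption)+
  define q where "q t s = (a t s, b t s)" for t s
  have q: "q t s \<in> U \<times> UNIV" "(q t has_vector_derivative X1 (q t s)) (at s)" if t: "t \<in> I" for t s
  proof -
    show "q t s \<in> U \<times> UNIV" using a t by (simp add: q_def)
    show "(q t has_vector_derivative X1 (q t s)) (at s)"
      unfolding q_def[abs_def] X1_def fst_conv snd_conv
      by (rule has_vector_derivative_Pair[OF a(2)[OF t] b(2)[OF t]])
  qed
  have initq: "((\<lambda>t. q t 0) has_vector_derivative (\<gamma>' t, \<gamma>'' t)) (at t)" if t: "t \<in> I" for t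
    by (rule has_vector_derivative_transform_within_open[OF has_vector_derivative_Pair[OF init[OF t] g(2)[OF t]] I t])
       (use b(1) in \<open>auto simp: q_def\<close>)
  have openq: "open (U \<times> (UNIV :: 'a set))" using open_U by (intro open_Times) auto
  obtain Q where Q: "\<And>t. t \<in> I \<Longrightarrow> Q t 0 = (\<gamma>' t, \<gamma>'' t)"
    "\<And>t s. t \<in> I \<Longrightarrow> (Q t has_vector_derivative DX1 (q t s) (Q t s)) (at s)"
    "\<And>t s. t \<in> I \<Longrightarrow> ((\<lambda>t. q t s) has_vector_derivative Q t s) (at t)"
    "\<And>s. continuous_on I (\<lambda>t. (\<gamma>' t, \<gamma>'' t)) \<Longrightarrow> continuous_on I (\<lambda>t. Q t s)"
    by (rule trajectory_differentiable_frechet[OF openq X1_has_derivative continuous_on_DX1 q I initq]) (assumption | rule that; assumption)+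
  define c where "c t s = snd (Q t s)" for t s
  \<comment> \<open>The second application yields a pair whose first component is again a
    \<open>t\<close>-derivative of the point, hence equal to \<open>b\<close> by uniqueness of
    derivatives.\<close>
  have fstQ: "fst (Q t s) = b t s" if t: "t \<in> I" for t s
  proof -
    have "((\<lambda>t. fst (q t s)) has_vector_derivative fst (Q t s)) (at t)"
      by (rule bounded_linear.has_vector_derivative[OF bounded_linear_fst Q(3)[OF t]])
    then show ?thesis using b(3)[OF t] vector_derivative_unique_at by (simp add: q_def) blast
  qed
  then have Qeq: "Q t s = (b t s, c t s)" if "t \<in> I" for t s using that by (simp add: c_def prod_eq_iff)
  have "continuous_on I \<gamma>'"
    using g(2) by (auto intro!: continuous_at_imp_continuous_on has_vector_derivative_continuous)
  then have cont: "continuous_on I (\<lambda>t. Q t s)" for s using Q(4) g(3) continuous_on_Pair by blast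
  show thesis
  proof (rule that[of b c])
    show "c t 0 = \<gamma>'' t" if "t \<in> I" for t using Q(1)[OF that] by (simp add: c_def)
    show "((\<lambda>t. \<phi> s (\<gamma> t)) has_vector_derivative b t s) (at t)" if "t \<in> I" for t s
      using b(3)[OF that] by (simp add: a_def)
    show "((\<lambda>t. b t s) has_vector_derivative c t s) (at t)" if "t \<in> I" for t s
      using bounded_linear.has_vector_derivative[OF bounded_linear_snd Q(3)[OF that]] by (simp add: q_def c_def)
    show "continuous_on I (\<lambda>t. c t s)" for s
      unfolding c_def by (intro continuous_on_snd cont)
    show "((\<lambda>s. (\<phi> s (\<gamma> t), b t s)) has_vector_derivative X1 (\<phi> s (\<gamma> t), b t s)) (at s)" if "t \<in> I" for t s
      using q(2)[OF that] by (simp add: q_def[abs_def] a_def)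
    show "((\<lambda>s. (b t s, c t s)) has_vector_derivative DX1 (\<phi> s (\<gamma> t), b t s) (b t s, c t s)) (at s)" if "t \<in> I" for t s
    proof -
      have "(\<lambda>s. (b t s, c t s)) = Q t" using Qeq[OF that] by (intro ext) simp
      then show ?thesis using Q(2)[OF that, of s] unfolding Qeq[OF that, of s] q_def a_def by simp
    qed
  qed (use b in auto)
qed

end

subsection \<open>Finsler functions and the geodesic spray\<close>

lemma dx_Basis: "i \<in> Basis \<Longrightarrow> dx i \<in> Basis" and dy_Basis: "i \<in> Basis \<Longrightarrow> dy i \<in> Basis"
  by (auto simp: dx_def dy_def Basis_prod_def)

lemma sum_Basis_Times:
  fixes f :: "'a::euclidean_space \<times> 'b::euclidean_space \<Rightarrow> 'c::comm_monoid_add"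
  shows "sum f Basis = (\<Sum>i\<in>Basis. f (i, 0)) + (\<Sum>i\<in>Basis. f (0, i))"
proof -
  have "inj_on (\<lambda>u. (u::'a, 0::'b)) Basis" "inj_on (\<lambda>u. (0::'a, u::'b)) Basis"
    by (auto intro!: inj_onI Pair_inject)
  then show ?thesis
    unfolding Basis_prod_def by (subst sum.union_disjoint) (auto simp: Basis_prod_def sum.reindex)
qed

lemma fd_Pair:
  "fd f p (v, w) = (\<Sum>k\<in>Basis. fpd (dx k) f p * (v \<bullet> k)) + (\<Sum>k\<in>Basis. fpd (dy k) f p * (w \<bullet> k))"
  unfolding fd_def sum_Basis_Times by (simp add: dx_def dy_def)

lemmas fd_linear_simps = linear_add[OF linear_fd] linear_diff[OF linear_fd] linear_scale[OF linear_fd] linear_0[OF linear_fd]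

text \<open>The derivative in direction \<open>v\<close> of \<open>fd f p w\<close> as a function of
  \<open>p\<close>, with \<open>w\<close> held fixed; it is the term that \<open>fd_chain\<close>
  adds when the base point moves.\<close>

definition fd2 :: "('a::euclidean_space \<Rightarrow> real) \<Rightarrow> 'a \<Rightarrow> 'a \<Rightarrow> 'a \<Rightarrow> real" where
  "fd2 f p v w = (\<Sum>b\<in>Basis. fd (fpd b f) p v * (w \<bullet> b))"

lemma fd_chain:
  assumes f: "C_inf_on S f" "open S" "q s \<in> S" and q: "(q has_vector_derivative q') (at s)"
    and w: "(w has_vector_derivative w') (at s)"
  shows "((\<lambda>s. fd f (q s) (w s)) has_real_derivative fd2 f (q s) q' (w s) + fd f (q s) w') (at s)"
proof -
  have "((\<lambda>s. w s \<bullet> b) has_real_derivative w' \<bullet> b) (at s)" for b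
    using bounded_linear.has_vector_derivative[OF bounded_linear_inner_left w]
    by (simp add: has_real_derivative_iff_has_vector_derivative)
  then have "((\<lambda>s. \<Sum>b\<in>Basis. fpd b f (q s) * (w s \<bullet> b)) has_real_derivative 
      (\<Sum>b\<in>Basis. fd (fpd b f) (q s) q' * (w s \<bullet> b) + (w' \<bullet> b) * fpd b f (q s))) (at s)"
    by (intro DERIV_sum DERIV_mult C_inf_on_chain[OF C_inf_on_fpd[OF f(1)] f(2,3) q])
  then show ?thesis unfolding fd_def[of f] fd2_def by (simp add: sum.distrib mult.commute)
qed

lemma continuous_on_fd2:
  assumes "C_inf_on S f" "continuous_on T q" "q ` T \<subseteq> S" "continuous_on T v" "continuous_on T w"
  shows "continuous_on T (\<lambda>t. fd2 f (q t) (v t) (w t))"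
  unfolding fd2_def
  by (intro continuous_intros continuous_on_fd[OF C_inf_on_fpd[OF assms(1)]] assms)

lemma has_vector_derivative_line: "((\<lambda>t. p + t *\<^sub>R v) has_vector_derivative v) (at t)"
  by (auto intro!: derivative_eq_intros)

lemma open_line_vimage:
  fixes p v :: "'a::real_normed_vector"
  assumes "open S"
  shows "open {t. p + t *\<^sub>R v \<in> S}"
proof -
  have "continuous_on UNIV (\<lambda>t. p + t *\<^sub>R v)" by (intro continuous_intros)
  from open_vimage[OF assms this] show ?thesis by (simp add: vimage_def)
qed

lemma fpd_eqI: "((\<lambda>t. f (p + t *\<^sub>R b)) has_real_derivative D) (at 0) \<Longrightarrow> fpd b f p = D"
  unfolding fpd_def by (rule DERIV_imp_deriv)

lemma C_inf_on_zero: "C_inf_on T (\<lambda>p::'a::euclidean_space. 0)"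
proof -
  have z: "fpd b (\<lambda>p. 0) = (\<lambda>p::'a. 0)" for b by (rule ext, rule fpd_eqI) simp
  then have "foldr fpd bs (\<lambda>p::'a. 0) = (\<lambda>p. 0)" for bs by (induction bs) auto
  then show ?thesis by (simp add: C_inf_on_def z)
qed

section \<open>Homogeneity and strong convexity of a Finsler function\<close>

locale finsler_chart =
  fixes U :: "'a::euclidean_space set" and F :: "'a \<times> 'a \<Rightarrow> real"
  assumes open_chart: "open U" and finsler: "finsler_on U F"
begin

abbreviation slit :: "('a \<times> 'a) set" where "slit \<equiv> U \<times> (UNIV - {0})"
abbreviation Fy :: "'a \<Rightarrow> 'a \<times> 'a \<Rightarrow> real" where "Fy i \<equiv> fpd (dy i) F"

lemma smooth_F: "C_inf_on slit F" and F_pos: "p \<in> slit \<Longrightarrow> F p > 0"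
  and F_hom: "x \<in> U \<Longrightarrow> c > 0 \<Longrightarrow> F (x, c *\<^sub>R v) = c * F (x, v)"
  using finsler unfolding finsler_on_def by auto

lemma open_slit: "open slit"
  using open_chart by (intro open_Times) auto

lemma smooth_Fx: "i \<in> Basis \<Longrightarrow> C_inf_on slit (fpd (dx i) F)" and smooth_Fy: "i \<in> Basis \<Longrightarrow> C_inf_on slit (Fy i)"
  by (auto intro: C_inf_on_fpd smooth_F dx_Basis dy_Basis)

text \<open>Covers both degrees of homogeneity that occur: along a ray \<open>F\<close> is affine
  with slope \<open>F p\<close> (Euler's relation), while \<open>Fy i\<close> is constant, so that
  \<open>D\<close> is 0.\<close>

lemma radial_derivative:
  assumes f: "C_inf_on slit f" and p: "p \<in> slit"
    and r: "\<And>t. -1 < t \<Longrightarrow> t < 1 \<Longrightarrow> f (fst p, (1 + t) *\<^sub>R snd p) = f p + t * D"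
  shows "fd f p (0, snd p) = D"
proof -
  have "((\<lambda>t. f (p + t *\<^sub>R (0, snd p))) has_real_derivative fd f (p + 0 *\<^sub>R (0, snd p)) (0, snd p)) (at 0)"
    by (rule C_inf_on_chain[OF f open_slit _ has_vector_derivative_line]) (use p in \<open>simp flip: zero_prod_def\<close>)
  moreover have "((\<lambda>t. f (p + t *\<^sub>R (0, snd p))) has_real_derivative D) (at 0)"
  proof (rule has_field_derivative_transform_within_open[where S = "{-1<..<1}"])
    show "((\<lambda>t. f p + t * D) has_real_derivative D) (at 0)" by (auto intro!: derivative_eq_intros)
    show "f p + t * D = f (p + t *\<^sub>R (0, snd p))" if "t \<in> {-1<..<1}" for t
      using r[of t] that by (cases p) (simp add: scaleR_add_left)
  qed auto
  ultimately show ?thesis using DERIV_unique by (fastforce simp flip: zero_prod_def)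
qed

lemma euler: "p \<in> slit \<Longrightarrow> fd F p (0, snd p) = F p"
  by (rule radial_derivative[OF smooth_F]) (auto simp: F_hom distrib_right)

text \<open>Moving \<open>c *\<^sub>R y\<close> by \<open>t\<close> is moving \<open>y\<close> by
  \<open>t / c\<close> and rescaling by \<open>c\<close>; the two factors cancel in the
  derivative.\<close>

lemma Fy_homogeneous:
  assumes x: "x \<in> U" and y: "y \<noteq> 0" and c: "c > 0" and i: "i \<in> Basis"
  shows "Fy i (x, c *\<^sub>R y) = Fy i (x, y)"
proof (rule fpd_eqI)
  have "((\<lambda>t. F ((x, y) + t *\<^sub>R dy i)) has_real_derivative Fy i (x, y)) (at (0 / c))"
    using C_inf_on_partial[OF smooth_F dy_Basis[OF i], of "(x, y)"] x y by simp
  then have "((\<lambda>t. c * F ((x, y) + (t / c) *\<^sub>R dy i)) has_real_derivative c * (Fy i (x, y) * (1 / c))) (at 0)"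
    by (intro DERIV_cmult DERIV_chain2[where f = "\<lambda>t. F ((x, y) + t *\<^sub>R dy i)"] DERIV_cdivide DERIV_ident)
  moreover have "c * F ((x, y) + (t / c) *\<^sub>R dy i) = F ((x, c *\<^sub>R y) + t *\<^sub>R dy i)" for t
    using F_hom[OF x c, of "y + (t / c) *\<^sub>R i"] c by (simp add: dy_def scaleR_add_right)
  ultimately show "((\<lambda>t. F ((x, c *\<^sub>R y) + t *\<^sub>R dy i)) has_real_derivative Fy i (x, y)) (at 0)"
    using c by simp
qed

lemma Fy_radial: "p \<in> slit \<Longrightarrow> i \<in> Basis \<Longrightarrow> fd (Fy i) p (0, snd p) = 0"
  using Fy_homogeneous[of "fst p" "snd p" _ i] by (intro radial_derivative[OF smooth_Fy]) (auto simp: mem_Times_iff)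

text \<open>Differentiates the identity \<open>eq\<close> in direction \<open>v\<close> by the
  product rule: \<open>p\<close> occurs both as the base point and, through \<open>snd p\<close>, as
  the direction.\<close>

lemma fd_vertical_chain:
  assumes f: "C_inf_on slit f" and p: "p \<in> slit" and g: "C_inf_on slit g"
    and eq: "\<And>p. p \<in> slit \<Longrightarrow> fd f p (0, snd p) = g p"
  shows "fd2 f p v (0, snd p) + fd f p (0, snd v) = fd g p v"
proof -
  have line: "((\<lambda>t. p + t *\<^sub>R v) has_vector_derivative v) (at 0)" by (rule has_vector_derivative_line)
  have line2: "((\<lambda>t. (0, snd (p + t *\<^sub>R v))) has_vector_derivative (0, snd v)) (at 0)"
    by (intro has_vector_derivative_Pair has_vector_derivative_const
        bounded_linear.has_vector_derivative[OF bounded_linear_snd line])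
  have 1: "((\<lambda>t. fd f (p + t *\<^sub>R v) (0, snd (p + t *\<^sub>R v))) has_real_derivative 
     (fd2 f (p + 0 *\<^sub>R v) v (0, snd (p + 0 *\<^sub>R v)) + fd f (p + 0 *\<^sub>R v) (0, snd v))) (at 0)"
    by (rule fd_chain[OF f open_slit _ line line2]) (use p in simp)
  have 2: "((\<lambda>t. g (p + t *\<^sub>R v)) has_real_derivative fd g (p + 0 *\<^sub>R v) v) (at 0)"
    by (rule C_inf_on_chain[OF g open_slit _ line]) (use p in simp)
  have "((\<lambda>t. fd f (p + t *\<^sub>R v) (0, snd (p + t *\<^sub>R v))) has_real_derivative fd g (p + 0 *\<^sub>R v) v) (at 0)"
  proof (rule has_field_derivative_transform_within_open[OF 2 open_line_vimage[OF open_slit, of p v]])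
    show "0 \<in> {t. p + t *\<^sub>R v \<in> slit}" using p by simp
    show "g (p + t *\<^sub>R v) = fd f (p + t *\<^sub>R v) (0, snd (p + t *\<^sub>R v))" if "t \<in> {t. p + t *\<^sub>R v \<in> slit}" for t
      using eq[of "p + t *\<^sub>R v"] that by (simp only: mem_Collect_eq)
  qed
  then show ?thesis using DERIV_unique[OF 1] by simp
qed

text \<open>Degree 0 homogeneity of \<open>Fy i\<close>, differentiated once. This is what will make
  the variation of the Euler-Lagrange expression insensitive to multiples of
  \<open>y\<close>.\<close>

lemma Fy_radial_variation:
  assumes p: "p \<in> slit" and i: "i \<in> Basis"
  shows "fd2 (Fy i) p v (0, snd p) + fd (Fy i) p (0, snd v) = 0"
  using fd_vertical_chain[OF smooth_Fy[OF i] p C_inf_on_zero, of v] Fy_radial[OF _ i]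
  by (simp add: fd_def fpd_def)

definition dFy :: "'a \<times> 'a \<Rightarrow> 'a \<times> 'a \<Rightarrow> 'a" where
  "dFy p v = (\<Sum>i\<in>Basis. fd (Fy i) p v *\<^sub>R i)"

definition Fx :: "'a \<times> 'a \<Rightarrow> 'a" where
  "Fx p = (\<Sum>i\<in>Basis. fpd (dx i) F p *\<^sub>R i)"

lemma dFy_inner: "i \<in> Basis \<Longrightarrow> dFy p v \<bullet> i = fd (Fy i) p v"
  and Fx_inner: "i \<in> Basis \<Longrightarrow> Fx p \<bullet> i = fpd (dx i) F p"
  by (simp_all add: dFy_def Fx_def)

lemma linear_dFy: "linear (dFy p)"
  unfolding dFy_def
  by (rule linearI) (auto simp: fd_linear_simps algebra_simps sum.distrib scaleR_sum_right)

lemma dFy_radial: "p \<in> slit \<Longrightarrow> dFy p (0, snd p) = 0"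
  by (simp add: dFy_def Fy_radial)

lemma dFy_inner_sum: "dFy p v \<bullet> w = (\<Sum>i\<in>Basis. fd (Fy i) p v * (w \<bullet> i))"
  unfolding dFy_def inner_sum_left inner_scaleR_left by (simp only: inner_commute)

text \<open>The fundamental tensor, i.e. half the vertical Hessian of \<open>F\<^sup>2\<close>, equals
  \<open>F F\<^sub>y\<^sub>y + F\<^sub>y F\<^sub>y\<close>.\<close>

lemma strong_convexity:
  assumes p: "p \<in> slit" and w: "w \<noteq> 0"
  shows "F p * (dFy p (0, w) \<bullet> w) + (fd F p (0, w))\<^sup>2 > 0"
proof -
  have H: "fpd (dy i) (fpd (dy j) (\<lambda>p. (F p)\<^sup>2)) p = 2 * (Fy i p * Fy j p + F p * fpd (dy i) (Fy j) p)"
    if i: "i \<in> Basis" and j: "j \<in> Basis" for i j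
  proof (rule fpd_eqI)
    have sq: "fpd (dy j) (\<lambda>p. (F p)\<^sup>2) q = 2 * F q * Fy j q" if q: "q \<in> slit" for q
    proof (rule fpd_eqI)
      have "((\<lambda>t. F (q + t *\<^sub>R dy j)) has_real_derivative Fy j q) (at 0)"
        by (rule C_inf_on_partial[OF smooth_F dy_Basis[OF j] q])
      from DERIV_power[OF this, of 2]
      show "((\<lambda>t. (F (q + t *\<^sub>R dy j))\<^sup>2) has_real_derivative 2 * F q * Fy j q) (at 0)"
        by (simp add: algebra_simps)
    qed
    have "((\<lambda>t. F (p + t *\<^sub>R dy i)) has_real_derivative Fy i p) (at 0)"
      "((\<lambda>t. Fy j (p + t *\<^sub>R dy i)) has_real_derivative fpd (dy i) (Fy j) p) (at 0)"
      by (rule C_inf_on_partial[OF smooth_F dy_Basis[OF i] p] C_inf_on_partial[OF smooth_Fy[OF j] dy_Basis[OF i] p])+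
    from DERIV_mult[OF this] have "((\<lambda>t. F (p + t *\<^sub>R dy i) * Fy j (p + t *\<^sub>R dy i)) has_real_derivative
       (Fy i p * Fy j p + F p * fpd (dy i) (Fy j) p)) (at 0)" by (simp add: mult.commute)
    then have "((\<lambda>t. 2 * F (p + t *\<^sub>R dy i) * Fy j (p + t *\<^sub>R dy i)) has_real_derivative
       2 * (Fy i p * Fy j p + F p * fpd (dy i) (Fy j) p)) (at 0)"
      unfolding mult.assoc by (rule DERIV_cmult)
    then show "((\<lambda>t. fpd (dy j) (\<lambda>p. (F p)\<^sup>2) (p + t *\<^sub>R dy i)) has_real_derivative
       2 * (Fy i p * Fy j p + F p * fpd (dy i) (Fy j) p)) (at 0)"
    proof (rule has_field_derivative_transform_within_open[OF _ open_line_vimage[OF open_slit, of p "dy i"]])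
      show "0 \<in> {t. p + t *\<^sub>R dy i \<in> slit}" using p by simp
      show "2 * F (p + t *\<^sub>R dy i) * Fy j (p + t *\<^sub>R dy i) = fpd (dy j) (\<lambda>p. (F p)\<^sup>2) (p + t *\<^sub>R dy i)"
        if "t \<in> {t. p + t *\<^sub>R dy i \<in> slit}" for t
        using sq[of "p + t *\<^sub>R dy i"] that by (simp only: mem_Collect_eq)
    qed
  qed
  have v0: "fd f p (0, w) = (\<Sum>k\<in>Basis. fpd (dy k) f p * (w \<bullet> k))" for f by (simp add: fd_Pair)
  have "0 < (\<Sum>i\<in>Basis. \<Sum>j\<in>Basis. fpd (dy i) (fpd (dy j) (\<lambda>p. (F p)\<^sup>2)) p * (w \<bullet> i) * (w \<bullet> j))"
    using finsler p w unfolding finsler_on_def by (cases p) auto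
  also have "\<dots> = (\<Sum>i\<in>Basis. \<Sum>j\<in>Basis. 2 * ((Fy i p * (w \<bullet> i)) * (Fy j p * (w \<bullet> j)))
      + 2 * (F p * ((fpd (dy i) (Fy j) p * (w \<bullet> i)) * (w \<bullet> j))))"
    by (intro sum.cong refl) (simp add: H algebra_simps)
  also have "\<dots> = 2 * (fd F p (0, w) * fd F p (0, w)) + 2 * (F p * (\<Sum>i\<in>Basis. \<Sum>j\<in>Basis. ((fpd (dy i) (Fy j) p * (w \<bullet> i)) * (w \<bullet> j))))"
    unfolding v0 sum_product by (simp only: sum.distrib sum_distrib_left)
  also have "(\<Sum>i\<in>Basis. \<Sum>j\<in>Basis. ((fpd (dy i) (Fy j) p * (w \<bullet> i)) * (w \<bullet> j))) = dFy p (0, w) \<bullet> w"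
    unfolding dFy_inner_sum v0 sum_distrib_right by (rule sum.swap)
  finally show ?thesis by (simp add: power2_eq_square)
qed

text \<open>\<open>F\<^sub>y\<^sub>y\<close> alone is degenerate in the direction of \<open>y\<close>; adjoining \<open>F\<^sub>y\<close> makes the map injective.\<close>

definition hess_op :: "'a \<times> 'a \<Rightarrow> 'a \<Rightarrow> 'a \<times> real" where
  "hess_op p w = (dFy p (0, w), fd F p (0, w))"

lemma linear_hess_op: "linear (hess_op p)"
proof (rule linearI)
  show "hess_op p (v + w) = hess_op p v + hess_op p w" for v w
    using linear_add[OF linear_dFy, of p "(0, v)" "(0, w)"] linear_add[OF linear_fd, of F p "(0, v)" "(0, w)"]
    by (simp add: hess_op_def)
  show "hess_op p (c *\<^sub>R v) = c *\<^sub>R hess_op p v" for c v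
    using linear_scale[OF linear_dFy, of p c "(0, v)"] linear_scale[OF linear_fd, of F p c "(0, v)"]
    by (simp add: hess_op_def)
qed

lemma continuous_on_dFy: "continuous_on T q \<Longrightarrow> q ` T \<subseteq> slit \<Longrightarrow> continuous_on T v \<Longrightarrow> continuous_on T (\<lambda>t. dFy (q t) (v t))"
  unfolding dFy_def by (intro continuous_intros continuous_on_fd[OF smooth_Fy])

text \<open>If both components of \<open>hess_op p w\<close> vanished for some
  \<open>w \<noteq> 0\<close>, the expression in \<open>strong_convexity\<close> would be 0. So the
  norm has a positive minimum on the compact set of \<open>p\<close> in \<open>K\<close> and unit
  vectors \<open>w\<close>, and linearity in \<open>w\<close> extends the bound to all
  \<open>w\<close>.\<close>

lemma hess_op_coercive:
  assumes K: "compact K" "K \<subseteq> slit"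
  obtains m where "m > 0" "\<And>p w. p \<in> K \<Longrightarrow> m * norm w \<le> norm (hess_op p w)"
proof (cases "K = {}")
  case False
  let ?B = "K \<times> sphere (0::'a) 1"
  have c: "continuous_on ?B (\<lambda>z. norm (hess_op (fst z) (snd z)))"
    unfolding hess_op_def using K 
    by (intro continuous_intros continuous_on_dFy continuous_on_fd[OF smooth_F]) auto
  have cB: "compact ?B" using K by (intro compact_Times) auto
  have "?B \<noteq> {}" using False by simp
  from continuous_attains_inf[OF cB this c] obtain z where z: "z \<in> ?B" "\<And>z'. z' \<in> ?B \<Longrightarrow> norm (hess_op (fst z) (snd z)) \<le> norm (hess_op (fst z') (snd z'))"
    by blast
  have "fst z \<in> slit" "snd z \<noteq> 0" using z(1) K by (auto simp: dist_norm)
  then have "hess_op (fst z) (snd z) \<noteq> 0" 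
    using strong_convexity[of "fst z" "snd z"] by (auto simp: hess_op_def zero_prod_def)
  then have m: "norm (hess_op (fst z) (snd z)) > 0" by simp
  have "norm (hess_op (fst z) (snd z)) * norm w \<le> norm (hess_op p w)" if p: "p \<in> K" for p w
  proof (cases "w = 0")
    case False
    have "norm (hess_op (fst z) (snd z)) \<le> norm (hess_op p (w /\<^sub>R norm w))"
      using z(2)[of "(p, w /\<^sub>R norm w)"] p False by (simp add: dist_norm)
    also have "\<dots> = norm (hess_op p w) / norm w"
      by (simp add: linear_scale[OF linear_hess_op] divide_inverse mult.commute)
    finally show ?thesis using False by (simp add: field_simps)
  qed (simp add: linear_0[OF linear_hess_op])
  then show thesis using that m by blast
qed (use that[of 1] in auto)

end

section \<open>Lipschitz bounds on compact sets\<close>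

lemma C_inf_on_lipschitz:
  fixes f :: "'a::euclidean_space \<Rightarrow> real"
  assumes f: "C_inf_on W f" and W: "open W" and B: "compact B" "convex B" "B \<subseteq> W"
  shows "\<exists>L. L-lipschitz_on B f"
proof -
  have "continuous_on B (\<lambda>p. \<Sum>b\<in>Basis. \<bar>fpd b f p\<bar>)"
    by (intro continuous_intros continuous_on_subset[OF C_inf_on_continuous[OF C_inf_on_fpd[OF f]] B(3)])
  then have "bounded ((\<lambda>p. \<Sum>b\<in>Basis. \<bar>fpd b f p\<bar>) ` B)"
    using B(1) by (intro compact_imp_bounded compact_continuous_image)
  then obtain M where M: "\<And>p. p \<in> B \<Longrightarrow> norm (\<Sum>b\<in>Basis. \<bar>fpd b f p\<bar>) \<le> M"
    unfolding bounded_iff by (metis imageI)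
  have "\<bar>M\<bar>-lipschitz_on B f"
  proof (rule bounded_derivative_imp_lipschitz)
    fix p assume p: "p \<in> B"
    show "(f has_derivative fd f p) (at p within B)"
      using C_inf_on_has_derivative[OF f W] p B by (auto intro: has_derivative_at_withinI)
    show "onorm (fd f p) \<le> \<bar>M\<bar>"
    proof (rule onorm_le)
      fix v
      have "norm (fd f p v) \<le> (\<Sum>b\<in>Basis. \<bar>fpd b f p\<bar> * \<bar>v \<bullet> b\<bar>)"
        unfolding fd_def by (simp add: sum_abs abs_mult flip: abs_mult) 
      also have "\<dots> \<le> (\<Sum>b\<in>Basis. \<bar>fpd b f p\<bar> * norm v)"
        by (intro sum_mono mult_left_mono Basis_le_norm) auto
      also have "\<dots> \<le> \<bar>M\<bar> * norm v"
        unfolding sum_distrib_right[symmetric] using M[OF p] by (intro mult_right_mono) auto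
      finally show "norm (fd f p v) \<le> \<bar>M\<bar> * norm v" .
    qed
  qed (use B in auto)
  then show ?thesis by blast
qed

lemma lipschitz_on_scaleR_compact:
  fixes f :: "'a::metric_space \<Rightarrow> real" and g :: "'a \<Rightarrow> 'b::real_normed_vector"
  assumes B: "compact B" and f: "L-lipschitz_on B f" and g: "M-lipschitz_on B g"
  shows "\<exists>L. L-lipschitz_on B (\<lambda>x. f x *\<^sub>R g x)"
proof -
  have "bounded (f ` B)" "bounded (g ` B)"
    using B f g by (auto intro!: compact_imp_bounded compact_continuous_image lipschitz_on_continuous_on)
  then obtain a b where a: "\<And>x. x \<in> B \<Longrightarrow> norm (f x) \<le> a" and b: "\<And>x. x \<in> B \<Longrightarrow> norm (g x) \<le> b"
    unfolding bounded_iff by (metis imageI)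
  have L: "L \<ge> 0" "M \<ge> 0" using f g lipschitz_on_nonneg by auto
  have "(\<bar>a\<bar> * M + L * \<bar>b\<bar>)-lipschitz_on B (\<lambda>x. f x *\<^sub>R g x)"
  proof (rule lipschitz_onI)
    fix x y assume x: "x \<in> B" and y: "y \<in> B"
    have "f x *\<^sub>R g x - f y *\<^sub>R g y = f x *\<^sub>R (g x - g y) + (f x - f y) *\<^sub>R g y"
      by (simp add: algebra_simps)
    also have "norm \<dots> \<le> norm (f x) * norm (g x - g y) + norm (f x - f y) * norm (g y)"
      by (rule order_trans[OF norm_triangle_ineq]) simp
    also have "\<dots> \<le> \<bar>a\<bar> * (M * dist x y) + (L * dist x y) * \<bar>b\<bar>"
      using a[OF x] b[OF y] lipschitz_onD[OF f x y] lipschitz_onD[OF g x y] L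
      by (intro add_mono mult_mono) (auto simp: dist_norm)
    finally show "dist (f x *\<^sub>R g x) (f y *\<^sub>R g y) \<le> (\<bar>a\<bar> * M + L * \<bar>b\<bar>) * dist x y"
      by (simp add: dist_norm algebra_simps)
  qed (use L in auto)
  then show ?thesis by blast
qed

lemma lipschitz_on_sum_ex:
  fixes f :: "'i \<Rightarrow> 'a::metric_space \<Rightarrow> 'b::real_normed_vector"
  assumes "\<And>i. i \<in> I \<Longrightarrow> \<exists>L. L-lipschitz_on B (f i)"
  shows "\<exists>L. L-lipschitz_on B (\<lambda>x. \<Sum>i\<in>I. f i x)"
  using assms
proof (induction I rule: infinite_finite_induct)
  case (insert i I)
  then obtain L where L: "L-lipschitz_on B (f i)" by blast
  obtain M where "M-lipschitz_on B (\<lambda>x. \<Sum>i\<in>I. f i x)" using insert.IH insert.prems by blast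
  from lipschitz_on_add[OF L this] show ?case using insert.hyps by auto
qed (auto intro: exI[of _ 0] lipschitz_on_constant)

context finsler_chart
begin

text \<open>The argument \<open>z\<close> stands for the second derivative of a curve. In this
  notation the defining equation of \<open>C\<close> reads
  \<open>el_expr p (C p) = 0\<close>.\<close>

definition el_expr :: "'a \<times> 'a \<Rightarrow> 'a \<Rightarrow> 'a" where
  "el_expr p z = Fx p - dFy p (snd p, z)"

text \<open>The chain rule carries out the time derivative in the Euler-Lagrange equations;
  \<open>nz\<close> keeps the lifted curve in \<open>slit\<close>, where \<open>Fy\<close> is
  differentiable.\<close>

lemma extremal_iff:
  assumes I: "open I" and U: "\<And>t. t \<in> I \<Longrightarrow> \<gamma> t \<in> U"
    and g: "\<And>t. t \<in> I \<Longrightarrow> (\<gamma> has_vector_derivative \<gamma>' t) (at t)"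
           "\<And>t. t \<in> I \<Longrightarrow> (\<gamma>' has_vector_derivative \<gamma>'' t) (at t)" "continuous_on I \<gamma>''"
    and nz: "\<And>t. t \<in> I \<Longrightarrow> \<gamma>' t \<noteq> 0"
  shows "extremal U F I \<gamma> \<longleftrightarrow> (\<forall>t\<in>I. el_expr (\<gamma> t, \<gamma>' t) (\<gamma>'' t) = 0)"
proof -
  have vd: "vector_derivative \<gamma> (at t) = \<gamma>' t" if "t \<in> I" for t
    using g(1)[OF that] by (rule vector_derivative_at)
  have C2: "C2_curve I \<gamma>" unfolding C2_curve_def using g by blast
  have EL: "((\<lambda>t. Fy i (\<gamma> t, vector_derivative \<gamma> (at t))) has_real_derivative D) (at t)
     \<longleftrightarrow> fd (Fy i) (\<gamma> t, \<gamma>' t) (\<gamma>' t, \<gamma>'' t) = D" if t: "t \<in> I" and i: "i \<in> Basis" for t i D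
  proof -
    have "((\<lambda>t. Fy i (\<gamma> t, \<gamma>' t)) has_real_derivative fd (Fy i) (\<gamma> t, \<gamma>' t) (\<gamma>' t, \<gamma>'' t)) (at t)"
      by (rule C_inf_on_chain[OF smooth_Fy[OF i] open_slit _ has_vector_derivative_Pair[OF g(1,2)[OF t]]])
         (use U t nz in auto)
    then have d: "((\<lambda>t. Fy i (\<gamma> t, vector_derivative \<gamma> (at t))) has_real_derivative fd (Fy i) (\<gamma> t, \<gamma>' t) (\<gamma>' t, \<gamma>'' t)) (at t)"
      by (rule has_field_derivative_transform_within_open[OF _ I t]) (simp add: vd)
    then show ?thesis using DERIV_unique by blast
  qed
  have "el_expr (\<gamma> t, \<gamma>' t) (\<gamma>'' t) = 0 \<longleftrightarrow> (\<forall>i\<in>Basis. fd (Fy i) (\<gamma> t, \<gamma>' t) (\<gamma>' t, \<gamma>'' t) = fpd (dx i) F (\<gamma> t, \<gamma>' t))" for t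
    unfolding euclidean_eq_iff[where 'a='a] el_expr_def by (auto simp: inner_diff_left dFy_inner Fx_inner)
  then show ?thesis unfolding extremal_def using C2 U EL by (auto simp: vd)
qed

text \<open>The multiple of \<open>y\<close> is chosen so that solutions of \<open>\<gamma>'' = spray C (\<gamma>, \<gamma>')\<close> have
  constant speed, and it makes the spray independent of \<open>C\<close>, hence regular.\<close>

definition spray :: "('a \<times> 'a \<Rightarrow> 'a) \<Rightarrow> 'a \<times> 'a \<Rightarrow> 'a" where
  "spray C p = C p - (fd F p (snd p, C p) / F p) *\<^sub>R snd p"

text \<open>Right-hand side of the linear system \<open>hess_op p z = spray_rhs p\<close>. Its first
  component says \<open>el_expr p z = 0\<close>, its second that the derivative of \<open>F\<close>
  along \<open>(snd p, z)\<close> vanishes; \<open>C\<close> does not enter.\<close>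

definition spray_rhs :: "'a \<times> 'a \<Rightarrow> 'a \<times> real" where
  "spray_rhs p = (Fx p - dFy p (snd p, 0), - fd F p (snd p, 0))"

lemma dFy_split: "dFy p (v, w) = dFy p (v, 0) + dFy p (0, w)"
  using linear_add[OF linear_dFy, of p "(v, 0)" "(0, w)"] by simp

lemma fd_split: "fd f p (v, w) = fd f p (v, 0) + fd f p (0, w :: 'a)"
  using linear_add[OF linear_fd, of f p "(v, 0)" "(0, w)"] by simp

text \<open>As \<open>hess_op p (snd p) = (0, F p)\<close>, subtracting a multiple of
  \<open>y\<close> from \<open>C p\<close> leaves the first component alone and adjusts the second
  at will; the coefficient in \<open>spray\<close> is the one that gives the required value.\<close>

lemma hess_op_spray:
  assumes p: "p \<in> slit" and C: "el_expr p (C p) = 0"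
  shows "hess_op p (spray C p) = spray_rhs p"
proof -
  define l where "l = fd F p (snd p, C p) / F p"
  have F: "F p > 0" using F_pos p by blast
  have "hess_op p (spray C p) = hess_op p (C p) - l *\<^sub>R hess_op p (snd p)"
    unfolding spray_def l_def[symmetric] by (simp add: linear_diff[OF linear_hess_op] linear_scale[OF linear_hess_op])
  also have "hess_op p (snd p) = (0, F p)" using dFy_radial euler p by (simp add: hess_op_def)
  also have "hess_op p (C p) - l *\<^sub>R (0, F p) = spray_rhs p"
    using C F dFy_split[of p "snd p" "C p"] fd_split[of F p "snd p" "C p"] 
    by (simp add: hess_op_def spray_rhs_def el_expr_def l_def)
  finally show ?thesis .
qed

lemma el_expr_spray: "p \<in> slit \<Longrightarrow> el_expr p (C p) = 0 \<Longrightarrow> el_expr p (spray C p) = 0"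
  and fd_F_spray: "p \<in> slit \<Longrightarrow> el_expr p (C p) = 0 \<Longrightarrow> fd F p (snd p, spray C p) = 0"
  using hess_op_spray[of p C] dFy_split[of p "snd p" "spray C p"] fd_split[of F p "snd p" "spray C p"]
  by (auto simp: hess_op_def spray_rhs_def el_expr_def)

text \<open>No regularity can be inherited from \<open>C\<close>. It comes from the linear system
  that determines the spray: its coefficients and right-hand side are Lipschitz on \<open>B\<close>,
  and \<open>hess_op\<close> is bounded below there uniformly.\<close>

lemma spray_lipschitz:
  assumes B: "compact B" "convex B" "B \<subseteq> slit" and C: "\<And>p. p \<in> slit \<Longrightarrow> el_expr p (C p) = 0"
  shows "\<exists>L. L-lipschitz_on B (spray C)"
proof -
  \<comment> \<open>Closure rules for Lipschitz continuity on \<open>B\<close>, from which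
    \<open>spray_rhs\<close> and the coefficients of \<open>hess_op\<close> are assembled.\<close>
  have lf: "\<exists>L. L-lipschitz_on B f" if "C_inf_on slit f" for f
    using C_inf_on_lipschitz[OF that open_slit B] .
  have lc: "\<exists>L. L-lipschitz_on B (\<lambda>p. c)" for c :: "'c::real_normed_vector"
    using lipschitz_on_constant by blast
  have ly: "\<exists>L. L-lipschitz_on B (\<lambda>p. snd p \<bullet> k)" for k
  proof -
    have "bounded_linear (\<lambda>p::'a \<times> 'a. snd p \<bullet> k)"
      by (intro bounded_linear_intros)
    then show ?thesis using bounded_linear.lipschitz_boundE by (metis lipschitz_on_subset subset_UNIV)
  qed
  have ls: "\<exists>L. L-lipschitz_on B (\<lambda>x. f x *\<^sub>R g x)" 
    if "\<exists>L. L-lipschitz_on B f" "\<exists>L. L-lipschitz_on B g" for f and g :: "_ \<Rightarrow> 'c::real_normed_vector"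
    using lipschitz_on_scaleR_compact[OF B(1)] that by metis
  have lm: "\<exists>L. L-lipschitz_on B (\<lambda>x. f x * g x)" 
    if "\<exists>L. L-lipschitz_on B f" "\<exists>L. L-lipschitz_on B g" for f g :: "_ \<Rightarrow> real"
    using ls[OF that] by simp
  have lp: "\<exists>L. L-lipschitz_on B (\<lambda>x. (f x, g x))" 
    if "\<exists>L. L-lipschitz_on B f" "\<exists>L. L-lipschitz_on B g" for f :: "_ \<Rightarrow> 'c::real_normed_vector" and g :: "_ \<Rightarrow> 'd::real_normed_vector"
    using lipschitz_on_Pair that by metis
  have ld: "\<exists>L. L-lipschitz_on B (\<lambda>x. f x - g x)" 
    if "\<exists>L. L-lipschitz_on B f" "\<exists>L. L-lipschitz_on B g" for f g :: "_ \<Rightarrow> 'c::real_normed_vector"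
    using lipschitz_on_diff that by metis
  have lfd: "\<exists>L. L-lipschitz_on B (\<lambda>p. fd f p (0, w))" "\<exists>L. L-lipschitz_on B (\<lambda>p. fd f p (snd p, 0))"
    if "C_inf_on slit f" for f w
  proof -
    have 1: "fd f p (0, w) = (\<Sum>k\<in>Basis. fpd (dy k) f p * (w \<bullet> k))"
      and 2: "fd f p (snd p, 0) = (\<Sum>k\<in>Basis. fpd (dx k) f p * (snd p \<bullet> k))" for p
      by (simp_all add: fd_Pair)
    show "\<exists>L. L-lipschitz_on B (\<lambda>p. fd f p (0, w))"
      unfolding 1 by (rule lipschitz_on_sum_ex, rule lm[OF lf lc]) (rule C_inf_on_fpd[OF that dy_Basis])
    show "\<exists>L. L-lipschitz_on B (\<lambda>p. fd f p (snd p, 0))"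
      unfolding 2 by (rule lipschitz_on_sum_ex, rule lm[OF lf ly]) (rule C_inf_on_fpd[OF that dx_Basis])
  qed
  have lrhs: "\<exists>L. L-lipschitz_on B spray_rhs"
  proof -
    have "spray_rhs = (\<lambda>p. (Fx p - dFy p (snd p, 0), 0 - fd F p (snd p, 0)))"
      by (simp add: spray_rhs_def[abs_def])
    then show ?thesis
      unfolding Fx_def dFy_def
      by (simp only:) (intro lp ld lipschitz_on_sum_ex ls lf lc lfd smooth_F smooth_Fx smooth_Fy)
  qed
  have "\<exists>L. L-lipschitz_on B (\<lambda>p. hess_op p j)" for j
    unfolding hess_op_def dFy_def by (intro lp lipschitz_on_sum_ex ls lc lfd smooth_F smooth_Fy)
  then obtain LA where LA: "\<And>j. (LA j)-lipschitz_on B (\<lambda>p. hess_op p j)" by metis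
  define M where "M = (\<Sum>j\<in>Basis. LA j)"
  have hess_op_rep: "hess_op p w = (\<Sum>j\<in>Basis. (w \<bullet> j) *\<^sub>R hess_op p j)" for p w
  proof -
    have "hess_op p w = hess_op p (\<Sum>j\<in>Basis. (w \<bullet> j) *\<^sub>R j)" by (simp add: euclidean_representation)
    then show ?thesis by (simp only: linear_sum[OF linear_hess_op] linear_scale[OF linear_hess_op])
  qed
  have M0: "M \<ge> 0" unfolding M_def using LA lipschitz_on_nonneg by (intro sum_nonneg) blast
  have Adiff: "norm (hess_op q w - hess_op p w) \<le> M * norm w * dist p q" if "p \<in> B" "q \<in> B" for p q w
  proof -
    have "hess_op q w - hess_op p w = (\<Sum>j\<in>Basis. (w \<bullet> j) *\<^sub>R (hess_op q j - hess_op p j))"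
      unfolding hess_op_rep[of _ w] by (simp add: sum_subtractf scaleR_diff_right)
    also have "norm \<dots> \<le> (\<Sum>j\<in>Basis. norm w * (LA j * dist p q))"
    proof (rule sum_norm_le)
      fix j :: 'a assume "j \<in> Basis"
      then show "norm ((w \<bullet> j) *\<^sub>R (hess_op q j - hess_op p j)) \<le> norm w * (LA j * dist p q)"
        using lipschitz_onD[OF LA that(2,1), of j] Basis_le_norm[of j w] 
        by (simp add: dist_norm norm_minus_commute mult_mono)
    qed
    also have "\<dots> = M * norm w * dist p q"
      unfolding M_def sum_distrib_right by (intro sum.cong) (auto simp: algebra_simps)
    finally show ?thesis .
  qed
  obtain m where m: "m > 0" "\<And>p w. p \<in> B \<Longrightarrow> m * norm w \<le> norm (hess_op p w)"
    using hess_op_coercive[OF B(1,3)] by metis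
  obtain Lr where Lr: "Lr-lipschitz_on B spray_rhs" using lrhs by blast
  have Lr0: "Lr \<ge> 0" using Lr by (rule lipschitz_on_nonneg)
  have "bounded (spray_rhs ` B)"
    using B(1) Lr by (intro compact_imp_bounded compact_continuous_image lipschitz_on_continuous_on)
  then obtain b where b: "\<And>p. p \<in> B \<Longrightarrow> norm (spray_rhs p) \<le> b" unfolding bounded_iff by (metis imageI)
  have AG: "hess_op p (spray C p) = spray_rhs p" if "p \<in> B" for p
    using hess_op_spray C B(3) that by blast
  have Gb: "norm (spray C p) \<le> \<bar>b\<bar> / m" if "p \<in> B" for p
    using m(2)[OF that, of "spray C p"] b[OF that] m(1) unfolding AG[OF that] by (simp add: field_simps)
  \<comment> \<open>Subtracting the systems at \<open>p\<close> and \<open>q\<close> leaves the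
    variation of the right-hand side, with constant \<open>Lr\<close>, and that of the coefficients
    applied to a spray value of norm at most \<open>\<bar>b\<bar> / m\<close>, with constant
    \<open>M\<close>. Coercivity divides the total by \<open>m\<close>.\<close>
  define K where "K = (Lr + M * (\<bar>b\<bar> / m)) / m"
  have "K-lipschitz_on B (spray C)"
  proof (rule lipschitz_onI)
    show "K \<ge> 0" unfolding K_def using Lr0 M0 m(1) by simp
    fix p q assume p: "p \<in> B" and q: "q \<in> B"
    have "hess_op p (spray C p - spray C q) = spray_rhs p - spray_rhs q + (hess_op q (spray C q) - hess_op p (spray C q))"
      by (simp add: linear_diff[OF linear_hess_op] AG p q)
    then have "m * norm (spray C p - spray C q) \<le> norm (spray_rhs p - spray_rhs q + (hess_op q (spray C q) - hess_op p (spray C q)))"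
      using m(2)[OF p, of "spray C p - spray C q"] by simp
    also have "\<dots> \<le> norm (spray_rhs p - spray_rhs q) + norm (hess_op q (spray C q) - hess_op p (spray C q))"
      by (rule norm_triangle_ineq)
    also have "\<dots> \<le> Lr * dist p q + M * norm (spray C q) * dist p q"
      using lipschitz_onD[OF Lr p q] Adiff[OF p q] by (intro add_mono) (auto simp: dist_norm)
    also have "\<dots> \<le> Lr * dist p q + M * (\<bar>b\<bar> / m) * dist p q"
      using Gb[OF q] M0 by (intro add_left_mono mult_right_mono mult_left_mono) auto
    finally show "dist (spray C p) (spray C q) \<le> K * dist p q"
      using m(1) by (simp add: K_def dist_norm field_simps)
  qed
  then show ?thesis by blast
qed

text \<open>The second-order equation is solved as a first-order system on \<open>slit\<close>.
  Constancy of the speed comes from \<open>fd_F_spray\<close>; this is why the acceleration is taken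
  to be the spray and not \<open>C\<close>.\<close>

lemma geodesic_exists:
  assumes p: "x \<in> U" "y \<noteq> 0" and C: "\<And>p. p \<in> slit \<Longrightarrow> el_expr p (C p) = 0"
  obtains \<delta> \<gamma> \<gamma>' \<gamma>'' where "\<delta> > 0" "geodesic U F {-\<delta><..<\<delta>} \<gamma>"
    "\<And>t. t \<in> {-\<delta><..<\<delta>} \<Longrightarrow> \<gamma> t \<in> U" "\<And>t. t \<in> {-\<delta><..<\<delta>} \<Longrightarrow> \<gamma>' t \<noteq> 0"
    "\<And>t. t \<in> {-\<delta><..<\<delta>} \<Longrightarrow> (\<gamma> has_vector_derivative \<gamma>' t) (at t)"
    "\<And>t. t \<in> {-\<delta><..<\<delta>} \<Longrightarrow> (\<gamma>' has_vector_derivative \<gamma>'' t) (at t)" 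
    "continuous_on {-\<delta><..<\<delta>} \<gamma>''"
    "\<gamma> 0 = x" "\<gamma>' 0 = y" "\<gamma>'' 0 = spray C (x, y)"
proof -
  have "(x, y) \<in> slit" using p by simp
  then obtain r where r: "r > 0" "cball (x, y) r \<subseteq> slit" using open_contains_cball[THEN iffD1, OF open_slit] by blast
  obtain L where L: "L-lipschitz_on (cball (x, y) r) (spray C)"
    using spray_lipschitz[OF compact_cball convex_cball r(2) C] by blast
  have "1-lipschitz_on (cball (x, y) r) (snd :: 'a \<times> 'a \<Rightarrow> 'a)"
    by (rule lipschitz_onI) (auto simp: dist_snd_le)
  from lipschitz_on_Pair[OF this L] 
  have lip: "(sqrt (1\<^sup>2 + L\<^sup>2))-lipschitz_on (cball (x, y) r) (\<lambda>p. (snd p, spray C p))" .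
  obtain \<delta> u where u: "\<delta> > 0" "u 0 = (x, y)" "\<And>t. \<bar>t\<bar> < \<delta> \<Longrightarrow> u t \<in> cball (x, y) r"
    "\<And>t. \<bar>t\<bar> < \<delta> \<Longrightarrow> (u has_vector_derivative (snd (u t), spray C (u t))) (at t)"
    by (rule autonomous_ode_exists[OF lip r(1)]) (rule that)
  define I where "I = {-\<delta><..<\<delta>}"
  have I: "\<bar>t\<bar> < \<delta>" if "t \<in> I" for t using that by (auto simp: I_def)
  define \<gamma> where "\<gamma> t = fst (u t)" for t
  define \<gamma>' where "\<gamma>' t = snd (u t)" for t
  define \<gamma>'' where "\<gamma>'' t = spray C (u t)" for t
  have uS: "u t \<in> slit" if "t \<in> I" for t using u(3)[OF I[OF that]] r(2) by blast
  have U: "\<gamma> t \<in> U" and nz: "\<gamma>' t \<noteq> 0" if "t \<in> I" for t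
    using uS[OF that] by (auto simp: \<gamma>_def \<gamma>'_def mem_Times_iff)
  have d1: "(\<gamma> has_vector_derivative \<gamma>' t) (at t)" and d2: "(\<gamma>' has_vector_derivative \<gamma>'' t) (at t)" if "t \<in> I" for t
    using bounded_linear.has_vector_derivative[OF bounded_linear_fst u(4)[OF I[OF that]]]
      bounded_linear.has_vector_derivative[OF bounded_linear_snd u(4)[OF I[OF that]]]
    by (simp_all add: \<gamma>_def[abs_def] \<gamma>'_def[abs_def] \<gamma>''_def)
  have "continuous_on I u"
    by (intro continuous_at_imp_continuous_on ballI has_vector_derivative_continuous[OF u(4)[OF I]])
  then have cont: "continuous_on I \<gamma>''"
    unfolding \<gamma>''_def
    by (rule continuous_on_compose2[OF lipschitz_on_continuous_on[OF L]]) (use u(3) I in auto)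
  have openI: "open I" and convI: "convex I" and I0: "0 \<in> I" by (auto simp: I_def u(1))
  have pu: "(\<gamma> t, \<gamma>' t) = u t" for t by (simp add: \<gamma>_def \<gamma>'_def)
  have "extremal U F I \<gamma>"
    by (subst extremal_iff[OF openI U d1 d2 cont nz])
       (auto simp: pu \<gamma>''_def intro!: el_expr_spray uS C)
  moreover have "\<exists>c>0. \<forall>t\<in>I. F (\<gamma> t, vector_derivative \<gamma> (at t)) = c"
  proof -
    have "((\<lambda>t. F (u t)) has_real_derivative 0) (at t within I)" if t: "t \<in> I" for t
    proof -
      have "((\<lambda>t. F (u t)) has_real_derivative fd F (u t) (snd (u t), spray C (u t))) (at t)"
        by (rule C_inf_on_chain[OF smooth_F open_slit uS[OF t] u(4)[OF I[OF t]]])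
      then show ?thesis using fd_F_spray[where C = C, OF uS[OF t] C[OF uS[OF t]]] 
        by (simp add: has_field_derivative_at_within)
    qed
    then obtain c where c: "\<And>t. t \<in> I \<Longrightarrow> F (u t) = c"
      using has_field_derivative_zero_constant[OF convI] by blast
    have "c > 0" using c[OF I0] F_pos[OF uS[OF I0]] by simp
    moreover have "vector_derivative \<gamma> (at t) = \<gamma>' t" if "t \<in> I" for t
      using d1[OF that] by (rule vector_derivative_at)
    ultimately show ?thesis using c by (intro exI[of _ c]) (simp add: pu)
  qed
  ultimately have "geodesic U F I \<gamma>" unfolding geodesic_def by blast
  then show thesis
    using that[of \<delta> \<gamma> \<gamma>' \<gamma>''] u(1,2) U nz d1 d2 cont unfolding I_def 
    by (simp add: \<gamma>_def \<gamma>'_def \<gamma>''_def)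
qed

end

subsection \<open>Variation of the Euler-Lagrange expression under the flow\<close>

lemma fd2_linear: "linear (fd2 f p v)"
  unfolding fd2_def
  by (rule linearI) (auto simp: inner_left_distrib algebra_simps sum.distrib sum_distrib_left)

locale finsler_field = finsler_chart U F + smooth_vector_field U X
  for U :: "'a::euclidean_space set" and F :: "'a \<times> 'a \<Rightarrow> real" and X :: "'a \<Rightarrow> 'a"
begin

text \<open>Derivative of the \<open>i\<close>-th component of \<open>el_expr p z\<close> when
  \<open>p\<close> moves along \<open>X1\<close> and the pair \<open>(snd p, z)\<close> along
  \<open>DX1 p\<close>, that is, under the action of \<open>X\<close> on 2-jets.\<close>

definition el_variation :: "'a \<Rightarrow> 'a \<times> 'a \<Rightarrow> 'a \<Rightarrow> real" where
  "el_variation i p z = fd (fpd (dx i) F) p (X1 p) - (fd2 (Fy i) p (X1 p) (snd p, z) + fd (Fy i) p (DX1 p (snd p, z)))"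

lemma DX_inner: "s \<in> Basis \<Longrightarrow> DX x v \<bullet> s = (\<Sum>r\<in>Basis. fpd r (\<lambda>u. X u \<bullet> s) x * (v \<bullet> r))"
  by (simp add: DX_def fd_def)

lemma D2X_inner: "s \<in> Basis \<Longrightarrow> D2X x v w \<bullet> s = (\<Sum>r\<in>Basis. (\<Sum>m\<in>Basis. fpd m (fpd r (\<lambda>u. X u \<bullet> s)) x * (v \<bullet> m)) * (w \<bullet> r))"
  by (simp add: D2X_def fd_def)

text \<open>An expansion in coordinates. Its one analytic input is the symmetry of mixed
  derivatives, which turns the \<open>y\<close>-derivative of \<open>F\<^sub>x\<close> in the flow
  equation into the \<open>x\<close>-derivative of \<open>Fy i\<close>.\<close>

lemma flow_eq_lhs_eq_el_variation:
  assumes p: "x \<in> U" "y \<noteq> 0" and i: "i \<in> Basis"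
  shows "flow_eq_lhs F X C i x y = el_variation i (x, y) (C (x, y))"
proof -
  define z where "z = C (x, y)"
  \<comment> \<open>Contracting the first derivatives of \<open>X\<close> with \<open>y\<close> and
    with \<open>C\<close> replaces the sums over \<open>r\<close> by components of \<open>v\<close>
    and \<open>w\<close>; \<open>E s\<close> below is the third-order coefficient common to all
    \<open>r\<close>.\<close>
  define v w where "v = DX x y" and "w = DX x z"
  define E where "E s = (\<Sum>k\<in>Basis. fpd (dy s) (fpd (dx k) (Fy i)) (x, y) * (y \<bullet> k)
                      + fpd (dy s) (fpd (dy k) (Fy i)) (x, y) * (z \<bullet> k))" for s
  have p': "(x, y) \<in> slit" using p by simp
  have sym: "fpd (dx s) (Fy i) (x, y) = fpd (dy i) (fpd (dx s) F) (x, y)" if "s \<in> Basis" for s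
    using fpd_commute[OF smooth_F open_slit p' dx_Basis[OF that] dy_Basis[OF i]] .
  have 1: "(\<Sum>r\<in>Basis. ((fpd (dy s) (fpd (dx i) F) (x, y) - fpd (dy i) (fpd (dx s) F) (x, y)) * (y \<bullet> r)
         - fpd (dy s) (Fy i) (x, y) * (z \<bullet> r) - E s * (y \<bullet> r)) * fpd r (\<lambda>u. X u \<bullet> s) x)
      = (fpd (dy s) (fpd (dx i) F) (x, y) - fpd (dx s) (Fy i) (x, y) - E s) * (v \<bullet> s) - fpd (dy s) (Fy i) (x, y) * (w \<bullet> s)"
    if s: "s \<in> Basis" for s
    unfolding v_def w_def DX_inner[OF s] sum_distrib_left sum_subtractf[symmetric] sym[OF s]
    by (intro sum.cong refl) (simp add: algebra_simps)
  have 2: "(\<Sum>m\<in>Basis. \<Sum>r\<in>Basis. fpd (dy s) (Fy i) (x, y) * (y \<bullet> m) * (y \<bullet> r)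
        * fpd m (fpd r (\<lambda>u. X u \<bullet> s)) x) = fpd (dy s) (Fy i) (x, y) * (D2X x y y \<bullet> s)" if s: "s \<in> Basis" for s
    unfolding D2X_inner[OF s] sum_distrib_left sum_distrib_right
    by (subst sum.swap) (intro sum.cong refl, simp add: algebra_simps)
  have inner_dx: "(a, b) \<bullet> dx k = a \<bullet> k" and inner_dy: "(a, b) \<bullet> dy k = b \<bullet> k" for a b k :: 'a
    by (simp_all add: dx_def dy_def)
  have swap: "(\<Sum>k\<in>Basis. (\<Sum>s\<in>Basis. a s k) * (u \<bullet> k)) = (\<Sum>s\<in>Basis. \<Sum>k\<in>Basis. a s k * (u \<bullet> k))" 
    for a :: "'a \<Rightarrow> 'a \<Rightarrow> real" and u
    unfolding sum_distrib_right by (rule sum.swap)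
  have "el_variation i (x, y) z = 
     ((\<Sum>s\<in>Basis. fpd (dx s) (fpd (dx i) F) (x, y) * (X x \<bullet> s)) + (\<Sum>s\<in>Basis. fpd (dy s) (fpd (dx i) F) (x, y) * (v \<bullet> s)))
   - ((\<Sum>k\<in>Basis. ((\<Sum>s\<in>Basis. fpd (dx s) (fpd (dx k) (Fy i)) (x, y) * (X x \<bullet> s))
                 + (\<Sum>s\<in>Basis. fpd (dy s) (fpd (dx k) (Fy i)) (x, y) * (v \<bullet> s))) * (y \<bullet> k))
     + (\<Sum>k\<in>Basis. ((\<Sum>s\<in>Basis. fpd (dx s) (fpd (dy k) (Fy i)) (x, y) * (X x \<bullet> s))
                 + (\<Sum>s\<in>Basis. fpd (dy s) (fpd (dy k) (Fy i)) (x, y) * (v \<bullet> s))) * (z \<bullet> k))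
     + ((\<Sum>s\<in>Basis. fpd (dx s) (Fy i) (x, y) * (v \<bullet> s))
       + (\<Sum>s\<in>Basis. fpd (dy s) (Fy i) (x, y) * ((D2X x y y + w) \<bullet> s))))"
    unfolding el_variation_def fd2_def sum_Basis_Times
    unfolding dx_def[symmetric] dy_def[symmetric] inner_dx inner_dy
    by (simp add: X1_def DX1_def fd_Pair v_def w_def)
  also have "\<dots> = (\<Sum>s\<in>Basis. (fpd (dx s) (fpd (dx i) F) (x, y)
         - (\<Sum>k\<in>Basis. fpd (dx s) (fpd (dx k) (Fy i)) (x, y) * (y \<bullet> k))
         - (\<Sum>k\<in>Basis. fpd (dx s) (fpd (dy k) (Fy i)) (x, y) * (z \<bullet> k))) * (X x \<bullet> s))
     + (\<Sum>s\<in>Basis. (fpd (dy s) (fpd (dx i) F) (x, y) - fpd (dx s) (Fy i) (x, y) - E s) * (v \<bullet> s) - fpd (dy s) (Fy i) (x, y) * (w \<bullet> s))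
     - (\<Sum>s\<in>Basis. fpd (dy s) (Fy i) (x, y) * (D2X x y y \<bullet> s))"
    unfolding sum.distrib[symmetric] sum_subtractf[symmetric] swap
    unfolding sum.distrib[symmetric] sum_subtractf[symmetric] E_def
    by (intro sum.cong refl)
       (simp add: algebra_simps inner_add_left sum.distrib sum_distrib_left sum_distrib_right)
  also have "\<dots> = flow_eq_lhs F X C i x y"
    unfolding flow_eq_lhs_def z_def[symmetric] E_def[symmetric] using 1 2 by simp
  finally show ?thesis by (simp add: z_def)
qed

lemma el_expr_inner_derivative:
  assumes i: "i \<in> Basis" and q: "q s \<in> slit" "(q has_vector_derivative X1 (q s)) (at s)"
    and w: "((\<lambda>s. (snd (q s), c s)) has_vector_derivative DX1 (q s) (snd (q s), c s)) (at s)"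
  shows "((\<lambda>s. el_expr (q s) (c s) \<bullet> i) has_real_derivative el_variation i (q s) (c s)) (at s)"
proof -
  have "el_expr p z \<bullet> i = fpd (dx i) F p - fd (Fy i) p (snd p, z)" for p z
    using i by (simp add: el_expr_def inner_diff_left dFy_inner Fx_inner)
  then show ?thesis unfolding el_variation_def
    by (simp only:) (intro DERIV_diff C_inf_on_chain[OF smooth_Fx[OF i] open_slit q] fd_chain[OF smooth_Fy[OF i] open_slit q w])
qed

text \<open>Up to sign, the linear part of the affine dependence of
  \<open>el_variation i p z\<close> on \<open>z\<close>.\<close>

definition vertical_var :: "'a \<Rightarrow> 'a \<times> 'a \<Rightarrow> 'a \<Rightarrow> real" where
  "vertical_var i p w = fd2 (Fy i) p (X1 p) (0, w) + fd (Fy i) p (0, DX (fst p) w)"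

lemma linear_vertical_var: "linear (vertical_var i p)"
proof (rule linearI)
  show "vertical_var i p (v + w) = vertical_var i p v + vertical_var i p w" for v w
    using linear_add[OF fd2_linear, of "Fy i" p "X1 p" "(0, v)" "(0, w)"]
      linear_add[OF linear_fd, of "Fy i" p "(0, DX (fst p) v)" "(0, DX (fst p) w)"]
    by (simp add: vertical_var_def linear_add[OF linear_DX])
  show "vertical_var i p (r *\<^sub>R v) = r *\<^sub>R vertical_var i p v" for r v
    using linear_scale[OF fd2_linear, of "Fy i" p "X1 p" r "(0, v)"]
      linear_scale[OF linear_fd, of "Fy i" p r "(0, DX (fst p) v)"]
    by (simp add: vertical_var_def linear_scale[OF linear_DX] distrib_left)
qed

text \<open>\<open>Fy_radial_variation\<close> in direction \<open>X1 p\<close>, whose vertical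
  component \<open>DX (fst p) (snd p)\<close> is exactly the vector in the second term of
  \<open>vertical_var\<close>.\<close>

lemma vertical_var_radial: "p \<in> slit \<Longrightarrow> i \<in> Basis \<Longrightarrow> vertical_var i p (snd p) = 0"
  using Fy_radial_variation[of p i "X1 p"] by (simp add: vertical_var_def X1_def)

lemma el_variation_diff: "el_variation i p z1 - el_variation i p z2 = - vertical_var i p (z1 - z2)"
proof -
  have 1: "fd2 (Fy i) p (X1 p) (snd p, z1) - fd2 (Fy i) p (X1 p) (snd p, z2) = fd2 (Fy i) p (X1 p) (0, z1 - z2)"
    using linear_diff[OF fd2_linear, of "Fy i" p "X1 p" "(snd p, z1)" "(snd p, z2)"] by simp
  have "DX1 p (snd p, z1) - DX1 p (snd p, z2) = (0, DX (fst p) (z1 - z2))"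
    by (simp add: DX1_def linear_diff[OF linear_DX])
  then have 2: "fd (Fy i) p (DX1 p (snd p, z1)) - fd (Fy i) p (DX1 p (snd p, z2)) = fd (Fy i) p (0, DX (fst p) (z1 - z2))"
    using linear_diff[OF linear_fd, of "Fy i" p "DX1 p (snd p, z1)" "DX1 p (snd p, z2)"] by simp
  show ?thesis using 1 2 unfolding el_variation_def vertical_var_def by linarith
qed

text \<open>The two accelerations differ by a multiple of \<open>y\<close>. This links the flow
  equation, written with an arbitrary \<open>C\<close>, to geodesics, whose acceleration is the
  spray.\<close>

lemma el_variation_spray:
  assumes "p \<in> slit" "i \<in> Basis"
  shows "el_variation i p (spray C p) = el_variation i p (C p)"
  using el_variation_diff[of i p "spray C p" "C p"] vertical_var_radial[OF assms]
  by (simp add: spray_def linear_neg[OF linear_vertical_var] linear_scale[OF linear_vertical_var])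

text \<open>Over a bounded range of \<open>s\<close> the trajectory \<open>q\<close> stays in a
  compact part of \<open>slit\<close>, which makes the coercivity constant \<open>m\<close> and the
  bound \<open>N\<close> of \<open>vertical_var\<close> uniform. They combine to the Gronwall
  constant \<open>N / m\<close>.\<close>

lemma el_expr_vanishes_along_flow:
  assumes q: "\<And>s. q s \<in> slit" "\<And>s. (q has_vector_derivative X1 (q s)) (at s)"
    and w: "\<And>s. ((\<lambda>s. (snd (q s), c s)) has_vector_derivative DX1 (q s) (snd (q s), c s)) (at s)"
    and C: "\<And>p. p \<in> slit \<Longrightarrow> el_expr p (C p) = 0"
    and eq: "\<And>p i. p \<in> slit \<Longrightarrow> i \<in> Basis \<Longrightarrow> el_variation i p (C p) = 0"
    and init: "el_expr (q 0) (c 0) = 0"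
  shows "el_expr (q s) (c s) = 0"
proof -
  define T where "T = \<bar>s\<bar>"
  have qc: "continuous_on {-T..T} q"
    by (intro continuous_at_imp_continuous_on ballI has_vector_derivative_continuous[OF q(2)])
  have qS: "q ` {-T..T} \<subseteq> slit" using q(1) by blast
  have fst_q: "fst (q \<sigma>) \<in> U" for \<sigma> using q(1)[of \<sigma>] by (simp add: mem_Times_iff)
  have "compact (q ` {-T..T})" using qc by (intro compact_continuous_image) auto
  from hess_op_coercive[OF this qS] obtain m where m: "m > 0" "\<And>p w. p \<in> q ` {-T..T} \<Longrightarrow> m * norm w \<le> norm (hess_op p w)" by metis
  have mq: "m * norm w \<le> norm (hess_op (q \<sigma>) w)" if "\<bar>\<sigma>\<bar> \<le> T" for \<sigma> w
    using m(2)[of "q \<sigma>" w] that by (auto simp: abs_le_iff)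
  have X1c: "continuous_on {-T..T} (\<lambda>\<sigma>. X1 (q \<sigma>))"
  proof (rule continuous_on_compose2[OF _ qc])
    show "continuous_on (U \<times> UNIV) X1"
      by (intro continuous_at_imp_continuous_on ballI has_derivative_continuous[OF X1_has_derivative])
    show "q ` {-T..T} \<subseteq> U \<times> UNIV" by (intro image_subsetI) (simp add: mem_Times_iff fst_q)
  qed
  have "continuous_on {-T..T} (\<lambda>\<sigma>. \<Sum>i\<in>Basis. \<Sum>j\<in>Basis. \<bar>vertical_var i (q \<sigma>) j\<bar>)"
    unfolding vertical_var_def
    by (intro continuous_intros continuous_on_fd2[OF smooth_Fy] continuous_on_fd[OF smooth_Fy] continuous_on_DX qc X1c)
       (assumption | rule qS | (rule image_subsetI, rule fst_q))+
  then have "bounded ((\<lambda>\<sigma>. \<Sum>i\<in>Basis. \<Sum>j\<in>Basis. \<bar>vertical_var i (q \<sigma>) j\<bar>) ` {-T..T})"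
    by (intro compact_imp_bounded compact_continuous_image) auto
  then obtain N where N: "\<And>\<sigma>. \<sigma> \<in> {-T..T} \<Longrightarrow> norm (\<Sum>i\<in>Basis. \<Sum>j\<in>Basis. \<bar>vertical_var i (q \<sigma>) j\<bar>) \<le> N"
    unfolding bounded_iff by (metis imageI)
  have Nb: "(\<Sum>i\<in>Basis. \<bar>vertical_var i (q \<sigma>) w\<bar>) \<le> N * norm w" if \<sigma>: "\<bar>\<sigma>\<bar> \<le> T" for \<sigma> w
  proof -
    have "\<bar>vertical_var i (q \<sigma>) w\<bar> \<le> (\<Sum>j\<in>Basis. \<bar>vertical_var i (q \<sigma>) j\<bar>) * norm w" for i
    proof -
      have "vertical_var i (q \<sigma>) w = vertical_var i (q \<sigma>) (\<Sum>j\<in>Basis. (w \<bullet> j) *\<^sub>R j)"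
        by (simp add: euclidean_representation)
      also have "\<dots> = (\<Sum>j\<in>Basis. (w \<bullet> j) * vertical_var i (q \<sigma>) j)"
        by (simp only: linear_sum[OF linear_vertical_var] linear_scale[OF linear_vertical_var] real_scaleR_def)
      also have "\<bar>\<dots>\<bar> \<le> (\<Sum>j\<in>Basis. \<bar>(w \<bullet> j) * vertical_var i (q \<sigma>) j\<bar>)" by (rule sum_abs)
      also have "\<dots> \<le> (\<Sum>j\<in>Basis. \<bar>vertical_var i (q \<sigma>) j\<bar> * norm w)"
      proof (rule sum_mono)
        fix j :: 'a assume "j \<in> Basis"
        then show "\<bar>(w \<bullet> j) * vertical_var i (q \<sigma>) j\<bar> \<le> \<bar>vertical_var i (q \<sigma>) j\<bar> * norm w"
          using mult_left_mono[OF Basis_le_norm[of j w], of "\<bar>vertical_var i (q \<sigma>) j\<bar>"]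
          by (simp add: abs_mult mult.commute)
      qed
      finally show ?thesis by (simp add: sum_distrib_right)
    qed
    then have "(\<Sum>i\<in>Basis. \<bar>vertical_var i (q \<sigma>) w\<bar>) \<le> (\<Sum>i\<in>Basis. \<Sum>j\<in>Basis. \<bar>vertical_var i (q \<sigma>) j\<bar>) * norm w"
      unfolding sum_distrib_right[of _ _ "norm w"] by (intro sum_mono) (simp add: sum_distrib_right)
    also have "\<dots> \<le> N * norm w"
      using N[of \<sigma>] \<sigma> by (intro mult_right_mono) (auto simp: abs_le_iff)
    finally show ?thesis .
  qed
  have N0: "N \<ge> 0" using N[of 0] norm_ge_zero order_trans by (fastforce simp: T_def)
  show ?thesis
  proof (rule gronwall_zero[where u = "\<lambda>s. el_expr (q s) (c s)" and u' = "\<lambda>\<sigma>. \<Sum>i\<in>Basis. el_variation i (q \<sigma>) (c \<sigma>) *\<^sub>R i" and K = "N / m" and T = T])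
    fix \<sigma> assume \<sigma>: "\<bar>\<sigma>\<bar> \<le> T"
    have "((\<lambda>s. \<Sum>i\<in>Basis. (el_expr (q s) (c s) \<bullet> i) *\<^sub>R i) has_vector_derivative (\<Sum>i\<in>Basis. el_variation i (q \<sigma>) (c \<sigma>) *\<^sub>R i)) (at \<sigma>)"
    proof (rule has_vector_derivative_sum)
      fix i :: 'a assume "i \<in> Basis"
      from el_expr_inner_derivative[where c = c, OF this q(1) q(2) w]
      show "((\<lambda>s. (el_expr (q s) (c s) \<bullet> i) *\<^sub>R i) has_vector_derivative el_variation i (q \<sigma>) (c \<sigma>) *\<^sub>R i) (at \<sigma>)"
        by (auto intro!: derivative_eq_intros)
    qed
    then show "((\<lambda>s. el_expr (q s) (c s)) has_vector_derivative (\<Sum>i\<in>Basis. el_variation i (q \<sigma>) (c \<sigma>) *\<^sub>R i)) (at \<sigma>)"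
      by (simp add: euclidean_representation)
    let ?p = "q \<sigma>"
    \<comment> \<open>The coefficient \<open>l\<close> cancels the second component of
      \<open>hess_op\<close>, so that \<open>hess_op ?p d\<close> is the pair of
      \<open>- el_expr ?p (c \<sigma>)\<close> and 0. Coercivity thus bounds \<open>d\<close> by the
      Euler-Lagrange expression, while the discarded multiple of \<open>y\<close> does not affect
      the variation.\<close>
    define l where "l = fd F ?p (0, c \<sigma> - C ?p) / F ?p"
    define d where "d = c \<sigma> - C ?p - l *\<^sub>R snd ?p"
    have F: "F ?p > 0" using F_pos q(1) by blast
    have "hess_op ?p d = hess_op ?p (c \<sigma> - C ?p) - l *\<^sub>R hess_op ?p (snd ?p)"
      unfolding d_def by (simp add: linear_diff[OF linear_hess_op] linear_scale[OF linear_hess_op])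
    also have "hess_op ?p (snd ?p) = (0, F ?p)" using dFy_radial euler q(1) by (simp add: hess_op_def)
    also have "hess_op ?p (c \<sigma> - C ?p) - l *\<^sub>R (0, F ?p) = (dFy ?p (0, c \<sigma> - C ?p), 0)"
      using F by (simp add: hess_op_def l_def)
    also have "dFy ?p (0, c \<sigma> - C ?p) = - el_expr ?p (c \<sigma>)"
      using linear_diff[OF linear_dFy, of ?p "(snd ?p, c \<sigma>)" "(snd ?p, C ?p)"] C[OF q(1), of \<sigma>]
      by (simp add: el_expr_def)
    finally have "norm (hess_op ?p d) = norm (el_expr ?p (c \<sigma>))" by (simp add: norm_Pair)
    then have d: "norm d \<le> norm (el_expr ?p (c \<sigma>)) / m" using mq[OF \<sigma>, of d] m(1) by (simp add: field_simps)
    have v: "el_variation i ?p (c \<sigma>) = - vertical_var i ?p d" if i: "i \<in> Basis" for i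
      using el_variation_diff[of i ?p "c \<sigma>" "C ?p"] eq[OF q(1) i, of \<sigma>] vertical_var_radial[OF q(1) i, of \<sigma>]
      by (simp add: d_def linear_diff[OF linear_vertical_var] linear_scale[OF linear_vertical_var])
    have "norm (\<Sum>i\<in>Basis. el_variation i ?p (c \<sigma>) *\<^sub>R i) \<le> (\<Sum>i\<in>Basis. \<bar>vertical_var i ?p d\<bar>)"
      by (rule sum_norm_le) (simp add: v)
    also have "\<dots> \<le> N * norm d" by (rule Nb[OF \<sigma>])
    also have "\<dots> \<le> N * (norm (el_expr ?p (c \<sigma>)) / m)" using d N0 by (rule mult_left_mono)
    finally show "norm (\<Sum>i\<in>Basis. el_variation i ?p (c \<sigma>) *\<^sub>R i) \<le> N / m * norm (el_expr ?p (c \<sigma>))" by simp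
  qed (use init in \<open>auto simp: T_def\<close>)
qed

end

theorem theorem3:
  fixes U :: "'a::euclidean_space set"
    and F :: "'a \<times> 'a \<Rightarrow> real"
    and X :: "'a \<Rightarrow> 'a"
    and \<phi> :: "real \<Rightarrow> 'a \<Rightarrow> 'a"
    and C :: "'a \<times> 'a \<Rightarrow> 'a"
  assumes "open U"
    and "finsler_on U F"
    and "\<forall>s\<in>Basis. C_inf_on U (\<lambda>u. X u \<bullet> s)"
    and "global_flow U X \<phi>"
    and "\<forall>x\<in>U. \<forall>y. y \<noteq> 0 \<longrightarrow> (\<forall>i\<in>Basis.
           (\<Sum>k\<in>Basis. fpd (dy k) (fpd (dy i) F) (x, y) * (C (x, y) \<bullet> k))
           = fpd (dx i) F (x, y) - (\<Sum>k\<in>Basis. fpd (dx k) (fpd (dy i) F) (x, y) * (y \<bullet> k)))"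
  shows "(\<forall>I \<gamma> s. open I \<and> is_interval I \<and> I \<noteq> {} \<and> geodesic U F I \<gamma>
            \<longrightarrow> extremal U F I (\<lambda>t. \<phi> s (\<gamma> t)))
         \<longleftrightarrow> (\<forall>x\<in>U. \<forall>y. y \<noteq> 0 \<longrightarrow> (\<forall>i\<in>Basis. flow_eq_lhs F X C i x y = 0))"
proof -
  interpret finsler_field U F X
    using assms(1-3) by unfold_locales auto
  have C: "el_expr p (C p) = 0" if "p \<in> slit" for p
  proof (rule euclidean_eqI)
    fix i :: 'a assume i: "i \<in> Basis"
    show "el_expr p (C p) \<bullet> i = 0 \<bullet> i"
      using assms(5) that i by (cases p) (auto simp: el_expr_def inner_diff_left dFy_inner Fx_inner fd_Pair)
  qed
  have flow: "\<phi> 0 p = p" "\<phi> s p \<in> U" if "p \<in> U" for p s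
    using assms(4) that unfolding global_flow_def by auto
  show ?thesis
  proof (intro iffI allI ballI impI; (elim conjE)?)
    fix x y i
    assume G: "\<forall>I \<gamma> s. open I \<and> is_interval I \<and> I \<noteq> {} \<and> geodesic U F I \<gamma>
            \<longrightarrow> extremal U F I (\<lambda>t. \<phi> s (\<gamma> t))"
      and x: "x \<in> U" and y: "y \<noteq> (0::'a)" and i: "i \<in> (Basis::'a set)"
    obtain \<delta> \<gamma> \<gamma>' \<gamma>'' where \<delta>: "\<delta> > 0" and geo: "geodesic U F {-\<delta><..<\<delta>} \<gamma>"
      and U: "\<And>t. t \<in> {-\<delta><..<\<delta>} \<Longrightarrow> \<gamma> t \<in> U" and nz: "\<And>t. t \<in> {-\<delta><..<\<delta>} \<Longrightarrow> \<gamma>' t \<noteq> 0"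
      and g: "\<And>t. t \<in> {-\<delta><..<\<delta>} \<Longrightarrow> (\<gamma> has_vector_derivative \<gamma>' t) (at t)"
        "\<And>t. t \<in> {-\<delta><..<\<delta>} \<Longrightarrow> (\<gamma>' has_vector_derivative \<gamma>'' t) (at t)" 
        "continuous_on {-\<delta><..<\<delta>} \<gamma>''"
      and init: "\<gamma> 0 = x" "\<gamma>' 0 = y" "\<gamma>'' 0 = spray C (x, y)"
      using geodesic_exists[where C = C, OF x y C] by blast
    define I where "I = {-\<delta><..<\<delta>}"
    have I: "open I" "is_interval I" "I \<noteq> {}" "0 \<in> I" using \<delta> by (auto simp: I_def is_interval_oo)
    note geo = geo[folded I_def] and U = U[folded I_def] and nz = nz[folded I_def] and g = g[folded I_def]
    obtain b c where b0: "\<And>t. t \<in> I \<Longrightarrow> b t 0 = \<gamma>' t" and c0: "\<And>t. t \<in> I \<Longrightarrow> c t 0 = \<gamma>'' t"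
      and b: "\<And>t s. t \<in> I \<Longrightarrow> ((\<lambda>t. \<phi> s (\<gamma> t)) has_vector_derivative b t s) (at t)"
      and c: "\<And>t s. t \<in> I \<Longrightarrow> ((\<lambda>t. b t s) has_vector_derivative c t s) (at t)"
      and cc: "\<And>s. continuous_on I (\<lambda>t. c t s)"
      and q: "\<And>t s. t \<in> I \<Longrightarrow> ((\<lambda>s. (\<phi> s (\<gamma> t), b t s)) has_vector_derivative X1 (\<phi> s (\<gamma> t), b t s)) (at s)"
      and w: "\<And>t s. t \<in> I \<Longrightarrow> ((\<lambda>s. (b t s, c t s)) has_vector_derivative DX1 (\<phi> s (\<gamma> t), b t s) (b t s, c t s)) (at s)"
      and bnz: "\<And>t s. t \<in> I \<Longrightarrow> b t s = 0 \<Longrightarrow> \<gamma>' t = 0"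
      using flow_prolongation[OF assms(4) I(1) U g] by blast
    have "el_expr (\<phi> s (\<gamma> t), b t s) (c t s) = 0" if t: "t \<in> I" for t s
    proof -
      have "extremal U F I (\<lambda>t. \<phi> s (\<gamma> t))" using G I geo by blast
      \<comment> \<open>By \<open>bnz\<close> the transported velocity never vanishes, so the
        characterisation of extremals applies for every \<open>s\<close>.\<close>
      then show ?thesis using extremal_iff[OF I(1) flow(2)[OF U] b c cc] nz bnz t by blast
    qed
    \<comment> \<open>The expression vanishes for all \<open>s\<close>, so its derivative at 0,
      computed next as the variation, is zero. Only \<open>t = 0\<close> matters, where the 2-jet is
      \<open>x\<close>, \<open>y\<close>, \<open>spray C (x, y)\<close>.\<close>
    then have "((\<lambda>s. el_expr (\<phi> s (\<gamma> 0), b 0 s) (c 0 s) \<bullet> i) has_real_derivative 0) (at 0)"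
      using I(4) by simp
    moreover have "((\<lambda>s. el_expr (\<phi> s (\<gamma> 0), b 0 s) (c 0 s) \<bullet> i) has_real_derivative 
        el_variation i (\<phi> 0 (\<gamma> 0), b 0 0) (c 0 0)) (at 0)"
    proof (rule el_expr_inner_derivative[where q = "\<lambda>s. (\<phi> s (\<gamma> 0), b 0 s)" and c = "c 0", OF i _ q[OF I(4)]])
      show "(\<phi> 0 (\<gamma> 0), b 0 0) \<in> slit" using flow x init b0[OF I(4)] y by simp
    qed (use w[OF I(4), of 0] in simp)
    ultimately have "el_variation i (\<phi> 0 (\<gamma> 0), b 0 0) (c 0 0) = 0" using DERIV_unique by blast
    then have "el_variation i (x, y) (spray C (x, y)) = 0"
      using b0[OF I(4)] c0[OF I(4)] init flow(1)[OF x] by simp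
    then show "flow_eq_lhs F X C i x y = 0"
      using flow_eq_lhs_eq_el_variation[OF x y i] el_variation_spray[of "(x, y)" i C] x y i by simp
  next
    fix I \<gamma> s
    assume E: "\<forall>x\<in>U. \<forall>y. y \<noteq> 0 \<longrightarrow> (\<forall>i\<in>Basis. flow_eq_lhs F X C i x y = 0)"
      and I: "open I" "is_interval I" "I \<noteq> {}" and geo: "geodesic U F I \<gamma>"
    have ext: "extremal U F I \<gamma>" using geo unfolding geodesic_def by blast
    then obtain \<gamma>' \<gamma>'' where g: "\<And>t. t \<in> I \<Longrightarrow> (\<gamma> has_vector_derivative \<gamma>' t) (at t)"
        "\<And>t. t \<in> I \<Longrightarrow> (\<gamma>' has_vector_derivative \<gamma>'' t) (at t)" "continuous_on I \<gamma>''"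
      unfolding extremal_def C2_curve_def by blast
    have U: "\<gamma> t \<in> U" if "t \<in> I" for t using ext that unfolding extremal_def by blast
    have nz: "\<gamma>' t \<noteq> 0" if t: "t \<in> I" for t
    proof
      assume z: "\<gamma>' t = 0"
      have "vector_derivative \<gamma> (at t) = \<gamma>' t" using g(1)[OF t] by (rule vector_derivative_at)
      then have "F (\<gamma> t, 0) > 0" using geo t z unfolding geodesic_def by auto
      \<comment> \<open>Positivity of \<open>F\<close> is postulated only off the zero vector;
        homogeneity with factor 2 forces the value 0 there, against the positive speed of a
        geodesic.\<close>
      moreover have "F (\<gamma> t, 2 *\<^sub>R 0) = 2 * F (\<gamma> t, 0)" by (rule F_hom[OF U[OF t]]) simp
      ultimately show False by simp
    qed
    have el: "el_expr (\<gamma> t, \<gamma>' t) (\<gamma>'' t) = 0" if "t \<in> I" for t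
      using extremal_iff[OF I(1) U g nz] ext that by blast
    obtain b c where b0: "\<And>t. t \<in> I \<Longrightarrow> b t 0 = \<gamma>' t" and c0: "\<And>t. t \<in> I \<Longrightarrow> c t 0 = \<gamma>'' t"
      and b: "\<And>t s. t \<in> I \<Longrightarrow> ((\<lambda>t. \<phi> s (\<gamma> t)) has_vector_derivative b t s) (at t)"
      and c: "\<And>t s. t \<in> I \<Longrightarrow> ((\<lambda>t. b t s) has_vector_derivative c t s) (at t)"
      and cc: "\<And>s. continuous_on I (\<lambda>t. c t s)"
      and q: "\<And>t s. t \<in> I \<Longrightarrow> ((\<lambda>s. (\<phi> s (\<gamma> t), b t s)) has_vector_derivative X1 (\<phi> s (\<gamma> t), b t s)) (at s)"
      and w: "\<And>t s. t \<in> I \<Longrightarrow> ((\<lambda>s. (b t s, c t s)) has_vector_derivative DX1 (\<phi> s (\<gamma> t), b t s) (b t s, c t s)) (at s)"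
      and bnz: "\<And>t s. t \<in> I \<Longrightarrow> b t s = 0 \<Longrightarrow> \<gamma>' t = 0"
      using flow_prolongation[OF assms(4) I(1) U g] by blast
    have bn: "b t s \<noteq> 0" if "t \<in> I" for t s using bnz[OF that] nz[OF that] by blast
    have "el_expr (\<phi> s (\<gamma> t), b t s) (c t s) = 0" if t: "t \<in> I" for t
    proof (rule el_expr_vanishes_along_flow[where q = "\<lambda>s. (\<phi> s (\<gamma> t), b t s)" and c = "c t", OF _ q[OF t] _ C])
      show "(\<phi> s (\<gamma> t), b t s) \<in> slit" for s using flow(2)[OF U[OF t]] bn[OF t] by simp
      show "el_variation i p (C p) = 0" if "p \<in> slit" "i \<in> Basis" for p i
        using E flow_eq_lhs_eq_el_variation[of "fst p" "snd p" i C] that by (auto simp: mem_Times_iff)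
      show "el_expr (\<phi> 0 (\<gamma> t), b t 0) (c t 0) = 0"
        using el[OF t] b0[OF t] c0[OF t] flow(1)[OF U[OF t]] by simp
    qed (use w[OF t] in simp_all)
    then show "extremal U F I (\<lambda>t. \<phi> s (\<gamma> t))"
      using extremal_iff[OF I(1) flow(2)[OF U] b c cc bn] by blast
  qed
qed

end
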